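(* Let $U,V$ be Banach spaces over $\mathbb{K}\in\{\mathbb{R},\mathbb{C}\}$, $\Omega\subset\mathbb{K}$ open, $\lambda_0\in\Omega$, $\mathfrak{L}\in\mathcal{C}^1(\Omega,\Phi_0(U,V))$, and $\mathfrak{N}\in\mathcal{C}^1(\Omega\times U,V)$ with $\mathfrak{N}(\lambda,0)=0$ and $D_u\mathfrak{N}(\lambda,0)=0$ for $\lambda$ near $\lambda_0$. Consider $\mathscr{F}(\lambda,u)=\mathfrak{L}(\lambda)u+\mathfrak{N}(\lambda,u)$ and a pair $(P,Q)$ of $\mathfrak{L}(\lambda_0)$-projections. Writing $u=x+y$ with $x=Pu\in N[\mathfrak{L}(\lambda_0)]$ and $y=(I_U-P)u$, there exist a neighborhood $\mathcal{U}$ of $(\lambda_0,0)$ in $\mathbb{K}\times N[\mathfrak{L}(\lambda_0)]$ and a unique $\mathcal{C}^1$ map $\mathscr{Y}:\mathcal{U}\to R[I_U-P]$ with $\mathscr{Y}(\lambda,0)=0$ and $Q\mathscr{F}(\lambda,x+\mathscr{Y}(\lambda,x))=0$ on $\mathcal{U}$ (giving locally all zeros of $Q\mathscr{F}$), and $D_x\mathscr{Y}(\lambda,0)=-L_{11}^{-1}(\lambda)L_{12}(\lambda)$. Moreover, the linearization at $x=0$ of the bifurcation equation $(I_V-Q)\mathscr{F}(\lambda,x+\mathscr{Y}(\lambda,x))=0$, namely $$\mathscr{B}(\lambda)x:=(I_V-Q)\mathfrak{L}(\lambda)\big(x+D_x\mathscr{Y}(\lambda,0)x\big),\qquad x\in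 N[\mathfrak{L}(\lambda_0)],$$ satisfies, for $\lambda$ near $\lambda_0$, $$\mathscr{B}(\lambda)=L_{22}(\lambda)-L_{21}(\lambda)L_{11}^{-1}(\lambda)L_{12}(\lambda).$$ Consequently, if in addition $\mathfrak{L}\in\mathcal{A}_{\lambda_0}(\Omega,\Phi_0(U,V))$, then $\chi[\mathfrak{L},\lambda_0]=\operatorname{ord}_{\lambda_0}\det\mathscr{B}(\lambda)$ for every pair $(P,Q)$ of $\mathfrak{L}(\lambda_0)$-projections.
   Context: $\Phi_0(U,V)$: Fredholm operators of index zero. A pair of $T$-projections: bounded projections $P$ onto $N[T]$ and $Q$ onto $R[T]$. $L_{11}(\lambda)=Q\mathfrak{L}(\lambda)(I_U-P)$ (invertible from $R[I_U-P]$ to $R[\mathfrak{L}(\lambda_0)]$ for $\lambda$ near $\lambda_0$), $L_{12}(\lambda)=Q\mathfrak{L}(\lambda)P$, $L_{21}(\lambda)=(I_V-Q)\mathfrak{L}(\lambda)(I_U-P)$, $L_{22}(\lambda)=(I_V-Q)\mathfrak{L}(\lambda)P$. $\mathcal{A}_{\lambda_0}(\Omega,\Phi_0(U,V))$: paths $\mathfrak{L}\in\mathcal{C}^r$ ($r\in\mathbb{N}$) such that for some $1\le\kappa\le r$ and $\varepsilon,C>0$, $\mathfrak{L}(\lambda)$ is invertible with $\|\mathfrak{L}^{-1}(\lambda)\|<C|\lambda-\lambda_0|^{-\kappa}$ for $0<|\lambda-\lambda_0|<\varepsilon$. $\chi[\mathfrak{L},\lambda_0]$ is the generalized algebraic multiplicity: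 if $\lambda_0$ is $\kappa$-transversal, i.e. with $\mathfrak{L}_j=\frac1{j!}\mathfrak{L}^{(j)}(\lambda_0)$, $\bigoplus_{j=1}^\kappa\mathfrak{L}_j(\bigcap_{i<j}N[\mathfrak{L}_i])\oplus R[\mathfrak{L}_0]=V$ and $\mathfrak{L}_\kappa(\bigcap_{i<\kappa}N[\mathfrak{L}_i])\ne\{0\}$, then $\chi=\sum_{j=1}^\kappa j\dim\mathfrak{L}_j(\bigcap_{i<j}N[\mathfrak{L}_i])$; in general $\chi[\mathfrak{L},\lambda_0]=\chi[\mathfrak{L}\circ\Phi,\lambda_0]$ for any polynomial $\Phi$ with $\Phi(\lambda_0)=I_U$ transversalizing $\lambda_0$ (exists, independent of $\Phi$); in finite dimensions $\chi=\operatorname{ord}_{\lambda_0}\det\mathfrak{L}$. *)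

theory Defs
  imports "HOL-Analysis.Analysis"
begin

text \<open>The scalar field K is a type 'k of class real_normed_field and banach
(these are exactly R and C up to isomorphism). A K-Banach space is a real Banach
space type together with a K-scalar multiplication s extending the real one.\<close>

definition kspace :: "('k::real_normed_field \<Rightarrow> 'u::real_normed_vector \<Rightarrow> 'u) \<Rightarrow> bool" where
  "kspace s \<longleftrightarrow>
     (\<forall>r x. s (of_real r) x = r *\<^sub>R x) \<and>
     (\<forall>a b x. s (a * b) x = s a (s b x)) \<and>
     (\<forall>a b x. s (a + b) x = s a x + s b x) \<and>
     (\<forall>a x y. s a (x + y) = s a x + s a y) \<and>
     (\<forall>a x. norm (s a x) = norm a * norm x)"

definition kbl :: "('k::real_normed_field \<Rightarrow> 'u::real_normed_vector \<Rightarrow> 'u) \<Rightarrow>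
                   ('k \<Rightarrow> 'v::real_normed_vector \<Rightarrow> 'v) \<Rightarrow> ('u \<Rightarrow> 'v) \<Rightarrow> bool" where
  "kbl sU sV T \<longleftrightarrow> bounded_linear T \<and> (\<forall>a x. T (sU a x) = sV a (T x))"

definition bscale :: "('k::real_normed_field \<Rightarrow> 'v::real_normed_vector \<Rightarrow> 'v) \<Rightarrow> 'k \<Rightarrow>
                      ('u::real_normed_vector \<Rightarrow>\<^sub>L 'v) \<Rightarrow> ('u \<Rightarrow>\<^sub>L 'v)" where
  "bscale sV a T = Blinfun (\<lambda>x. sV a (blinfun_apply T x))"

definition pscale :: "('k \<Rightarrow> 'a \<Rightarrow> 'a) \<Rightarrow> ('k \<Rightarrow> 'b \<Rightarrow> 'b) \<Rightarrow> 'k \<Rightarrow> 'a \<times> 'b \<Rightarrow> 'a \<times> 'b" where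
  "pscale sa sb a p = (sa a (fst p), sb a (snd p))"

definition kfindim :: "('k::field \<Rightarrow> 'u::ab_group_add \<Rightarrow> 'u) \<Rightarrow> 'u set \<Rightarrow> bool" where
  "kfindim s S \<longleftrightarrow> module.subspace s S \<and> (\<exists>B. finite B \<and> B \<subseteq> S \<and> module.span s B = S)"

definition fredholm0 :: "('k::real_normed_field \<Rightarrow> 'u::real_normed_vector \<Rightarrow> 'u) \<Rightarrow>
                         ('k \<Rightarrow> 'v::real_normed_vector \<Rightarrow> 'v) \<Rightarrow> ('u \<Rightarrow> 'v) \<Rightarrow> bool" where
  "fredholm0 sU sV T \<longleftrightarrow> kbl sU sV T \<and>
     kfindim sU {x. T x = 0} \<and> closed (range T) \<and>
     (\<exists>W. kfindim sV W \<and> W \<inter> range T = {0} \<and> (\<forall>v. \<exists>w\<in>W. \<exists>z\<in>range T. v = w + z) \<and>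
          vector_space.dim sV W = vector_space.dim sU {x. T x = 0})"

definition kproj :: "('k::real_normed_field \<Rightarrow> 'u::real_normed_vector \<Rightarrow> 'u) \<Rightarrow> ('u \<Rightarrow> 'u) \<Rightarrow> 'u set \<Rightarrow> bool" where
  "kproj s P S \<longleftrightarrow> kbl s s P \<and> (\<forall>x. P (P x) = P x) \<and> range P = S"

definition tproj_pair :: "('k::real_normed_field \<Rightarrow> 'u::real_normed_vector \<Rightarrow> 'u) \<Rightarrow>
     ('k \<Rightarrow> 'v::real_normed_vector \<Rightarrow> 'v) \<Rightarrow> ('u \<Rightarrow> 'v) \<Rightarrow> ('u \<Rightarrow> 'u) \<Rightarrow> ('v \<Rightarrow> 'v) \<Rightarrow> bool" where
  "tproj_pair sU sV T P Q \<longleftrightarrow> kproj sU P {x. T x = 0} \<and> kproj sV Q (range T)"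

definition kC1_on :: "('k::real_normed_field \<Rightarrow> 'a::real_normed_vector \<Rightarrow> 'a) \<Rightarrow>
     ('k \<Rightarrow> 'b::real_normed_vector \<Rightarrow> 'b) \<Rightarrow> 'a set \<Rightarrow> ('a \<Rightarrow> 'b) \<Rightarrow> bool" where
  "kC1_on sa sb S F \<longleftrightarrow> (\<exists>F'::'a \<Rightarrow> ('a \<Rightarrow>\<^sub>L 'b).
      (\<forall>p\<in>S. (F has_derivative blinfun_apply (F' p)) (at p within S) \<and>
              (\<forall>a h. F' p (sa a h) = sb a (F' p h))) \<and>
      continuous_on S F')"

definition kCr :: "('k::real_normed_field \<Rightarrow> 'u::real_normed_vector \<Rightarrow> 'u) \<Rightarrow>
     ('k \<Rightarrow> 'v::real_normed_vector \<Rightarrow> 'v) \<Rightarrow> 'k set \<Rightarrow> nat \<Rightarrow> ('k \<Rightarrow> ('u \<Rightarrow>\<^sub>L 'v)) \<Rightarrow>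
     (nat \<Rightarrow> 'k \<Rightarrow> ('u \<Rightarrow>\<^sub>L 'v)) \<Rightarrow> bool" where
  "kCr sU sV \<Omega> r L Ls \<longleftrightarrow>
     (\<forall>lam\<in>\<Omega>. Ls 0 lam = L lam) \<and>
     (\<forall>j<r. \<forall>lam\<in>\<Omega>. (Ls j has_derivative (\<lambda>h. bscale sV h (Ls (Suc j) lam))) (at lam)) \<and>
     (\<forall>j\<le>r. continuous_on \<Omega> (Ls j)) \<and>
     (\<forall>j\<le>r. \<forall>lam\<in>\<Omega>. kbl sU sV (blinfun_apply (Ls j lam)))"

definition kerint :: "(nat \<Rightarrow> 'u \<Rightarrow> 'v::zero) \<Rightarrow> nat \<Rightarrow> 'u set" where
  "kerint M j = {x. \<forall>i<j. M i x = 0}"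

definition Tsp :: "(nat \<Rightarrow> 'u \<Rightarrow> 'v::zero) \<Rightarrow> nat \<Rightarrow> 'v set" where
  "Tsp M j = M j ` kerint M j"

text \<open>kappa-transversality of lambda_0 for the family with Taylor coefficients M j:
V = M_1(..) (+) ... (+) M_kappa(..) (+) R[M_0] (direct sum), M_kappa(..) ~= {0}.\<close>
definition transversal :: "(nat \<Rightarrow> 'u \<Rightarrow> 'v::comm_monoid_add) \<Rightarrow> nat \<Rightarrow> bool" where
  "transversal M \<kappa> \<longleftrightarrow>
     (1 \<le> \<kappa> \<longrightarrow> Tsp M \<kappa> \<noteq> {0}) \<and>
     (\<forall>v. \<exists>!w::nat \<Rightarrow> 'v. w 0 \<in> range (M 0) \<and> (\<forall>j\<in>{1..\<kappa>}. w j \<in> Tsp M j) \<and>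
                         (\<forall>j>\<kappa>. w j = 0) \<and> v = (\<Sum>j\<le>\<kappa>. w j))"

definition tmult :: "('k::field \<Rightarrow> 'v::ab_group_add \<Rightarrow> 'v) \<Rightarrow> (nat \<Rightarrow> 'u \<Rightarrow> 'v) \<Rightarrow> nat \<Rightarrow> nat" where
  "tmult sV M \<kappa> = (\<Sum>j=1..\<kappa>. j * vector_space.dim sV (Tsp M j))"

text \<open>Polynomial Phi(lam) = sum_b (lam - lam0)^b Phi_b with Phi_0 = I_U (coefficients
bounded K-linear, finitely many nonzero).\<close>
definition kpoly_id :: "('k::real_normed_field \<Rightarrow> 'u::real_normed_vector \<Rightarrow> 'u) \<Rightarrow> (nat \<Rightarrow> 'u \<Rightarrow> 'u) \<Rightarrow> bool" where
  "kpoly_id sU Phi \<longleftrightarrow> Phi 0 = id \<and> (\<forall>b. kbl sU sU (Phi b)) \<and> (\<exists>m. \<forall>b>m. Phi b = (\<lambda>x. 0))"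

text \<open>Taylor coefficients at lam0 of lam |-> L(lam) Phi(lam) (Leibniz rule).\<close>
definition prod_taylor :: "(nat \<Rightarrow> 'k \<Rightarrow> ('u::real_normed_vector \<Rightarrow>\<^sub>L 'v::real_normed_vector)) \<Rightarrow>
     'k \<Rightarrow> (nat \<Rightarrow> 'u \<Rightarrow> 'u) \<Rightarrow> nat \<Rightarrow> 'u \<Rightarrow> 'v" where
  "prod_taylor Ls lam0 Phi j x =
     (\<Sum>b\<le>j. blinfun_apply ((inverse (fact (j - b)) :: real) *\<^sub>R Ls (j - b) lam0) (Phi b x))"

definition alg_mult :: "('k::real_normed_field \<Rightarrow> 'u::real_normed_vector \<Rightarrow> 'u) \<Rightarrow>
     ('k \<Rightarrow> 'v::real_normed_vector \<Rightarrow> 'v) \<Rightarrow> 'k set \<Rightarrow> nat \<Rightarrow> ('k \<Rightarrow> ('u \<Rightarrow>\<^sub>L 'v)) \<Rightarrow> 'k \<Rightarrow> nat" where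
  "alg_mult sU sV \<Omega> r L lam0 = (THE c. \<exists>Ls Phi \<kappa>.
      kCr sU sV \<Omega> r L Ls \<and> kpoly_id sU Phi \<and> \<kappa> \<le> r \<and>
      transversal (prod_taylor Ls lam0 Phi) \<kappa> \<and> c = tmult sV (prod_taylor Ls lam0 Phi) \<kappa>)"

definition classA :: "('k::real_normed_field \<Rightarrow> 'u::real_normed_vector \<Rightarrow> 'u) \<Rightarrow>
     ('k \<Rightarrow> 'v::real_normed_vector \<Rightarrow> 'v) \<Rightarrow> 'k set \<Rightarrow> 'k \<Rightarrow> nat \<Rightarrow> ('k \<Rightarrow> ('u \<Rightarrow>\<^sub>L 'v)) \<Rightarrow> bool" where
  "classA sU sV \<Omega> lam0 r L \<longleftrightarrow> 1 \<le> r \<and> (\<exists>Ls. kCr sU sV \<Omega> r L Ls) \<and>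
     (\<forall>lam\<in>\<Omega>. fredholm0 sU sV (blinfun_apply (L lam))) \<and>
     (\<exists>\<kappa> \<epsilon> C. 1 \<le> \<kappa> \<and> \<kappa> \<le> r \<and> \<epsilon> > 0 \<and> C > 0 \<and> ball lam0 \<epsilon> \<subseteq> \<Omega> \<and>
        (\<forall>lam. 0 < dist lam lam0 \<and> dist lam lam0 < \<epsilon> \<longrightarrow>
           bij (blinfun_apply (L lam)) \<and> bounded_linear (inv (blinfun_apply (L lam))) \<and>
           onorm (inv (blinfun_apply (L lam))) < C / norm (lam - lam0) ^ \<kappa>))"

definition kbasis :: "('k::field \<Rightarrow> 'u::ab_group_add \<Rightarrow> 'u) \<Rightarrow> 'u set \<Rightarrow> nat \<Rightarrow> (nat \<Rightarrow> 'u) \<Rightarrow> bool" where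
  "kbasis s S n e \<longleftrightarrow> inj_on e {..<n} \<and> \<not> module.dependent s (e ` {..<n}) \<and>
                      module.span s (e ` {..<n}) = S"

definition coords :: "('k::field \<Rightarrow> 'u::ab_group_add \<Rightarrow> 'u) \<Rightarrow> nat \<Rightarrow> (nat \<Rightarrow> 'u) \<Rightarrow> 'u \<Rightarrow> nat \<Rightarrow> 'k" where
  "coords s n f v = (THE c. v = (\<Sum>i<n. s (c i) (f i)) \<and> (\<forall>i\<ge>n. c i = 0))"

definition ldet :: "nat \<Rightarrow> (nat \<Rightarrow> nat \<Rightarrow> 'k::comm_ring_1) \<Rightarrow> 'k" where
  "ldet n M = (\<Sum>p | p permutes {..<n}. of_int (sign p) * (\<Prod>i<n. M i (p i)))"

definition map_det :: "('k::field \<Rightarrow> 'v::ab_group_add \<Rightarrow> 'v) \<Rightarrow> nat \<Rightarrow> (nat \<Rightarrow> 'u) \<Rightarrow> (nat \<Rightarrow> 'v) \<Rightarrow> ('u \<Rightarrow> 'v) \<Rightarrow> 'k" where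
  "map_det sV n e f B = ldet n (\<lambda>i j. coords sV n f (B (e j)) i)"

definition has_order :: "('k::real_normed_field \<Rightarrow> 'k) \<Rightarrow> 'k \<Rightarrow> nat \<Rightarrow> bool" where
  "has_order f lam0 k \<longleftrightarrow> (\<exists>g \<delta>. \<delta> > 0 \<and> continuous (at lam0) g \<and> g lam0 \<noteq> 0 \<and>
      (\<forall>lam. dist lam lam0 < \<delta> \<longrightarrow> f lam = (lam - lam0) ^ k * g lam))"

end

theory Submission
  imports Defs "Jordan_Normal_Form.Determinant"
begin

text \<open>The partial inverse \<open>S = L\<^sub>1\<^sub>1(\<lambda>\<^sub>0)\<^sup>-\<^sup>1 Q\<close> turns \<open>Q F(\<lambda>, u) = 0\<close>, \<open>P u = x\<close> into the single
  equation \<open>P u + S F(\<lambda>, u) = x\<close>, whose left-hand side has derivative the identity at \<open>(\<lambda>\<^sub>0, 0)\<close>, so the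
  inverse function theorem in Banach spaces yields \<open>x + Y(\<lambda>, x)\<close> and its derivative.

  For the multiplicity, let \<open>u\<^sub>i(\<lambda>)\<close> be polynomials whose values at \<open>\<lambda>\<^sub>0\<close> form a basis of the kernel and
  with \<open>L u\<^sub>i = (\<lambda> - \<lambda>\<^sub>0)\<^bsup>j\<^sub>i\<^esup> w\<^sub>i\<close>, where the \<open>w\<^sub>i(\<lambda>\<^sub>0)\<close> form a basis modulo the range of \<open>L(\<lambda>\<^sub>0)\<close>.
  Then \<open>B(\<lambda>) P u\<^sub>i\<close> is \<open>(\<lambda> - \<lambda>\<^sub>0)\<^bsup>j\<^sub>i\<^esup>\<close> times a vector tending to \<open>(I - Q) w\<^sub>i(\<lambda>\<^sub>0)\<close>, so
  \<open>det B\<close> has order \<open>\<Sum> j\<^sub>i\<close>. Every transversalization provides such a system with \<open>\<Sum> j\<^sub>i\<close> equal to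
  its multiplicity, so the multiplicity does not depend on it. One exists: the bound on
  \<open>L\<^sup>-\<^sup>1\<close> bounds the lengths \<open>j\<^sub>i\<close>, and a system with \<open>\<Sum> j\<^sub>i\<close> maximal is transversal.\<close>

section \<open>Open mapping and inverse function theorems\<close>

text \<open>Derivatives and the inverse function theorem are taken over the reals: a K-Banach space
  is a real one with an extra multiplication, so the K-linearity of each derivative is a separate
  fact that must be carried through every inversion. The open mapping theorem enters through the
  boundedness of S. The multiplicity is a definite description over all \<open>Ls\<close>,
  \<open>Phi\<close> and \<open>\<kappa>\<close>, so that evaluating it needs both existence and
  uniqueness of the described number. Uniqueness comes from det B, which mentions none of the three.
  L is merely of class C^r and Y of class C^1, so neither L nor B has a power series in t - a.
  Divisibility replaces expansion: a path in V is written as (t - a)^j w(t) with w continuous at a.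
  The remainder o((t - a)^r) of Taylor's formula can be absorbed in w because all exponents that
  occur are at most r.\<close>

lemma approximate_preimages_if_surj:
  fixes T :: "'a::banach \<Rightarrow> 'b::banach"
  assumes T: "bounded_linear T" and surj: "surj T"
  shows "\<exists>K>0. \<forall>y. \<exists>x. norm x \<le> K * norm y \<and> norm (y - T x) \<le> norm y / 2"
proof -
  interpret T: bounded_linear T by fact
  let ?G = "range (\<lambda>n::nat. closure (T ` ball 0 (real n)))"
  have cover: "\<Union>?G = UNIV"
  proof -
    have "y \<in> \<Union>?G" for y
    proof -
      obtain x where "y = T x" using surj by blast
      moreover obtain n :: nat where "norm x < real n" using reals_Archimedean2 by blast
      ultimately have "y \<in> T ` ball 0 (real n)" by auto
      then have "y \<in> closure (T ` ball 0 (real n))" by (rule subsetD[OF closure_subset])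
      then show ?thesis by (rule UN_I[OF UNIV_I])
    qed
    then show ?thesis by blast
  qed
  have "\<exists>n::nat. interior (closure (T ` ball 0 (real n))) \<noteq> {}"
  proof (rule ccontr)
    assume "\<not> ?thesis"
    then have "euclidean interior_of \<Union>?G = {}"
      by (intro Baire_category_alt)
         (auto simp: completely_metrizable_space_euclidean closed_closedin[symmetric])
    then show False unfolding cover by simp
  qed
  then obtain n :: nat and y0 where "y0 \<in> interior (closure (T ` ball 0 (real n)))" by blast
  then obtain \<epsilon> where \<epsilon>: "\<epsilon> > 0" "ball y0 \<epsilon> \<subseteq> closure (T ` ball 0 (real n))"
    unfolding mem_interior by blast
  have near: "\<exists>x. norm x \<le> 2 * real n \<and> norm (y - T x) \<le> \<delta>"
    if y: "norm y < \<epsilon>" and \<delta>: "\<delta> > 0" for y \<delta>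
  proof -
    have "y0 + y \<in> closure (T ` ball 0 (real n))" "y0 \<in> closure (T ` ball 0 (real n))"
      using \<epsilon> y by (auto simp: dist_norm subset_iff)
    then obtain x1 x2 where x: "norm x1 < real n" "dist (T x1) (y0 + y) < \<delta>/2"
       "norm x2 < real n" "dist (T x2) y0 < \<delta>/2"
      unfolding closure_approachable using \<delta> by (auto dest!: spec[of _ "\<delta>/2"] simp: less_imp_le)
    have "y - T (x1 - x2) = (y0 + y - T x1) - (y0 - T x2)" by (simp add: T.diff)
    also have "norm \<dots> \<le> norm (y0 + y - T x1) + norm (y0 - T x2)" by (rule norm_triangle_ineq4)
    also have "\<dots> \<le> \<delta>" using x by (simp add: dist_norm norm_minus_commute)
    finally have "norm (y - T (x1 - x2)) \<le> \<delta>" .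
    moreover have "norm (x1 - x2) \<le> 2 * real n" using norm_triangle_ineq4[of x1 x2] x by simp
    ultimately show ?thesis by blast
  qed
  \<comment> \<open>The factor a below scales y to norm \<epsilon>/2. An error \<epsilon>/4 becomes
    \<open>norm y / 2\<close> after scaling back, and the bound 2n becomes 4n \<open>norm y\<close>
    / \<epsilon>. The summand 1 keeps K positive for n = 0.\<close>
  define K where "K = 4 * (real n + 1) / \<epsilon>"
  have "\<exists>x. norm x \<le> K * norm y \<and> norm (y - T x) \<le> norm y / 2" for y
  proof (cases "y = 0")
    case True then show ?thesis by (intro exI[of _ 0]) (simp add: T.zero)
  next
    case False
    define a where "a = \<epsilon> / (2 * norm y)"
    have a: "a > 0" using False \<epsilon> by (simp add: a_def)
    have "norm (a *\<^sub>R y) < \<epsilon>" using False \<epsilon> by (simp add: a_def)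
    then obtain x where x: "norm x \<le> 2 * real n" "norm (a *\<^sub>R y - T x) \<le> \<epsilon> / 4"
      using near[of "a *\<^sub>R y" "\<epsilon>/4"] \<epsilon> by auto
    have "norm (x /\<^sub>R a) = norm x / a" using a by (simp add: divide_inverse mult.commute)
    also have "\<dots> \<le> 2 * real n / a" using x a by (simp add: divide_right_mono)
    also have "\<dots> \<le> K * norm y" using \<epsilon> False by (simp add: K_def a_def field_simps)
    finally have 1: "norm (x /\<^sub>R a) \<le> K * norm y" .
    have "y - T (x /\<^sub>R a) = (a *\<^sub>R y - T x) /\<^sub>R a"
      using a by (simp add: T.scaleR scaleR_diff_right)
    then have "norm (y - T (x /\<^sub>R a)) = norm (a *\<^sub>R y - T x) / a"
      using a by (simp add: divide_inverse mult.commute)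
    also have "\<dots> \<le> \<epsilon> / 4 / a" by (rule divide_right_mono) (use x a in auto)
    also have "\<dots> = norm y / 2" using \<epsilon> False by (simp add: a_def field_simps)
    finally show ?thesis using 1 by blast
  qed
  moreover have "K > 0" using \<epsilon> by (simp add: K_def)
  ultimately show ?thesis by blast
qed

text \<open>Approximate preimages are taken of the successive residuals. Each residual has at most
  half the norm of the previous one, so the corrections form an absolutely convergent series whose
  sum is an exact preimage, at the cost of doubling K.\<close>

theorem open_mapping_bound:
  fixes T :: "'a::banach \<Rightarrow> 'b::banach"
  assumes T: "bounded_linear T" and surj: "surj T"
  shows "\<exists>C>0. \<forall>y. \<exists>x. T x = y \<and> norm x \<le> C * norm y"
proof -
  interpret T: bounded_linear T by fact
  obtain K where K: "K > 0" "\<And>y. \<exists>x. norm x \<le> K * norm y \<and> norm (y - T x) \<le> norm y / 2"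
    using approximate_preimages_if_surj[OF assms] by blast
  obtain g where g: "\<And>y. norm (g y) \<le> K * norm y" "\<And>y. norm (y - T (g y)) \<le> norm y / 2"
    using K(2) by metis
  have "\<exists>x. T x = y \<and> norm x \<le> (2 * K) * norm y" for y
  proof -
    define r where "r k = ((\<lambda>z. z - T (g z)) ^^ k) y" for k
    have r0: "r 0 = y" and rS: "r (Suc k) = r k - T (g (r k))" for k by (simp_all add: r_def)
    have rb: "norm (r k) \<le> norm y * (1/2) ^ k" for k
    proof (induction k)
      case (Suc k)
      have "norm (r (Suc k)) \<le> norm (r k) / 2" unfolding rS by (rule g)
      also have "\<dots> \<le> norm y * (1/2) ^ Suc k" using Suc by simp
      finally show ?case .
    qed (simp add: r0)
    have gb: "norm (g (r k)) \<le> K * norm y * (1/2) ^ k" for k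
    proof -
      have "norm (g (r k)) \<le> K * norm (r k)" by (rule g)
      also have "\<dots> \<le> K * (norm y * (1/2) ^ k)" using rb K by (intro mult_left_mono) auto
      finally show ?thesis by simp
    qed
    have geo: "(\<lambda>k. K * norm y * (1/2) ^ k) sums (K * norm y * 2)"
      using sums_mult[OF geometric_sums[of "1/2::real"], of "K * norm y"] by simp
    have sg: "summable (\<lambda>k. norm (g (r k)))"
      by (rule summable_comparison_test'[OF sums_summable[OF geo], of 0]) (use gb in simp)
    define x where "x = (\<Sum>k. g (r k))"
    have "norm x \<le> (\<Sum>k. norm (g (r k)))" unfolding x_def by (rule summable_norm[OF sg])
    also have "\<dots> \<le> K * norm y * 2"
      using suminf_le[OF _ sg sums_summable[OF geo]] gb sums_unique[OF geo] by simp
    finally have 1: "norm x \<le> (2 * K) * norm y" by (simp add: mult_ac)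
    have "(\<lambda>k. g (r k)) sums x" unfolding x_def by (rule summable_sums[OF summable_norm_cancel[OF sg]])
    then have "(\<lambda>k. T (g (r k))) sums T x" by (rule T.sums)
    moreover have "(\<Sum>k<m. T (g (r k))) = y - r m" for m
      by (induction m) (simp_all add: r0 rS)
    ultimately have "(\<lambda>m. y - r m) \<longlonglongrightarrow> T x" by (simp add: sums_def)
    moreover have "r \<longlonglongrightarrow> 0"
    proof (rule Lim_null_comparison[OF always_eventually])
      show "(\<lambda>k. norm y * (1/2) ^ k) \<longlonglongrightarrow> 0"
        by (rule tendsto_mult_right_zero[OF LIMSEQ_realpow_zero]) auto
    qed (simp add: rb)
    then have "(\<lambda>m. y - r m) \<longlonglongrightarrow> y - 0" by (rule tendsto_diff[OF tendsto_const])
    ultimately have "T x = y" using LIMSEQ_unique by fastforce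
    with 1 show ?thesis by blast
  qed
  with \<open>K > 0\<close> show ?thesis by (intro exI[of _ "2 * K"]) simp
qed

section \<open>Bounded operators near the identity\<close>

text \<open>A solution is a fixed point of x -> y + x - T x, which contracts by the factor
  1/2.\<close>

lemma near_identity_surj:
  fixes T :: "'a::banach \<Rightarrow>\<^sub>L 'a"
  assumes "norm (T - id_blinfun) \<le> 1/2"
  shows "\<exists>x. blinfun_apply T x = y"
proof -
  have "\<exists>!x\<in>UNIV. y + x - T x = x"
  proof (rule Banach_fix[where c = "1/2"])
    fix p q :: 'a
    have "y + p - T p - (y + q - T q) = - ((T - id_blinfun) (p - q))"
      by (simp add: blinfun.bilinear_simps)
    then have "dist (y + p - T p) (y + q - T q) = norm ((T - id_blinfun) (p - q))"
      by (simp add: dist_norm)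
    also have "\<dots> \<le> norm (T - id_blinfun) * norm (p - q)" by (rule norm_blinfun)
    also have "\<dots> \<le> 1/2 * dist p q" unfolding dist_norm using assms by (rule mult_right_mono) simp
    finally show "dist (y + p - T p) (y + q - T q) \<le> 1/2 * dist p q" .
  qed (auto simp: complete_UNIV)
  then obtain x where "y + x - T x = x" by blast
  then show ?thesis by (intro exI[of _ x]) (simp add: algebra_simps)
qed

lemma near_identity_lower_bound:
  fixes T :: "'a::real_normed_vector \<Rightarrow>\<^sub>L 'a"
  assumes "norm (T - id_blinfun) \<le> 1/2"
  shows "norm x \<le> 2 * norm (blinfun_apply T x)"
proof -
  have "norm x = norm (T x - (T - id_blinfun) x)" by (simp add: blinfun.bilinear_simps)
  also have "\<dots> \<le> norm (T x) + norm ((T - id_blinfun) x)" by (rule norm_triangle_ineq4)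
  also have "norm ((T - id_blinfun) x) \<le> norm (T - id_blinfun) * norm x" by (rule norm_blinfun)
  also have "\<dots> \<le> 1/2 * norm x" using assms by (rule mult_right_mono) simp
  finally show ?thesis by simp
qed

lemma near_identity_inverse:
  fixes T :: "'a::banach \<Rightarrow>\<^sub>L 'a"
  assumes "norm (T - id_blinfun) \<le> 1/2"
  obtains R where "R o\<^sub>L T = id_blinfun" "T o\<^sub>L R = id_blinfun" "norm R \<le> 2"
proof -
  have inj: "x = y" if "T x = T y" for x y
    using near_identity_lower_bound[OF assms, of "x - y"] that by (simp add: blinfun.diff_right)
  obtain g where g: "\<And>y. T (g y) = y" using near_identity_surj[OF assms] by metis
  have bl: "bounded_linear g"
  proof (rule bounded_linear_intro[where K = 2])
    show "norm (g x) \<le> norm x * 2" for x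
      using near_identity_lower_bound[OF assms, of "g x"] by (simp add: g)
    show "g (x + y) = g x + g y" for x y by (rule inj) (simp add: g blinfun.add_right)
    show "g (a *\<^sub>R x) = a *\<^sub>R g x" for a x by (rule inj) (simp add: g blinfun.scaleR_right)
  qed
  have "norm (Blinfun g) \<le> 2"
    using near_identity_lower_bound[OF assms, of "g _"] bl
    by (intro norm_blinfun_bound) (auto simp: bounded_linear_Blinfun_apply g)
  moreover have "Blinfun g o\<^sub>L T = id_blinfun" "T o\<^sub>L Blinfun g = id_blinfun"
    by (rule blinfun_eqI, rule inj, simp add: bounded_linear_Blinfun_apply[OF bl] g,
        rule blinfun_eqI, simp add: bounded_linear_Blinfun_apply[OF bl] g)
  ultimately show ?thesis using that by blast
qed

section \<open>Local inversion of maps with derivative near the identity\<close>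

text \<open>Again a fixed point of p -> y + p - f p. Banach's theorem needs the complete closed
  ball; the strict bound on \<open>y - f p0\<close> afterwards puts the solution into the open ball,
  which makes the domain of the inverse open.\<close>

lemma local_surjectivity_near_identity:
  fixes f :: "'a::banach \<Rightarrow> 'a"
  assumes lip: "\<And>p q. p \<in> cball p0 r \<Longrightarrow> q \<in> cball p0 r \<Longrightarrow>
                 norm ((f p - p) - (f q - q)) \<le> 1/2 * norm (p - q)"
    and r: "r > 0" and y: "norm (y - f p0) < r / 2"
  shows "\<exists>p\<in>ball p0 r. f p = y"
proof -
  have "\<exists>!p\<in>cball p0 r. y + p - f p = p"
  proof (rule Banach_fix[where c = "1/2"])
    show "(\<lambda>p. y + p - f p) ` cball p0 r \<subseteq> cball p0 r"
    proof clarify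
      fix p assume p: "p \<in> cball p0 r"
      have "y + p - f p - p0 = (y - f p0) - ((f p - p) - (f p0 - p0))" by simp
      also have "norm \<dots> \<le> norm (y - f p0) + norm ((f p - p) - (f p0 - p0))"
        by (rule norm_triangle_ineq4)
      also have "\<dots> \<le> r/2 + 1/2 * norm (p - p0)" using y lip[OF p, of p0] r by simp
      also have "\<dots> \<le> r" using p by (simp add: dist_norm norm_minus_commute)
      finally show "y + p - f p \<in> cball p0 r" by (simp add: dist_norm norm_minus_commute)
    qed
    fix p q assume pq: "p \<in> cball p0 r" "q \<in> cball p0 r"
    have "y + p - f p - (y + q - f q) = - ((f p - p) - (f q - q))" by simp
    then have "dist (y + p - f p) (y + q - f q) = norm ((f p - p) - (f q - q))"
      unfolding dist_norm by (metis norm_minus_cancel)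
    then show "dist (y + p - f p) (y + q - f q) \<le> 1/2 * dist p q"
      using lip[OF pq] by (simp add: dist_norm)
  qed (use r in \<open>auto simp: complete_eq_closed\<close>)
  then obtain p where p: "p \<in> cball p0 r" "y + p - f p = p" by blast
  then have p: "p \<in> cball p0 r" "f p = y" by (simp_all add: algebra_simps)
  have "p - p0 = (y - f p0) - ((f p - p) - (f p0 - p0))" using p by simp
  also have "norm \<dots> \<le> norm (y - f p0) + norm ((f p - p) - (f p0 - p0))"
    by (rule norm_triangle_ineq4)
  also have "\<dots> \<le> norm (y - f p0) + 1/2 * norm (p - p0)" using lip[OF p(1), of p0] r by simp
  finally have "norm (p - p0) < r" using y by simp
  then show ?thesis using p by (auto simp: dist_norm norm_minus_commute)
qed

text \<open>Where \<open>f'\<close> stays within 1/2 of the identity, \<open>f p - p\<close> is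
  Lipschitz with constant 1/2, so f is injective with a 2-Lipschitz inverse and locally onto. The
  inverse's derivative is returned with both composition identities, because the application reads
  its values off them.\<close>

theorem inverse_function_near_identity:
  fixes f :: "'a::banach \<Rightarrow> 'a" and f' :: "'a \<Rightarrow> ('a \<Rightarrow>\<^sub>L 'a)"
  assumes S: "open S" "p0 \<in> S"
    and der: "\<And>p. p \<in> S \<Longrightarrow> (f has_derivative blinfun_apply (f' p)) (at p)"
    and cont: "continuous_on S f'" and id: "f' p0 = id_blinfun"
  obtains W V g g' where "open W" "p0 \<in> W" "W \<subseteq> S" "open V" "f p0 \<in> V"
    "\<And>p. p \<in> W \<Longrightarrow> f p \<in> V \<and> g (f p) = p"
    "\<And>y. y \<in> V \<Longrightarrow> g y \<in> W \<and> f (g y) = y"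
    "\<And>y. y \<in> V \<Longrightarrow> (g has_derivative blinfun_apply (g' y)) (at y)"
    "\<And>y. y \<in> V \<Longrightarrow> f' (g y) o\<^sub>L g' y = id_blinfun"
    "\<And>y. y \<in> V \<Longrightarrow> g' y o\<^sub>L f' (g y) = id_blinfun"
    "continuous_on V g'"
proof -
  have "isCont f' p0" using cont S continuous_on_eq_continuous_at by blast
  then have "\<exists>d>0. \<forall>p. dist p p0 < d \<longrightarrow> dist (f' p) (f' p0) < 1/2"
    unfolding continuous_at_eps_delta by (auto dest!: spec[of _ "1/2"])
  then have "\<forall>\<^sub>F p in nhds p0. dist (f' p) (f' p0) < 1/2"
    unfolding eventually_nhds_metric .
  moreover have "\<forall>\<^sub>F p in nhds p0. p \<in> S" using S by (rule eventually_nhds_in_open)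
  ultimately have "\<forall>\<^sub>F p in nhds p0. p \<in> S \<and> norm (f' p - id_blinfun) \<le> 1/2"
    by eventually_elim (simp add: id dist_norm)
  then obtain d where d: "d > 0" "\<And>p. dist p p0 < d \<Longrightarrow> p \<in> S \<and> norm (f' p - id_blinfun) \<le> 1/2"
    unfolding eventually_nhds_metric by blast
  \<comment> \<open>Half the radius keeps the closed ball inside the open ball on which the
    derivative is controlled.\<close>
  define r where "r = d / 2"
  have r: "r > 0" "\<And>p. p \<in> cball p0 r \<Longrightarrow> p \<in> S \<and> norm (f' p - id_blinfun) \<le> 1/2"
    using d by (auto simp: r_def dist_commute)
  have lip: "norm ((f p - p) - (f q - q)) \<le> 1/2 * norm (p - q)"
    if "p \<in> cball p0 r" "q \<in> cball p0 r" for p q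
  proof (rule differentiable_bound[OF convex_cball[of p0 r] _ _ that])
    fix x assume x: "x \<in> cball p0 r"
    show "((\<lambda>p. f p - p) has_derivative blinfun_apply (f' x - id_blinfun)) (at x within cball p0 r)"
      using has_derivative_at_withinI[OF der, of x] r(2)[OF x]
      by (auto intro!: derivative_eq_intros simp: blinfun.bilinear_simps)
    show "onorm (blinfun_apply (f' x - id_blinfun)) \<le> 1/2"
      using r(2)[OF x] by (simp add: norm_blinfun.rep_eq)
  qed
  have low: "norm (p - q) \<le> 2 * norm (f p - f q)" if "p \<in> cball p0 r" "q \<in> cball p0 r" for p q
  proof -
    have "norm (p - q) = norm ((f p - f q) - ((f p - p) - (f q - q)))" by simp
    also have "\<dots> \<le> norm (f p - f q) + norm ((f p - p) - (f q - q))" by (rule norm_triangle_ineq4)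
    also have "\<dots> \<le> norm (f p - f q) + 1/2 * norm (p - q)" using lip[OF that] by simp
    finally show ?thesis by simp
  qed
  \<comment> \<open>r/2 is the distance up to which local surjectivity reaches. Cutting the ball
    down by the preimage of V makes f and g inverse bijections between W and V.\<close>
  define V where "V = ball (f p0) (r/2)"
  define W where "W = ball p0 r \<inter> f -` V"
  have contf: "continuous_on (ball p0 r) f"
    by (intro continuous_at_imp_continuous_on ballI has_derivative_continuous[OF der]) (use r(2) in \<open>auto simp: less_imp_le\<close>)
  have "open W" unfolding W_def V_def using contf by (intro continuous_open_preimage) auto
  have "\<exists>p. p \<in> ball p0 r \<and> f p = y" if "y \<in> V" for y
    using local_surjectivity_near_identity[of p0 r f y, OF lip r(1)] that
    by (auto simp: V_def dist_norm norm_minus_commute)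
  then obtain g where g: "\<And>y. y \<in> V \<Longrightarrow> g y \<in> ball p0 r \<and> f (g y) = y" by metis
  have gW: "g y \<in> W \<and> f (g y) = y" if "y \<in> V" for y using g[OF that] that by (simp add: W_def)
  have gf: "f p \<in> V \<and> g (f p) = p" if "p \<in> W" for p
  proof -
    have "f p \<in> V" "p \<in> cball p0 r" using that by (auto simp: W_def)
    then show ?thesis using low[of "g (f p)" p] g[of "f p"] by auto
  qed
  have glip: "dist (g y) (g z) \<le> 2 * dist y z" if "y \<in> V" "z \<in> V" for y z
    using low[of "g y" "g z"] g[OF that(1)] g[OF that(2)] by (simp add: dist_norm)
  have contg: "continuous_on V g"
  proof (intro continuous_onI)
    fix x e assume "x \<in> V" "e > (0::real)"
    then show "\<exists>d>0. \<forall>x'\<in>V. dist x' x < d \<longrightarrow> dist (g x') (g x) \<le> e"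
      using glip by (intro exI[of _ "e/2"]) force
  qed
  have "\<exists>R. R o\<^sub>L f' p = id_blinfun \<and> f' p o\<^sub>L R = id_blinfun \<and> norm R \<le> 2" if "p \<in> W" for p
    using near_identity_inverse[of "f' p"] r(2)[of p] that by (auto simp: W_def)
  then obtain R where R: "\<And>p. p \<in> W \<Longrightarrow> R p o\<^sub>L f' p = id_blinfun"
     "\<And>p. p \<in> W \<Longrightarrow> f' p o\<^sub>L R p = id_blinfun" "\<And>p. p \<in> W \<Longrightarrow> norm (R p) \<le> 2"
    by metis
  \<comment> \<open>Resolvent identity \<open>R p - R q = R p (f' q - f' p) R q\<close>; both outer
    factors have norm at most 2, whence the constant 4.\<close>
  have Rlip: "dist (R p) (R q) \<le> 4 * dist (f' p) (f' q)" if "p \<in> W" "q \<in> W" for p q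
  proof -
    have 1: "R p (f' p x) = x" for x using R(1)[OF that(1)] by (metis blinfun_apply_blinfun_compose blinfun_apply_id_blinfun)
    have 2: "f' q (R q x) = x" for x using R(2)[OF that(2)] by (metis blinfun_apply_blinfun_compose blinfun_apply_id_blinfun)
    have "R p - R q = R p o\<^sub>L ((f' q - f' p) o\<^sub>L R q)"
      by (rule blinfun_eqI) (simp add: blinfun.bilinear_simps 1 2)
    then have "norm (R p - R q) \<le> norm (R p) * norm ((f' q - f' p) o\<^sub>L R q)"
      by (simp add: norm_blinfun_compose)
    also have "\<dots> \<le> 2 * (norm (f' q - f' p) * norm (R q))"
      using R(3)[OF that(1)] by (intro mult_mono norm_blinfun_compose) auto
    also have "\<dots> \<le> 2 * (norm (f' q - f' p) * 2)"
      using R(3)[OF that(2)] by (intro mult_left_mono) auto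
    finally show ?thesis by (simp add: dist_norm norm_minus_commute)
  qed
  have contR: "continuous_on W R"
  proof (intro continuous_onI)
    fix x e assume x: "x \<in> W" and e: "e > (0::real)"
    have "W \<subseteq> S" using r(2) by (auto simp: W_def)
    then have "continuous_on W f'" using cont continuous_on_subset by blast
    then obtain d where "d > 0" "\<And>x'. x' \<in> W \<Longrightarrow> dist x' x < d \<Longrightarrow> dist (f' x') (f' x) < e/4"
      unfolding continuous_on_iff using x e by (metis divide_pos_pos zero_less_numeral)
    then show "\<exists>d>0. \<forall>x'\<in>W. dist x' x < d \<longrightarrow> dist (R x') (R x) \<le> e"
      using Rlip[OF _ x] by (intro exI[of _ d]) force
  qed
  show ?thesis
  proof (rule that[of W V g "\<lambda>y. R (g y)"])
    show "open W" by fact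
    show "p0 \<in> W" "f p0 \<in> V" using r(1) by (auto simp: W_def V_def)
    show "W \<subseteq> S" using r(2) by (auto simp: W_def)
    show "open V" by (simp add: V_def)
    show "f p \<in> V \<and> g (f p) = p" if "p \<in> W" for p using gf that .
    show "g y \<in> W \<and> f (g y) = y" if "y \<in> V" for y using gW that .
    show "f' (g y) o\<^sub>L R (g y) = id_blinfun" "R (g y) o\<^sub>L f' (g y) = id_blinfun" if "y \<in> V" for y
      using R(1,2)[of "g y"] gW[OF that] by simp_all
    show "continuous_on V (\<lambda>y. R (g y))"
      by (rule continuous_on_compose2[OF contR contg]) (use gW in blast)
    show "(g has_derivative blinfun_apply (R (g y))) (at y)" if y: "y \<in> V" for y
    proof (rule has_derivative_inverse_basic[where f = f and f' = "blinfun_apply (f' (g y))" and T = V])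
      show "(f has_derivative blinfun_apply (f' (g y))) (at (g y))"
        by (rule der) (use r(2)[of "g y"] gW[OF y] in \<open>simp add: W_def\<close>)
      show "blinfun_apply (R (g y)) \<circ> blinfun_apply (f' (g y)) = id"
        using R(1)[of "g y"] gW[OF y]
        by (metis (no_types, lifting) blinfun_apply_blinfun_compose blinfun_apply_id_blinfun comp_apply eq_id_iff)
      show "continuous (at y) g" using contg y \<open>open V\<close> by (simp add: continuous_on_eq_continuous_at)
    qed (use y gW \<open>open V\<close> in \<open>simp_all add: blinfun.bounded_linear_right\<close>)
  qed
qed

section \<open>Coordinates and determinants\<close>

lemma kspace_vector_space:
  assumes "kspace s"
  shows "vector_space s"
proof
  have "s (of_real 1) x = 1 *\<^sub>R x" for x using assms unfolding kspace_def by blast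
  then show "s 1 x = x" for x by simp
qed (use assms in \<open>auto simp: kspace_def\<close>)

lemma kspace_norm: "kspace s \<Longrightarrow> norm (s a x) = norm a * norm x"
  unfolding kspace_def by blast

lemma kspace_bounded_bilinear:
  fixes s :: "'k::real_normed_field \<Rightarrow> 'u::real_normed_vector \<Rightarrow> 'u"
  assumes "kspace s"
  shows "bounded_bilinear s"
proof
  have sr: "s (of_real r) x = r *\<^sub>R x" and sm: "s (a * b) x = s a (s b x)" for r a b x
    using assms unfolding kspace_def by blast+
  show "s (r *\<^sub>R a) x = r *\<^sub>R s a x" for r a x
    by (simp add: sm sr scaleR_conv_of_real)
  show "s a (r *\<^sub>R x) = r *\<^sub>R s a x" for r a x
    using sm[of a "of_real r" x] sm[of "of_real r" a x] by (simp add: sr mult.commute)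
  show "\<exists>K. \<forall>a x. norm (s a x) \<le> norm a * norm x * K"
    using assms by (intro exI[of _ 1]) (simp add: kspace_norm)
qed (use assms in \<open>auto simp: kspace_def\<close>)

definition lincomb :: "('k::comm_ring_1 \<Rightarrow> 'u::ab_group_add \<Rightarrow> 'u) \<Rightarrow> nat \<Rightarrow> (nat \<Rightarrow> 'u) \<Rightarrow> (nat \<Rightarrow> 'k) \<Rightarrow> 'u" where
  "lincomb s n e c = (\<Sum>i<n. s (c i) (e i))"

text \<open>Independence of a family rather than of a set: a repeated vector already is a
  dependence, and coefficient functions serve directly as matrix columns. \<open>kbasis\<close>
  expresses the same by injectivity and independence of the image.\<close>

definition indep_family :: "('k::comm_ring_1 \<Rightarrow> 'u::ab_group_add \<Rightarrow> 'u) \<Rightarrow> nat \<Rightarrow> (nat \<Rightarrow> 'u) \<Rightarrow> bool" where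
  "indep_family s n e \<longleftrightarrow> (\<forall>c. lincomb s n e c = 0 \<longrightarrow> (\<forall>i<n. c i = 0))"

context vector_space
begin

lemma lincomb_image:
  assumes "inj_on e {..<n}"
  shows "(\<Sum>v\<in>e ` {..<n}. scale (u v) v) = lincomb scale n e (u \<circ> e)"
  using assms by (simp add: lincomb_def sum.reindex)

lemma lincomb_eq_image:
  assumes "inj_on e {..<n}"
  shows "lincomb scale n e c = (\<Sum>v\<in>e ` {..<n}. scale (c (the_inv_into {..<n} e v)) v)"
  unfolding lincomb_image[OF assms] lincomb_def using assms
  by (intro sum.cong) (auto simp: the_inv_into_f_f)

lemma lincomb_diff: "lincomb scale n e c - lincomb scale n e d = lincomb scale n e (\<lambda>i. c i - d i)"
  by (simp add: lincomb_def scale_left_diff_distrib sum_subtractf)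

lemma lincomb_add: "lincomb scale n e c + lincomb scale n e d = lincomb scale n e (\<lambda>i. c i + d i)"
  by (simp add: lincomb_def scale_left_distrib sum.distrib)

lemma lincomb_scale: "scale a (lincomb scale n e c) = lincomb scale n e (\<lambda>i. a * c i)"
  by (simp add: lincomb_def scale_sum_right)

lemma lincomb_delta: "k < n \<Longrightarrow> lincomb scale n e (\<lambda>i. if i = k then a else 0) = scale a (e k)"
  unfolding lincomb_def by (simp add: if_distrib[of "\<lambda>z. scale z _"] sum.delta cong: if_cong)

lemma indep_family_inj:
  assumes "indep_family scale n e"
  shows "inj_on e {..<n}"
proof (rule inj_onI)
  fix i j assume ij: "i \<in> {..<n}" "j \<in> {..<n}" "e i = e j"
  have "lincomb scale n e (\<lambda>k. (if k = i then 1 else 0) - (if k = j then 1 else 0)) = 0"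
    using ij unfolding lincomb_diff[symmetric] by (simp add: lincomb_delta)
  then have "\<forall>k<n. (if k = i then 1 else 0) - (if k = j then 1 else 0) = (0::'a)"
    using assms unfolding indep_family_def by blast
  then show "i = j" using ij by (auto dest!: spec[of _ i] split: if_splits)
qed

lemma indep_family_iff:
  "indep_family scale n e \<longleftrightarrow> inj_on e {..<n} \<and> independent (e ` {..<n})"
proof
  assume e: "indep_family scale n e"
  have inj: "inj_on e {..<n}" by (rule indep_family_inj[OF e])
  have "u v = 0" if "(\<Sum>v\<in>e ` {..<n}. scale (u v) v) = 0" "v \<in> e ` {..<n}" for u v
    using e that unfolding lincomb_image[OF inj] indep_family_def by fastforce
  then show "inj_on e {..<n} \<and> independent (e ` {..<n})"
    using inj unfolding dependent_finite[OF finite_imageI[OF finite_lessThan]] by blast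
next
  assume e: "inj_on e {..<n} \<and> independent (e ` {..<n})"
  show "indep_family scale n e" unfolding indep_family_def
  proof (intro allI impI)
    fix c i assume c: "lincomb scale n e c = 0" and i: "i < n"
    have "(\<Sum>v\<in>e ` {..<n}. scale (c (the_inv_into {..<n} e v)) v) = 0"
      using c e by (simp add: lincomb_eq_image)
    then have "c (the_inv_into {..<n} e (e i)) = 0"
      using e i by (auto simp: dependent_finite dest!: spec[of _ "\<lambda>v. c (the_inv_into {..<n} e v)"])
    then show "c i = 0" using e i by (simp add: the_inv_into_f_f)
  qed
qed

lemma span_image_lessThan: "span (e ` {..<n}) = range (lincomb scale n e)"
proof
  show "range (lincomb scale n e) \<subseteq> span (e ` {..<n})"
    unfolding lincomb_def by (auto intro!: span_sum intro: span_scale span_base)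
  show "span (e ` {..<n}) \<subseteq> range (lincomb scale n e)"
  proof (rule span_minimal)
    show "e ` {..<n} \<subseteq> range (lincomb scale n e)"
    proof clarify
      fix k assume "k < n"
      then have "e k = lincomb scale n e (\<lambda>i. if i = k then 1 else 0)" by (simp add: lincomb_delta)
      then show "e k \<in> range (lincomb scale n e)" by blast
    qed
    show "subspace (range (lincomb scale n e))"
    proof (rule subspaceI)
      have "0 = lincomb scale n e (\<lambda>_. 0)" by (simp add: lincomb_def)
      then show "0 \<in> range (lincomb scale n e)" by blast
    qed (auto simp: lincomb_add lincomb_scale)
  qed
qed

lemma kbasis_iff: "kbasis scale S n e \<longleftrightarrow> indep_family scale n e \<and> range (lincomb scale n e) = S"
  by (auto simp: kbasis_def indep_family_iff span_image_lessThan)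

lemma lincomb_eq_iff:
  assumes "indep_family scale n e"
  shows "lincomb scale n e c = lincomb scale n e d \<longleftrightarrow> (\<forall>i<n. c i = d i)"
proof
  assume "lincomb scale n e c = lincomb scale n e d"
  then have "lincomb scale n e (\<lambda>i. c i - d i) = 0" by (simp add: lincomb_diff[symmetric])
  then show "\<forall>i<n. c i = d i" using assms unfolding indep_family_def by fastforce
qed (simp add: lincomb_def)

lemma coords_lincomb:
  assumes "indep_family scale n e" and "i < n"
  shows "coords scale n e (lincomb scale n e c) i = c i"
proof -
  \<comment> \<open>The description in \<open>coords\<close> demands zeros from n on, which c need
    not have; its truncation d is the function described.\<close>
  define d where "d = (\<lambda>i. if i < n then c i else 0)"
  have ld: "lincomb scale n e c = lincomb scale n e d" by (simp add: lincomb_def d_def)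
  have "coords scale n e (lincomb scale n e c) = d"
    unfolding coords_def lincomb_def[symmetric]
  proof (rule the_equality)
    show "lincomb scale n e c = lincomb scale n e d \<and> (\<forall>i\<ge>n. d i = 0)" using ld by (simp add: d_def)
    fix c' assume c': "lincomb scale n e c = lincomb scale n e c' \<and> (\<forall>i\<ge>n. c' i = 0)"
    then have "\<forall>i<n. c' i = d i" using lincomb_eq_iff[OF assms(1)] ld by simp
    then show "c' = d" using c' by (intro ext) (simp add: d_def)
  qed
  then show ?thesis using assms by (simp add: d_def)
qed

lemma lincomb_coords:
  assumes "kbasis scale S n e" and "v \<in> S"
  shows "lincomb scale n e (coords scale n e v) = v"
proof -
  obtain c where v: "v = lincomb scale n e c" and e: "indep_family scale n e"
    using assms unfolding kbasis_iff by blast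
  show ?thesis unfolding v lincomb_eq_iff[OF e] using coords_lincomb[OF e] by simp
qed

lemma kbasis_dim: "kbasis scale S n e \<Longrightarrow> dim S = n"
  by (auto simp: kbasis_def dim_span_eq_card_independent card_image simp del: dim_span)

lemma kbasis_subspace: "kbasis scale S n e \<Longrightarrow> subspace S"
  by (auto simp: kbasis_def subspace_span)

lemma kbasis_mem: "kbasis scale S n e \<Longrightarrow> i < n \<Longrightarrow> e i \<in> S"
  by (auto simp: kbasis_def intro: span_base)

text \<open>A vector of S outside the span of g would extend g to n + 1 independent vectors in the
  span of n vectors.\<close>

lemma kbasisI_indep_family:
  assumes e: "kbasis scale S n e" and g: "indep_family scale n g" "\<And>i. i < n \<Longrightarrow> g i \<in> S"
  shows "kbasis scale S n g"
proof -
  have gS: "g ` {..<n} \<subseteq> S" using g by blast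
  then have "span (g ` {..<n}) \<subseteq> S" using span_minimal kbasis_subspace[OF e] by blast
  moreover have "v \<in> span (g ` {..<n})" if "v \<in> S" for v
  proof (rule ccontr)
    assume v: "v \<notin> span (g ` {..<n})"
    then have "independent (insert v (g ` {..<n}))" using g by (simp add: indep_family_iff independent_insert)
    moreover have "insert v (g ` {..<n}) \<subseteq> span (e ` {..<n})" using gS that e by (simp add: kbasis_def)
    ultimately have "card (insert v (g ` {..<n})) \<le> card (e ` {..<n})"
      by (rule conjunct2[OF independent_span_bound[OF finite_imageI[OF finite_lessThan]]])
    moreover have "v \<notin> g ` {..<n}" using v by (rule contrapos_nn) (rule span_base)
    ultimately show False using e g by (simp add: indep_family_iff kbasis_def card_image)
  qed
  ultimately show ?thesis using g unfolding kbasis_def indep_family_iff by blast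
qed

end

section \<open>Determinants of matrices given by functions\<close>

text \<open>Bridge to matrix determinants, from which multiplicativity of \<open>ldet\<close> is
  imported.\<close>

lemma ldet_conv_det: "ldet n M = det (mat n n (\<lambda>(i, j). M i j))"
proof -
  have "{0..<n} = {..<n}" by auto
  moreover have "(\<Prod>i<n. M i (p i)) = (\<Prod>i<n. mat n n (\<lambda>(i, j). M i j) $$ (i, p i))"
    if "p permutes {..<n}" for p
    using permutes_in_image[OF that] by (intro prod.cong) auto
  ultimately show ?thesis by (simp add: ldet_def det_def)
qed

lemma ldet_mult: "ldet n (\<lambda>i j. \<Sum>k<n. A i k * B k j) = ldet n A * ldet n (B :: nat \<Rightarrow> nat \<Rightarrow> 'a::idom)"
proof -
  have "mat n n (\<lambda>(i, j). \<Sum>k<n. A i k * B k j) = mat n n (\<lambda>(i, j). A i j) * mat n n (\<lambda>(i, j). B i j)"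
    by (rule eq_matI) (auto simp: scalar_prod_def atLeast0LessThan)
  then show ?thesis by (simp add: ldet_conv_det det_mult[of _ n])
qed

lemma ldet_one: "ldet n (\<lambda>i j. if i = j then 1 else 0) = (1 :: 'a::comm_ring_1)"
proof -
  have "mat n n (\<lambda>(i, j). if i = j then 1 else 0) = (1\<^sub>m n :: 'a mat)" by (rule eq_matI) auto
  then show ?thesis by (simp add: ldet_conv_det)
qed

lemma ldet_cong:
  assumes "\<And>i j. i < n \<Longrightarrow> j < n \<Longrightarrow> A i j = B i j"
  shows "ldet n A = ldet n B"
proof -
  have "mat n n (\<lambda>(i, j). A i j) = mat n n (\<lambda>(i, j). B i j)" using assms by (intro eq_matI) auto
  then show ?thesis by (simp add: ldet_conv_det)
qed

lemma ldet_scale_columns: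
  "ldet n (\<lambda>i j. t j * M i j) = (\<Prod>j<n. t j) * ldet n (M :: nat \<Rightarrow> nat \<Rightarrow> 'a::comm_ring_1)"
proof -
  have "(\<Prod>i<n. t (p i) * M i (p i)) = (\<Prod>j<n. t j) * (\<Prod>i<n. M i (p i))"
    if "p permutes {..<n}" for p
    using prod.permute[OF that, of t] by (simp add: prod.distrib comp_def)
  then show ?thesis by (simp add: ldet_def sum_distrib_left mult_ac)
qed

lemma continuous_ldet:
  fixes M :: "'b::t2_space \<Rightarrow> nat \<Rightarrow> nat \<Rightarrow> 'a::real_normed_field"
  assumes "\<And>i j. i < n \<Longrightarrow> j < n \<Longrightarrow> continuous F (\<lambda>x. M x i j)"
  shows "continuous F (\<lambda>x. ldet n (M x))"
  unfolding ldet_def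
proof (intro continuous_sum continuous_mult continuous_const continuous_prod)
  fix p i assume "p \<in> {p. p permutes {..<n}}" "i \<in> {..<n}"
  then show "continuous F (\<lambda>x. M x i (p i))" using permutes_in_image[of p "{..<n}" i] assms by auto
qed

text \<open>The coordinate matrices of g in e and of e in g are inverse to each other, so their
  determinants have product 1.\<close>

lemma (in vector_space) ldet_coords_nonzero:
  assumes e: "kbasis scale S n e" and g: "kbasis scale S n g"
  shows "ldet n (\<lambda>i j. coords scale n e (g j) i) \<noteq> 0"
proof -
  define A where "A = (\<lambda>i j. coords scale n e (g j) i)"
  define B where "B = (\<lambda>i j. coords scale n g (e j) i)"
  have "(\<Sum>k<n. A i k * B k j) = (if i = j then 1 else 0)" if ij: "i < n" "j < n" for i j
  proof -
    have "e j = lincomb scale n g (coords scale n g (e j))"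
      by (simp add: lincomb_coords[OF g] kbasis_mem[OF e] ij)
    also have "\<dots> = (\<Sum>k<n. scale (B k j) (lincomb scale n e (\<lambda>i. A i k)))"
      unfolding lincomb_def[of _ _ g] A_def B_def
      by (intro sum.cong) (simp_all add: lincomb_coords[OF e] kbasis_mem[OF g])
    also have "\<dots> = lincomb scale n e (\<lambda>i. \<Sum>k<n. A i k * B k j)"
      unfolding lincomb_def scale_sum_right scale_sum_left
      by (subst sum.swap) (simp add: mult.commute)
    finally have "lincomb scale n e (\<lambda>i. if i = j then 1 else 0) = \<dots>" using ij by (simp add: lincomb_delta)
    then show ?thesis using e ij by (simp add: kbasis_iff lincomb_eq_iff)
  qed
  then have "ldet n (\<lambda>i j. \<Sum>k<n. A i k * B k j) = ldet n (\<lambda>i j. if i = j then 1 else 0)"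
    by (intro ldet_cong)
  then have "ldet n A * ldet n B = 1" by (simp add: ldet_mult ldet_one)
  then show ?thesis unfolding A_def by auto
qed

section \<open>Orders of vanishing\<close>

text \<open>If k < l, cancelling \<open>(x - a) ^ k\<close> off a gives
  \<open>g x = (x - a) ^ (l - k) * h x\<close>, and letting x tend to a forces
  \<open>g a = 0\<close>. This is what makes the multiplicity independent of the
  transversalization.\<close>

lemma has_order_unique:
  fixes f :: "'k::real_normed_field \<Rightarrow> 'k"
  assumes "has_order f a k" "has_order f a l"
  shows "k = l"
proof -
  have *: False if kl: "k < l" and k: "has_order f a k" and l: "has_order f a l" for k l
  proof -
    obtain g d where g': "d > 0 \<and> continuous (at a) g \<and> g a \<noteq> 0 \<and>
        (\<forall>x. dist x a < d \<longrightarrow> f x = (x - a) ^ k * g x)"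
      using k unfolding has_order_def by (elim exE) (rule that)
    obtain h d' where h': "d' > 0 \<and> continuous (at a) h \<and> h a \<noteq> 0 \<and>
        (\<forall>x. dist x a < d' \<longrightarrow> f x = (x - a) ^ l * h x)"
      using l unfolding has_order_def by (elim exE) (rule that)
    note g = g'[THEN conjunct1] g'[THEN conjunct2, THEN conjunct1]
      g'[THEN conjunct2, THEN conjunct2, THEN conjunct1]
      g'[THEN conjunct2, THEN conjunct2, THEN conjunct2, rule_format]
    note h = h'[THEN conjunct1] h'[THEN conjunct2, THEN conjunct1]
      h'[THEN conjunct2, THEN conjunct2, THEN conjunct2, rule_format]
    have "g x = (x - a) ^ (l - k) * h x" if "x \<noteq> a" "dist x a < min d d'" for x
    proof -
      have "(x - a) ^ k * g x = (x - a) ^ k * ((x - a) ^ (l - k) * h x)"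
        using g(4)[of x] h(3)[of x] that kl by (simp add: mult.assoc[symmetric] power_add[symmetric])
      then show ?thesis using that by simp
    qed
    then have "\<forall>\<^sub>F x in at a. g x = (x - a) ^ (l - k) * h x"
      unfolding eventually_at using g(1) h(1) by (intro exI[of _ "min d d'"]) auto
    moreover have "(g \<longlongrightarrow> g a) (at a)" using g(2) by (simp add: continuous_at)
    ultimately have "((\<lambda>x. (x - a) ^ (l - k) * h x) \<longlongrightarrow> g a) (at a)"
      by (rule Lim_transform_eventually[rotated])
    moreover have "((\<lambda>x. (x - a) ^ (l - k) * h x) \<longlongrightarrow> (a - a) ^ (l - k) * h a) (at a)"
      using h(2) by (intro tendsto_intros) (simp add: continuous_at)
    ultimately have "g a = (a - a) ^ (l - k) * h a" by (rule LIM_unique)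
    then have "g a = 0" using kl by simp
    then show False using g by blast
  qed
  show ?thesis using *[of k l] *[of l k] assms by (meson linorder_neqE_nat)
qed

section \<open>Norm estimates in finite-dimensional subspaces\<close>

lemma lincomb_tendsto:
  assumes "kspace s" "\<And>i. i < n \<Longrightarrow> ((\<lambda>x. c x i) \<longlongrightarrow> l i) F"
  shows "((\<lambda>x. lincomb s n e (c x)) \<longlongrightarrow> lincomb s n e l) F"
  unfolding lincomb_def
  by (intro tendsto_sum bounded_bilinear.tendsto[OF kspace_bounded_bilinear[OF assms(1)]]
        assms(2) tendsto_const) simp

lemma lincomb_Suc: "lincomb s (Suc n) e c = lincomb s n e c + s (c n) (e n)"
  by (simp add: lincomb_def)

lemma indep_family_Suc:
  assumes "vector_space s" "indep_family s (Suc n) e"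
  shows "indep_family s n e" and "e n \<notin> range (lincomb s n e)"
proof -
  interpret vector_space s by fact
  have D: "\<forall>i<Suc n. c i = 0" if "lincomb s (Suc n) e c = 0" for c
    using assms(2) that unfolding indep_family_def by simp
  show "indep_family s n e" unfolding indep_family_def
  proof (intro allI impI)
    fix c i assume c: "lincomb s n e c = 0" and i: "i < n"
    have "lincomb s n e (c(n := 0)) = lincomb s n e c" by (simp add: lincomb_def)
    then have "lincomb s (Suc n) e (c(n := 0)) = 0" using c by (simp add: lincomb_Suc)
    from D[OF this] i show "c i = 0" by (auto dest: spec[of _ i])
  qed
  show "e n \<notin> range (lincomb s n e)"
  proof
    assume "e n \<in> range (lincomb s n e)"
    then obtain c where c: "e n = lincomb s n e c" by (rule imageE)
    have "lincomb s n e (c(n := -1)) = lincomb s n e c" by (simp add: lincomb_def)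
    then have "lincomb s (Suc n) e (c(n := -1)) = 0" using c by (simp add: lincomb_Suc)
    from D[OF this] show False by (auto dest: spec[of _ n])
  qed
qed

text \<open>The bound turns a convergent sequence of combinations into Cauchy sequences of
  coefficients, whose limits exist because K is complete.\<close>

lemma closed_range_lincomb:
  fixes s :: "'k::{real_normed_field,banach} \<Rightarrow> 'u::real_normed_vector \<Rightarrow> 'u"
  assumes s: "kspace s" and C: "\<And>c. (\<Sum>i<n. norm (c i)) \<le> C * norm (lincomb s n e c)"
  shows "closed (range (lincomb s n e))"
proof -
  interpret vector_space s by (rule kspace_vector_space[OF s])
  show ?thesis unfolding closed_sequential_limits
  proof (intro allI impI, elim conjE)
    fix X l assume X: "\<forall>k. X k \<in> range (lincomb s n e)" and l: "X \<longlonglongrightarrow> l"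
    have "\<exists>c. X k = lincomb s n e c" for k using X[rule_format, of k] by (rule imageE) blast
    then obtain c where c: "\<And>k. X k = lincomb s n e (c k)" by metis
    have "convergent (\<lambda>k. c k i)" if i: "i < n" for i
    proof (rule Cauchy_convergent, rule metric_CauchyI)
      fix \<epsilon> :: real assume \<epsilon>: "\<epsilon> > 0"
      have "Cauchy X" using l by (rule LIMSEQ_imp_Cauchy)
      \<comment> \<open>\<open>\<bar>C\<bar> + 1\<close> replaces C, whose sign is unknown, so that
        the tolerance is positive.\<close>
      then obtain M where M: "\<And>k m. k \<ge> M \<Longrightarrow> m \<ge> M \<Longrightarrow> dist (X k) (X m) < \<epsilon> / (\<bar>C\<bar> + 1)"
        using metric_CauchyD[of X "\<epsilon> / (\<bar>C\<bar> + 1)"] \<epsilon> by (auto simp: add_nonneg_pos)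
      have "dist (c k i) (c m i) < \<epsilon>" if "k \<ge> M" "m \<ge> M" for k m
      proof -
        have "norm (c k i - c m i) \<le> (\<Sum>i<n. norm (c k i - c m i))"
          using i by (intro member_le_sum) auto
        also have "\<dots> \<le> C * norm (lincomb s n e (\<lambda>i. c k i - c m i))" by (rule C)
        also have "\<dots> = C * dist (X k) (X m)" by (simp add: c dist_norm lincomb_diff)
        also have "\<dots> \<le> (\<bar>C\<bar> + 1) * dist (X k) (X m)" by (intro mult_right_mono) auto
        also have "\<dots> < \<epsilon>" using M[OF that] by (simp add: pos_less_divide_eq mult.commute add_nonneg_pos)
        finally show ?thesis by (simp add: dist_norm)
      qed
      then show "\<exists>M. \<forall>m\<ge>M. \<forall>k\<ge>M. dist (c m i) (c k i) < \<epsilon>" by blast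
    qed
    then have "(\<lambda>k. c k i) \<longlonglongrightarrow> lim (\<lambda>k. c k i)" if "i < n" for i
      using that by (simp add: convergent_LIMSEQ_iff)
    then have "(\<lambda>k. lincomb s n e (c k)) \<longlonglongrightarrow> lincomb s n e (\<lambda>i. lim (\<lambda>k. c k i))"
      by (rule lincomb_tendsto[OF s])
    then have "X \<longlonglongrightarrow> lincomb s n e (\<lambda>i. lim (\<lambda>k. c k i))" by (simp add: c[abs_def])
    then have "l = lincomb s n e (\<lambda>i. lim (\<lambda>k. c k i))" using l LIMSEQ_unique by blast
    then show "l \<in> range (lincomb s n e)" by simp
  qed
qed

text \<open>Induction on n. The span of the first n vectors is closed by the previous lemma, so the
  last vector has positive distance d from it, and \<open>norm (c n)\<close> is at most the norm of
  the combination divided by d. Subtracting the last term leaves the earlier coefficients to the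
  induction hypothesis.\<close>

lemma lincomb_norm_bound:
  fixes s :: "'k::{real_normed_field,banach} \<Rightarrow> 'u::real_normed_vector \<Rightarrow> 'u"
  assumes s: "kspace s" and "indep_family s n e"
  shows "\<exists>C>0. \<forall>c. (\<Sum>i<n. norm (c i)) \<le> C * norm (lincomb s n e c)"
  using assms(2)
proof (induction n)
  case 0 show ?case by (intro exI[of _ 1]) simp
next
  case (Suc n)
  interpret vector_space s by (rule kspace_vector_space[OF s])
  note e = indep_family_Suc[OF vector_space_axioms Suc.prems]
  obtain C where C: "C > 0" "\<And>c. (\<Sum>i<n. norm (c i)) \<le> C * norm (lincomb s n e c)"
    using Suc.IH[OF e(1)] by auto
  define d where "d = infdist (e n) (range (lincomb s n e))"
  have "d > 0" unfolding d_def
    using closed_range_lincomb[OF s C(2)] e(2) by (intro infdist_pos_not_in_closed) auto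
  have last: "norm (c n) * d \<le> norm (lincomb s (Suc n) e c)" for c
  proof (cases "c n = 0")
    case False
    have "lincomb s (Suc n) e c = s (c n) (e n - lincomb s n e (\<lambda>i. - (c i / c n)))"
      using False by (simp add: lincomb_Suc lincomb_def sum_negf scale_right_distrib scale_sum_right)
    moreover have "d \<le> norm (e n - lincomb s n e (\<lambda>i. - (c i / c n)))"
      unfolding d_def dist_norm[symmetric] by (intro infdist_le) simp
    ultimately show ?thesis by (simp add: kspace_norm[OF s] mult_left_mono)
  qed simp
  have "(\<Sum>i<Suc n. norm (c i)) \<le> (C + (C * norm (e n) + 1) / d) * norm (lincomb s (Suc n) e c)" for c
  proof -
    let ?v = "norm (lincomb s (Suc n) e c)"
    have cn: "norm (c n) \<le> ?v / d" using last[of c] \<open>d > 0\<close> by (simp add: pos_le_divide_eq)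
    have "lincomb s n e c = lincomb s (Suc n) e c - s (c n) (e n)" by (simp add: lincomb_Suc)
    then have "norm (lincomb s n e c) \<le> ?v + norm (c n) * norm (e n)"
      using norm_triangle_ineq4[of "lincomb s (Suc n) e c" "s (c n) (e n)"] by (simp add: kspace_norm[OF s])
    then have "(\<Sum>i<n. norm (c i)) \<le> C * (?v + norm (c n) * norm (e n))"
      using C(2)[of c] C(1) by (meson mult_le_cancel_left_pos order_trans)
    then have "(\<Sum>i<Suc n. norm (c i)) \<le> C * ?v + norm (c n) * (C * norm (e n) + 1)"
      by (simp add: algebra_simps)
    also have "\<dots> \<le> C * ?v + ?v / d * (C * norm (e n) + 1)"
      using cn C(1) by (intro add_left_mono mult_right_mono) auto
    also have "\<dots> = (C + (C * norm (e n) + 1) / d) * ?v" by (simp add: algebra_simps add_divide_distrib)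
    finally show ?thesis .
  qed
  moreover have "C + (C * norm (e n) + 1) / d > 0" using C(1) \<open>d > 0\<close> by (simp add: add_pos_nonneg)
  ultimately show ?case by blast
qed

text \<open>The coefficient bound makes coordinates Lipschitz on S.\<close>

lemma continuous_coords:
  fixes s :: "'k::{real_normed_field,banach} \<Rightarrow> 'u::real_normed_vector \<Rightarrow> 'u"
    and v :: "'a::t2_space \<Rightarrow> 'u"
  assumes s: "kspace s" and e: "kbasis s S n e"
    and v: "continuous (at a) v" "\<forall>\<^sub>F x in nhds a. v x \<in> S" and i: "i < n"
  shows "continuous (at a) (\<lambda>x. coords s n e (v x) i)"
proof -
  interpret vector_space s by (rule kspace_vector_space[OF s])
  have ie: "indep_family s n e" using e by (simp add: kbasis_iff)
  obtain C where C: "\<And>c. (\<Sum>i<n. norm (c i)) \<le> C * norm (lincomb s n e c)"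
    using lincomb_norm_bound[OF s ie] by auto
  have a: "v a \<in> S" using v(2) by (rule eventually_nhds_x_imp_x)
  have bound: "norm (coords s n e (v x) i - coords s n e (v a) i) \<le> C * norm (v x - v a)"
    if x: "v x \<in> S" for x
  proof -
    have "norm (coords s n e (v x) i - coords s n e (v a) i)
        \<le> (\<Sum>i<n. norm (coords s n e (v x) i - coords s n e (v a) i))"
      using i by (intro member_le_sum) auto
    also have "\<dots> \<le> C * norm (lincomb s n e (\<lambda>i. coords s n e (v x) i - coords s n e (v a) i))" by (rule C)
    also have "\<dots> = C * norm (v x - v a)"
      by (simp add: lincomb_diff[symmetric] lincomb_coords[OF e x] lincomb_coords[OF e a])
    finally show ?thesis .
  qed
  have "((\<lambda>x. coords s n e (v x) i - coords s n e (v a) i) \<longlongrightarrow> 0) (at a)"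
  proof (rule Lim_null_comparison)
    have "\<forall>\<^sub>F x in at a. v x \<in> S" using v(2) by (auto simp: eventually_at_filter elim: eventually_mono)
    then show "\<forall>\<^sub>F x in at a. norm (coords s n e (v x) i - coords s n e (v a) i) \<le> C * norm (v x - v a)"
      by (rule eventually_mono) (rule bound)
    have "((\<lambda>x. C * norm (v x - v a)) \<longlongrightarrow> C * norm (v a - v a)) (at a)"
      using v(1) by (intro tendsto_intros) (simp add: continuous_at)
    then show "((\<lambda>x. C * norm (v x - v a)) \<longlongrightarrow> 0) (at a)" by simp
  qed
  then show ?thesis unfolding continuous_at by (rule Lim_null[THEN iffD2])
qed

text \<open>If M, R and N are the matrices of B, p and w in the bases e and f, then M(t) R(t) = N(t)
  diag((t - a)^(j k)). The determinants of R and N are continuous and nonzero at a, so det M has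
  order \<open>\<Sum>i<n. j i\<close>. No expansion of B in t is involved.\<close>

lemma has_order_map_det:
  fixes sU :: "'k::{real_normed_field,banach} \<Rightarrow> 'u::real_normed_vector \<Rightarrow> 'u"
    and sV :: "'k \<Rightarrow> 'v::real_normed_vector \<Rightarrow> 'v"
  assumes sU: "kspace sU" and sV: "kspace sV"
    and e: "kbasis sU X n e" and f: "kbasis sV Z n f"
    and lin: "\<forall>\<^sub>F t in nhds a. \<forall>c. B t (lincomb sU n e c) = lincomb sV n (\<lambda>i. B t (e i)) c"
    and BZ: "\<forall>\<^sub>F t in nhds a. \<forall>i<n. B t (e i) \<in> Z"
    and p: "\<And>i. i < n \<Longrightarrow> continuous (at a) (p i)" "\<And>i. i < n \<Longrightarrow> \<forall>\<^sub>F t in nhds a. p i t \<in> X"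
    and p0: "kbasis sU X n (\<lambda>i. p i a)"
    and w: "\<And>i. i < n \<Longrightarrow> continuous (at a) (w i)" "\<And>i. i < n \<Longrightarrow> \<forall>\<^sub>F t in nhds a. w i t \<in> Z"
    and w0: "kbasis sV Z n (\<lambda>i. w i a)"
    and Bp: "\<And>i. i < n \<Longrightarrow> \<forall>\<^sub>F t in nhds a. B t (p i t) = sV ((t - a) ^ j i) (w i t)"
  shows "has_order (\<lambda>t. map_det sV n e f (B t)) a (\<Sum>i<n. j i)"
proof -
  interpret U: vector_space sU by (rule kspace_vector_space[OF sU])
  interpret V: vector_space sV by (rule kspace_vector_space[OF sV])
  define M where "M = (\<lambda>t i k. coords sV n f (B t (e k)) i)"
  define R where "R = (\<lambda>t i k. coords sU n e (p k t) i)"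
  define N where "N = (\<lambda>t i k. coords sV n f (w k t) i)"
  have entry: "(\<Sum>l<n. M t i l * R t l k) = (t - a) ^ j k * N t i k"
    if lin: "\<forall>c. B t (lincomb sU n e c) = lincomb sV n (\<lambda>i. B t (e i)) c" and BZ: "\<forall>i<n. B t (e i) \<in> Z"
      and pX: "p k t \<in> X" and wZ: "w k t \<in> Z" and Bp: "B t (p k t) = sV ((t - a) ^ j k) (w k t)"
      and ik: "i < n" "k < n" for t i k
  proof -
    have "lincomb sV n f (\<lambda>i. (t - a) ^ j k * N t i k) = B t (p k t)"
      unfolding Bp N_def V.lincomb_scale[symmetric] by (simp add: V.lincomb_coords[OF f wZ])
    also have "\<dots> = B t (lincomb sU n e (\<lambda>l. R t l k))"
      unfolding R_def by (simp add: U.lincomb_coords[OF e pX])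
    also have "\<dots> = lincomb sV n (\<lambda>l. lincomb sV n f (\<lambda>i. M t i l)) (\<lambda>l. R t l k)"
      unfolding lin[rule_format] lincomb_def[of _ _ "\<lambda>l. lincomb sV n f (\<lambda>i. M t i l)"]
      unfolding lincomb_def[of _ _ "\<lambda>i. B t (e i)"] M_def
      by (intro sum.cong) (simp_all add: V.lincomb_coords[OF f] BZ)
    also have "\<dots> = lincomb sV n f (\<lambda>i. \<Sum>l<n. M t i l * R t l k)"
      unfolding lincomb_def V.scale_sum_right V.scale_sum_left
      by (subst sum.swap) (simp add: mult.commute)
    finally have "lincomb sV n f (\<lambda>i. (t - a) ^ j k * N t i k) = lincomb sV n f (\<lambda>i. \<Sum>l<n. M t i l * R t l k)" .
    then show ?thesis using f ik by (simp add: V.kbasis_iff V.lincomb_eq_iff)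
  qed
  have all: "\<forall>\<^sub>F t in nhds a. \<forall>k\<in>{..<n}. p k t \<in> X \<and> w k t \<in> Z \<and> B t (p k t) = sV ((t - a) ^ j k) (w k t)"
    by (intro eventually_ball_finite ballI eventually_conj) (use p(2) w(2) Bp in simp_all)
  have contR: "continuous (at a) (\<lambda>t. ldet n (R t))" unfolding R_def
    by (intro continuous_ldet continuous_coords[OF sU e] p)
  have contN: "continuous (at a) (\<lambda>t. ldet n (N t))" unfolding N_def
    by (intro continuous_ldet continuous_coords[OF sV f] w)
  have R0: "ldet n (R a) \<noteq> 0" unfolding R_def by (rule U.ldet_coords_nonzero[OF e p0])
  have N0: "ldet n (N a) \<noteq> 0" unfolding N_def by (rule V.ldet_coords_nonzero[OF f w0])
  have "\<forall>\<^sub>F t in at a. ldet n (R t) \<noteq> 0"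
    using contR R0 unfolding continuous_at by (rule tendsto_imp_eventually_ne)
  then have "\<forall>\<^sub>F t in nhds a. ldet n (R t) \<noteq> 0"
    using R0 by (simp add: eventually_nhds_conv_at)
  with all lin BZ have "\<forall>\<^sub>F t in nhds a. map_det sV n e f (B t) = (t - a) ^ (\<Sum>i<n. j i) * (ldet n (N t) / ldet n (R t))"
  proof eventually_elim
    case (elim t)
    have "ldet n (M t) * ldet n (R t) = ldet n (\<lambda>i k. (t - a) ^ j k * N t i k)"
      unfolding ldet_mult[symmetric] by (intro ldet_cong entry) (use elim in auto)
    also have "\<dots> = (t - a) ^ (\<Sum>i<n. j i) * ldet n (N t)" by (simp add: ldet_scale_columns power_sum)
    finally have "ldet n (M t) = (t - a) ^ (\<Sum>i<n. j i) * (ldet n (N t) / ldet n (R t))"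
      using elim(4) by (simp add: field_simps)
    then show ?case by (simp add: map_det_def M_def)
  qed
  then obtain d where d: "d > 0"
    "\<forall>t. dist t a < d \<longrightarrow> map_det sV n e f (B t) = (t - a) ^ (\<Sum>i<n. j i) * (ldet n (N t) / ldet n (R t))"
    unfolding eventually_nhds_metric by auto
  show ?thesis unfolding has_order_def
    by (rule exI[of _ "\<lambda>t. ldet n (N t) / ldet n (R t)"], rule exI[of _ d], intro conjI d continuous_divide contN contR R0)
       (use R0 N0 in simp_all)
qed

section \<open>Taylor expansions\<close>

lemma bscale_apply:
  fixes T :: "'u::real_normed_vector \<Rightarrow>\<^sub>L 'v::real_normed_vector"
  assumes "kspace sV"
  shows "blinfun_apply (bscale sV a T) x = sV a (T x)"
proof -
  have "bounded_linear (\<lambda>x. sV a (T x))"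
    by (intro bounded_linear_compose[OF bounded_bilinear.bounded_linear_right[OF kspace_bounded_bilinear[OF assms]]]
        blinfun.bounded_linear_right)
  then show ?thesis by (simp add: bscale_def bounded_linear_Blinfun_apply)
qed

text \<open>Operators form a K-space again, so the Taylor estimate applies to L itself, in the
  operator norm. The lower estimate of the norm follows from the upper one by scaling back with
  \<open>inverse a\<close>.\<close>

lemma kspace_bscale:
  fixes sV :: "'k::real_normed_field \<Rightarrow> 'v::real_normed_vector \<Rightarrow> 'v"
  assumes sV: "kspace sV"
  shows "kspace (bscale sV :: 'k \<Rightarrow> ('u::real_normed_vector \<Rightarrow>\<^sub>L 'v) \<Rightarrow> ('u \<Rightarrow>\<^sub>L 'v))"
proof -
  interpret V: vector_space sV by (rule kspace_vector_space[OF sV])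
  have le: "norm (bscale sV a T) \<le> norm a * norm T" for a and T :: "'u \<Rightarrow>\<^sub>L 'v"
  proof (rule norm_blinfun_bound)
    show "norm (bscale sV a T x) \<le> norm a * norm T * norm x" for x
      using mult_left_mono[OF norm_blinfun[of T x], of "norm a"]
      by (simp add: bscale_apply[OF sV] kspace_norm[OF sV] mult.assoc)
  qed simp
  have mult: "bscale sV (a * b) T = bscale sV a (bscale sV b T)" for a b and T :: "'u \<Rightarrow>\<^sub>L 'v"
    by (rule blinfun_eqI) (simp add: bscale_apply[OF sV])
  have "norm (bscale sV a T) = norm a * norm T" for a and T :: "'u \<Rightarrow>\<^sub>L 'v"
  proof (rule antisym[OF le])
    show "norm a * norm T \<le> norm (bscale sV a T)"
    proof (cases "a = 0")
      case False
      have "T = bscale sV (inverse a) (bscale sV a T)"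
        using False by (intro blinfun_eqI) (simp add: bscale_apply[OF sV])
      then have "norm T \<le> norm (inverse a) * norm (bscale sV a T)" using le[of "inverse a"] by metis
      then have "norm T \<le> norm (bscale sV a T) / norm a"
        using False by (simp only: norm_inverse divide_inverse mult.commute)
      then show ?thesis using False by (simp add: pos_le_divide_eq mult.commute)
    qed simp
  qed
  then show ?thesis unfolding kspace_def
    using sV mult by (auto intro!: blinfun_eqI simp: bscale_apply[OF sV] kspace_def blinfun.bilinear_simps)
qed

text \<open>Induction on r for all sequences D at once: the remainder of order r + 1 has as
  derivative the remainder of order r of the shifted sequence, and the mean value inequality gains
  one power of \<open>norm (t - a)\<close>. In the base case the estimate is continuity of
  \<open>D 0\<close>.\<close>

lemma taylor_little_o:
  fixes s :: "'k::real_normed_field \<Rightarrow> 'x::real_normed_vector \<Rightarrow> 'x"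
  assumes s: "kspace s" and \<Omega>: "open \<Omega>" "a \<in> \<Omega>"
    and der: "\<And>j t. j < r \<Longrightarrow> t \<in> \<Omega> \<Longrightarrow> (D j has_derivative (\<lambda>h. s h (D (Suc j) t))) (at t)"
    and cont: "continuous_on \<Omega> (D r)" and \<epsilon>: "\<epsilon> > 0"
  shows "\<exists>\<delta>>0. \<forall>t. dist t a < \<delta> \<longrightarrow> t \<in> \<Omega> \<and>
    norm (D 0 t - (\<Sum>j\<le>r. s ((t - a) ^ j) (inverse (fact j) *\<^sub>R D j a))) \<le> \<epsilon> * norm (t - a) ^ r"
  using der cont
proof (induction r arbitrary: D)
  case 0
  obtain d where d: "d > 0" "ball a d \<subseteq> \<Omega>" using \<Omega> openE by blast
  obtain d' where d': "d' > 0" "\<And>t. t \<in> \<Omega> \<Longrightarrow> dist t a < d' \<Longrightarrow> dist (D 0 t) (D 0 a) < \<epsilon>"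
    using 0(2) \<Omega> \<epsilon> unfolding continuous_on_iff by blast
  interpret vector_space s by (rule kspace_vector_space[OF s])
  show ?case using d d'
    by (intro exI[of _ "min d d'"]) (auto simp: subset_iff dist_commute dist_norm norm_minus_commute intro!: less_imp_le)
next
  case (Suc r)
  interpret vector_space s by (rule kspace_vector_space[OF s])
  interpret S: bounded_bilinear s by (rule kspace_bounded_bilinear[OF s])
  have sr: "s (of_real q) x = q *\<^sub>R x" for q x using s unfolding kspace_def by blast
  obtain \<delta> where \<delta>: "\<delta> > 0" "\<And>t. dist t a < \<delta> \<Longrightarrow> t \<in> \<Omega> \<and>
      norm (D 1 t - (\<Sum>j\<le>r. s ((t - a) ^ j) (inverse (fact j) *\<^sub>R D (Suc j) a))) \<le> \<epsilon> * norm (t - a) ^ r"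
    using Suc.IH[of "\<lambda>j. D (Suc j)"] Suc.prems by auto
  define g where "g = (\<lambda>t. D 0 t - (\<Sum>j\<le>Suc r. s ((t - a) ^ j) (inverse (fact j) *\<^sub>R D j a)))"
  define g1 where "g1 = (\<lambda>t. D 1 t - (\<Sum>j\<le>r. s ((t - a) ^ j) (inverse (fact j) *\<^sub>R D (Suc j) a)))"
  have ga: "g a = 0" unfolding g_def by (subst sum.atMost_Suc_shift) (simp add: power_0_left)
  have der_g: "(g has_derivative (\<lambda>h. s h (g1 t))) (at t)" if t: "dist t a < \<delta>" for t
  proof -
    have "(D 0 has_derivative (\<lambda>h. s h (D 1 t))) (at t)" using Suc.prems(1)[of 0 t] \<delta>(2)[OF t] by simp
    moreover have "((\<lambda>t. s ((t - a) ^ j) (inverse (fact j) *\<^sub>R D j a)) has_derivative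
        (\<lambda>h. s (of_nat j * h * (t - a) ^ (j - 1)) (inverse (fact j) *\<^sub>R D j a))) (at t)" for j
      by (rule bounded_linear.has_derivative[OF S.bounded_linear_left])
         (auto intro!: derivative_eq_intros)
    ultimately have "(g has_derivative (\<lambda>h. s h (D 1 t) -
        (\<Sum>j\<le>Suc r. s (of_nat j * h * (t - a) ^ (j - 1)) (inverse (fact j) *\<^sub>R D j a)))) (at t)"
      unfolding g_def by (intro has_derivative_diff has_derivative_sum)
    moreover have "s h (D 1 t) - (\<Sum>j\<le>Suc r. s (of_nat j * h * (t - a) ^ (j - 1)) (inverse (fact j) *\<^sub>R D j a))
        = s h (g1 t)" for h
    proof -
      \<comment> \<open>The cancellation (j + 1) / (j + 1)! = 1 / j! mixes a K-scalar with a real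
        one, so the factor j + 1 is first moved through the embedding of the reals.\<close>
      have "s (of_nat (Suc j) * h * (t - a) ^ j) (inverse (fact (Suc j)) *\<^sub>R x)
          = s h (s ((t - a) ^ j) (inverse (fact j) *\<^sub>R x))" for j x
      proof -
        have "s (of_nat (Suc j) * h * (t - a) ^ j) (inverse (fact (Suc j)) *\<^sub>R x)
            = s (h * (t - a) ^ j) (s (of_real (real (Suc j))) (inverse (fact (Suc j)) *\<^sub>R x))"
          unfolding of_real_of_nat_eq scale_scale by (simp add: mult_ac)
        also have "s (of_real (real (Suc j))) (inverse (fact (Suc j)) *\<^sub>R x) = inverse (fact j) *\<^sub>R x"
          unfolding sr by (simp del: of_nat_Suc)
        finally show ?thesis by simp
      qed
      then show ?thesis
        by (subst sum.atMost_Suc_shift) (simp add: g1_def scale_right_diff_distrib scale_sum_right del: of_nat_Suc fact_Suc)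
    qed
    ultimately show ?thesis by simp
  qed
  have "norm (g t) \<le> \<epsilon> * norm (t - a) ^ Suc r" if t: "dist t a < \<delta>" for t
  proof -
    \<comment> \<open>On the closed ball whose boundary contains t, the derivative is bounded by its
      estimate at radius \<open>norm (t - a)\<close>.\<close>
    have "norm (g t - g a) \<le> (\<epsilon> * norm (t - a) ^ r) * norm (t - a)"
    proof (rule differentiable_bound[OF convex_cball[of a "norm (t - a)"]])
      fix x assume x: "x \<in> cball a (norm (t - a))"
      then have xa: "norm (x - a) \<le> norm (t - a)" by (simp add: dist_norm norm_minus_commute)
      then have xd: "dist x a < \<delta>" using t by (simp add: dist_norm)
      show "(g has_derivative (\<lambda>h. s h (g1 x))) (at x within cball a (norm (t - a)))"
        by (rule has_derivative_at_withinI[OF der_g[OF xd]])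
      have "norm (g1 x) \<le> \<epsilon> * norm (x - a) ^ r" using \<delta>(2)[OF xd] by (simp add: g1_def)
      also have "\<dots> \<le> \<epsilon> * norm (t - a) ^ r" using xa \<epsilon> by (intro mult_left_mono power_mono) auto
      finally have "norm (g1 x) \<le> \<epsilon> * norm (t - a) ^ r" .
      then show "onorm (\<lambda>h. s h (g1 x)) \<le> \<epsilon> * norm (t - a) ^ r"
        using \<epsilon> by (intro onorm_bound) (auto simp: kspace_norm[OF s] mult.commute intro: mult_left_mono)
    qed (auto simp: dist_norm norm_minus_commute)
    then show ?thesis by (simp add: ga mult_ac)
  qed
  then show ?case using \<delta> by (intro exI[of _ \<delta>]) (simp add: g_def)
qed

section \<open>Divisibility of L(t) u(t) for polynomials u\<close>

text \<open>Cauchy product: the coefficient of t^l in A(t) u(t), where A(t) and u(t) have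
  coefficients \<open>A i\<close> and \<open>u b\<close>.\<close>

definition coeff_conv :: "(nat \<Rightarrow> 'u \<Rightarrow> 'v::comm_monoid_add) \<Rightarrow> (nat \<Rightarrow> 'u) \<Rightarrow> nat \<Rightarrow> 'v" where
  "coeff_conv A u l = (\<Sum>b\<le>l. A (l - b) (u b))"

text \<open>The double sum is grouped by the degree i + b. Since r \<le> m, antidiagonals of degree
  at most r lie entirely in the rectangle, so those below j vanish and the one of degree j is
  complete. Antidiagonals of higher degree may be truncated, but contribute nothing to
  \<open>G 0\<close>.\<close>

lemma truncated_product_factor:
  fixes s :: "'k::real_normed_field \<Rightarrow> 'v::real_normed_vector \<Rightarrow> 'v" and v :: "nat \<Rightarrow> nat \<Rightarrow> 'v"
  assumes s: "kspace s" and jr: "j \<le> r" "r \<le> m"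
    and low: "\<And>l. l < j \<Longrightarrow> (\<Sum>b\<le>l. v (l - b) b) = 0"
  obtains G where "continuous_on UNIV G" "G 0 = (\<Sum>b\<le>j. v (j - b) b)"
    "\<And>t. (\<Sum>i\<le>r. \<Sum>b\<le>m. s (t ^ (i + b)) (v i b)) = s (t ^ j) (G t)"
proof -
  interpret vector_space s by (rule kspace_vector_space[OF s])
  interpret S: bounded_bilinear s by (rule kspace_bounded_bilinear[OF s])
  define I where "I = {..r} \<times> {..m}"
  have fin: "finite I" by (simp add: I_def)
  have diag: "(\<Sum>p\<in>{p \<in> I. fst p + snd p = l}. h (fst p) (snd p)) = (\<Sum>b\<le>l. h (l - b) b)"
    if "l \<le> r" for l and h :: "nat \<Rightarrow> nat \<Rightarrow> 'v"
    by (rule sum.reindex_bij_witness[of _ "\<lambda>b. (l - b, b)" snd]) (use that jr in \<open>auto simp: I_def\<close>)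
  define G where "G = (\<lambda>t. \<Sum>p\<in>{p \<in> I. j \<le> fst p + snd p}. s (t ^ (fst p + snd p - j)) (v (fst p) (snd p)))"
  show ?thesis
  proof (rule that[of G])
    show "continuous_on UNIV G" unfolding G_def
      by (intro continuous_on_sum S.continuous_on continuous_intros)
    have "G 0 = (\<Sum>p\<in>{p \<in> I. fst p + snd p = j}. v (fst p) (snd p))" unfolding G_def
      by (rule sum.mono_neutral_cong_right) (use fin in \<open>auto simp: power_0_left\<close>)
    then show "G 0 = (\<Sum>b\<le>j. v (j - b) b)" using diag[OF jr(1), of v] by simp
    fix t
    have "(\<Sum>i\<le>r. \<Sum>b\<le>m. s (t ^ (i + b)) (v i b)) = (\<Sum>p\<in>I. s (t ^ (fst p + snd p)) (v (fst p) (snd p)))"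
      unfolding I_def by (simp add: sum.cartesian_product case_prod_beta)
    also have "I = {p \<in> I. fst p + snd p < j} \<union> {p \<in> I. j \<le> fst p + snd p}" by auto
    also have "(\<Sum>p\<in>\<dots>. s (t ^ (fst p + snd p)) (v (fst p) (snd p))) =
       (\<Sum>p\<in>{p \<in> I. fst p + snd p < j}. s (t ^ (fst p + snd p)) (v (fst p) (snd p))) +
       (\<Sum>p\<in>{p \<in> I. j \<le> fst p + snd p}. s (t ^ (fst p + snd p)) (v (fst p) (snd p)))"
      using fin by (intro sum.union_disjoint) auto
    also have "(\<Sum>p\<in>{p \<in> I. fst p + snd p < j}. s (t ^ (fst p + snd p)) (v (fst p) (snd p)))
       = (\<Sum>l\<in>{..<j}. \<Sum>p\<in>{p \<in> {p \<in> I. fst p + snd p < j}. fst p + snd p = l}. s (t ^ (fst p + snd p)) (v (fst p) (snd p)))"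
      using fin by (intro sum.group[symmetric]) auto
    also have "\<dots> = (\<Sum>l\<in>{..<j}. 0)"
    proof (rule sum.cong[OF refl])
      fix l assume l: "l \<in> {..<j}"
      then have "{p \<in> {p \<in> I. fst p + snd p < j}. fst p + snd p = l} = {p \<in> I. fst p + snd p = l}" by auto
      then have "(\<Sum>p\<in>{p \<in> {p \<in> I. fst p + snd p < j}. fst p + snd p = l}. s (t ^ (fst p + snd p)) (v (fst p) (snd p)))
        = (\<Sum>p\<in>{p \<in> I. fst p + snd p = l}. s (t ^ (fst p + snd p)) (v (fst p) (snd p)))" by simp
      also have "\<dots> = s (t ^ l) (\<Sum>p\<in>{p \<in> I. fst p + snd p = l}. v (fst p) (snd p))"
        unfolding scale_sum_right by (rule sum.cong) auto
      also have "\<dots> = 0" using l jr diag[of l v] low[of l] by simp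
      finally show "(\<Sum>p\<in>{p \<in> {p \<in> I. fst p + snd p < j}. fst p + snd p = l}. s (t ^ (fst p + snd p)) (v (fst p) (snd p))) = 0" .
    qed
    also have "(\<Sum>p\<in>{p \<in> I. j \<le> fst p + snd p}. s (t ^ (fst p + snd p)) (v (fst p) (snd p))) = s (t ^ j) (G t)"
      unfolding G_def scale_sum_right by (rule sum.cong) (auto simp: power_add[symmetric])
    finally show "(\<Sum>i\<le>r. \<Sum>b\<le>m. s (t ^ (i + b)) (v i b)) = s (t ^ j) (G t)" by simp
  qed
qed

definition taylor_coeff :: "(nat \<Rightarrow> 'k \<Rightarrow> ('u::real_normed_vector \<Rightarrow>\<^sub>L 'v::real_normed_vector)) \<Rightarrow> 'k \<Rightarrow> nat \<Rightarrow> 'u \<Rightarrow> 'v" where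
  "taylor_coeff Ls a i = blinfun_apply ((inverse (fact i) :: real) *\<^sub>R Ls i a)"

definition vpoly :: "('k::real_normed_field \<Rightarrow> 'u::real_normed_vector \<Rightarrow> 'u) \<Rightarrow> 'k \<Rightarrow> nat \<Rightarrow> (nat \<Rightarrow> 'u) \<Rightarrow> 'k \<Rightarrow> 'u" where
  "vpoly s a m u t = (\<Sum>b\<le>m. s ((t - a) ^ b) (u b))"

lemma vpoly_center: "kspace s \<Longrightarrow> vpoly s a m u a = u 0"
proof -
  assume s: "kspace s"
  interpret vector_space s by (rule kspace_vector_space[OF s])
  have "vpoly s a m u a = (\<Sum>b\<le>m. if b = 0 then u b else 0)"
    unfolding vpoly_def by (rule sum.cong) (auto simp: power_0_left)
  then show ?thesis by simp
qed

lemma continuous_on_vpoly: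
  assumes "kspace s"
  shows "continuous_on UNIV (vpoly s a m u)"
  unfolding vpoly_def
  by (intro continuous_on_sum bounded_bilinear.continuous_on[OF kspace_bounded_bilinear[OF assms]] continuous_intros)

text \<open>L is split into its Taylor polynomial of order r and a remainder E. The polynomial part
  of the product is divisible by (t - a)^j, and E = o((t - a)^r) remains negligible after division
  by (t - a)^j because j \<le> r.\<close>

lemma apply_vpoly_factor:
  fixes sU :: "'k::real_normed_field \<Rightarrow> 'u::real_normed_vector \<Rightarrow> 'u"
    and sV :: "'k \<Rightarrow> 'v::real_normed_vector \<Rightarrow> 'v"
  assumes sU: "kspace sU" and sV: "kspace sV" and \<Omega>: "open \<Omega>" "a \<in> \<Omega>"
    and Cr: "kCr sU sV \<Omega> r L Ls" and jr: "j \<le> r" "r \<le> m"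
    and low: "\<And>l. l < j \<Longrightarrow> coeff_conv (taylor_coeff Ls a) u l = 0"
  obtains w where "continuous (at a) w" "w a = coeff_conv (taylor_coeff Ls a) u j"
    "\<forall>\<^sub>F t in nhds a. L t (vpoly sU a m u t) = sV ((t - a) ^ j) (w t)"
proof -
  interpret U: vector_space sU by (rule kspace_vector_space[OF sU])
  interpret V: vector_space sV by (rule kspace_vector_space[OF sV])
  have L0: "Ls 0 t = L t" if "t \<in> \<Omega>" for t using Cr that unfolding kCr_def by blast
  have der: "(Ls i has_derivative (\<lambda>h. bscale sV h (Ls (Suc i) t))) (at t)" if "i < r" "t \<in> \<Omega>" for i t
    using Cr that unfolding kCr_def by blast
  have cont: "continuous_on \<Omega> (Ls r)" using Cr unfolding kCr_def by blast
  have lin: "taylor_coeff Ls a i (sU c x) = sV c (taylor_coeff Ls a i x)" if "i \<le> r" for i c x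
  proof -
    have "Ls i a (sU c x) = sV c (Ls i a x)" using Cr that \<Omega> unfolding kCr_def kbl_def by blast
    moreover have "sV c (q *\<^sub>R y) = q *\<^sub>R sV c y" for q y
      by (rule bounded_bilinear.scaleR_right[OF kspace_bounded_bilinear[OF sV]])
    ultimately show ?thesis by (simp add: taylor_coeff_def blinfun.scaleR_left)
  qed
  define v where "v = (\<lambda>i b. taylor_coeff Ls a i (u b))"
  have low': "(\<Sum>b\<le>l. v (l - b) b) = 0" if "l < j" for l using low[OF that] by (simp add: v_def coeff_conv_def)
  obtain G where G: "continuous_on UNIV G" "G 0 = (\<Sum>b\<le>j. v (j - b) b)"
    "\<And>t. (\<Sum>i\<le>r. \<Sum>b\<le>m. sV (t ^ (i + b)) (v i b)) = sV (t ^ j) (G t)"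
    by (rule truncated_product_factor[OF sV jr low']) blast+
  define E where "E = (\<lambda>t. L t - (\<Sum>i\<le>r. bscale sV ((t - a) ^ i) (inverse (fact i) *\<^sub>R Ls i a)))"
  have Esmall: "\<exists>\<delta>>0. \<forall>t. dist t a < \<delta> \<longrightarrow> t \<in> \<Omega> \<and> norm (E t) \<le> \<epsilon> * norm (t - a) ^ r" if \<epsilon>: "\<epsilon> > 0" for \<epsilon>
  proof -
    obtain \<delta> where "\<delta> > 0" "\<And>t. dist t a < \<delta> \<Longrightarrow> t \<in> \<Omega> \<and>
       norm (Ls 0 t - (\<Sum>j\<le>r. bscale sV ((t - a) ^ j) (inverse (fact j) *\<^sub>R Ls j a))) \<le> \<epsilon> * norm (t - a) ^ r"
      using taylor_little_o[OF kspace_bscale[OF sV] \<Omega> der cont \<epsilon>] by auto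
    then show ?thesis unfolding E_def by (intro exI[of _ \<delta>]) (simp add: L0[symmetric])
  qed
  define U where "U = vpoly sU a m u"
  have decomp: "L t (U t) = sV ((t - a) ^ j) (G (t - a)) + E t (U t)" for t
  proof -
    have "L t (U t) - E t (U t) = (\<Sum>i\<le>r. sV ((t - a) ^ i) (taylor_coeff Ls a i (U t)))"
      by (simp add: E_def blinfun.bilinear_simps bscale_apply[OF sV] taylor_coeff_def blinfun.sum_left)
    also have "\<dots> = (\<Sum>i\<le>r. \<Sum>b\<le>m. sV ((t - a) ^ (i + b)) (v i b))"
    proof (rule sum.cong[OF refl])
      fix i assume "i \<in> {..r}"
      then have "taylor_coeff Ls a i (U t) = (\<Sum>b\<le>m. sV ((t - a) ^ b) (v i b))"
        unfolding U_def vpoly_def v_def by (simp add: lin[symmetric]) (simp add: taylor_coeff_def blinfun.sum_right)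
      then show "sV ((t - a) ^ i) (taylor_coeff Ls a i (U t)) = (\<Sum>b\<le>m. sV ((t - a) ^ (i + b)) (v i b))"
        by (simp add: V.scale_sum_right power_add)
    qed
    finally show ?thesis by (simp add: G(3) algebra_simps)
  qed
  \<comment> \<open>For r = 0 the bound at a only says \<open>norm (E a) \<le> 1\<close>, so that
    case is computed directly.\<close>
  have Ea: "E a = 0"
  proof -
    obtain \<delta> where "\<delta> > 0" "\<forall>t. dist t a < \<delta> \<longrightarrow> t \<in> \<Omega> \<and> norm (E t) \<le> 1 * norm (t - a) ^ r"
      using Esmall[of 1] by auto
    show ?thesis
    proof (cases "r = 0")
      case True then show ?thesis using L0[OF \<Omega>(2)] by (simp add: E_def) (rule blinfun_eqI, simp add: bscale_apply[OF sV])
    next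
      case False then show ?thesis using \<open>\<delta> > 0\<close> \<open>\<forall>t. _ t\<close> by (auto dest!: spec[of _ a] simp: power_0_left)
    qed
  qed
  \<comment> \<open>As \<open>E a = 0\<close>, the second summand vanishes at t = a whatever the
    value of the inverse there, so the formula needs no case distinction.\<close>
  define w where "w = (\<lambda>t. G (t - a) + sV (inverse ((t - a) ^ j)) (E t (U t)))"
  have wa: "w a = coeff_conv (taylor_coeff Ls a) u j"
    using Ea by (simp add: w_def G(2) v_def coeff_conv_def)
  have eq: "L t (U t) = sV ((t - a) ^ j) (w t)" for t
    by (cases "t = a") (simp_all add: decomp w_def Ea V.scale_right_distrib)
  have Ucont: "(U \<longlongrightarrow> U a) (at a)"
    using continuous_on_vpoly[OF sU] unfolding U_def by (simp add: continuous_on_eq_continuous_at continuous_at)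
  have "((\<lambda>t. sV (inverse ((t - a) ^ j)) (E t (U t))) \<longlongrightarrow> 0) (at a)"
  proof (rule tendstoI)
    fix \<epsilon> :: real assume \<epsilon>: "\<epsilon> > 0"
    \<comment> \<open>K bounds \<open>U t\<close> near a, so the tolerance \<epsilon>/(2K) leaves
      \<epsilon>/2. Staying within distance 1 of a allows the power r to be replaced by the smaller
      power j.\<close>
    define K where "K = norm (U a) + 1"
    have K: "K > 0" unfolding K_def by (simp add: add_nonneg_pos)
    have "\<forall>\<^sub>F t in at a. norm (U t) < K"
      using tendsto_norm[OF Ucont] unfolding K_def by (rule order_tendstoD) simp
    moreover obtain \<delta> where \<delta>: "\<delta> > 0" "\<forall>t. dist t a < \<delta> \<longrightarrow> t \<in> \<Omega> \<and> norm (E t) \<le> \<epsilon> / (2 * K) * norm (t - a) ^ r"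
      using Esmall[of "\<epsilon> / (2 * K)"] \<epsilon> K by auto
    have "\<forall>\<^sub>F t in at a. t \<noteq> a \<and> dist t a < min \<delta> 1"
      unfolding eventually_at using \<delta>(1) by (intro exI[of _ "min \<delta> 1"]) auto
    ultimately show "\<forall>\<^sub>F t in at a. dist (sV (inverse ((t - a) ^ j)) (E t (U t))) 0 < \<epsilon>"
    proof eventually_elim
      case (elim t)
      have n: "0 < norm (t - a)" "norm (t - a) \<le> 1" using elim by (auto simp: dist_norm)
      have "norm (E t (U t)) \<le> norm (E t) * norm (U t)" by (rule norm_blinfun)
      also have "\<dots> \<le> (\<epsilon> / (2 * K) * norm (t - a) ^ r) * K"
        using elim \<delta>(2) K \<epsilon> by (intro mult_mono) auto
      also have "\<dots> = \<epsilon> / 2 * norm (t - a) ^ r" using K by simp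
      also have "\<dots> \<le> \<epsilon> / 2 * norm (t - a) ^ j"
        using \<epsilon> n jr by (intro mult_left_mono power_decreasing) auto
      finally have "norm (E t (U t)) / norm (t - a) ^ j \<le> \<epsilon> / 2" using n by (simp add: pos_divide_le_eq)
      moreover have "norm (sV (inverse ((t - a) ^ j)) (E t (U t))) = norm (E t (U t)) / norm (t - a) ^ j"
        by (simp only: kspace_norm[OF sV] norm_inverse norm_power divide_inverse mult.commute)
      ultimately show ?case using \<epsilon> unfolding dist_norm diff_zero by linarith
    qed
  qed
  moreover have "((\<lambda>t. G (t - a)) \<longlongrightarrow> G (a - a)) (at a)"
  proof (rule isCont_tendsto_compose[of _ G])
    show "isCont G (a - a)" using G(1) by (simp add: continuous_on_eq_continuous_at)
  qed (intro tendsto_intros)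
  ultimately have "(w \<longlongrightarrow> G (a - a) + 0) (at a)" unfolding w_def by (intro tendsto_add)
  then have "continuous (at a) w" unfolding continuous_at using Ea by (simp add: w_def)
  then show ?thesis using wa eq unfolding U_def by (intro that[of w]) simp_all
qed

text \<open>L u = (t - a)^\<kappa> w, where the vanishing of the coefficient of index \<kappa>
  itself gives \<open>w a = 0\<close>. The bound on the inverse cancels the power and yields
  \<open>norm (u t) \<le> C * norm (w t)\<close>, hence u(a) = 0. So a chain with nonzero start has
  at most \<kappa> vanishing coefficients.\<close>

lemma chain_length_bound:
  fixes sU :: "'k::real_normed_field \<Rightarrow> 'u::real_normed_vector \<Rightarrow> 'u"
    and sV :: "'k \<Rightarrow> 'v::real_normed_vector \<Rightarrow> 'v"
  assumes sU: "kspace sU" and sV: "kspace sV" and \<Omega>: "open \<Omega>" "a \<in> \<Omega>"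
    and Cr: "kCr sU sV \<Omega> r L Ls" and \<kappa>: "\<kappa> \<le> r" and "\<epsilon> > 0"
    and inv: "\<And>t. 0 < dist t a \<Longrightarrow> dist t a < \<epsilon> \<Longrightarrow> bij (blinfun_apply (L t)) \<and>
       bounded_linear (inv_into UNIV (blinfun_apply (L t))) \<and> onorm (inv_into UNIV (blinfun_apply (L t))) < C / norm (t - a) ^ \<kappa>"
    and chain: "\<And>l. l \<le> \<kappa> \<Longrightarrow> coeff_conv (taylor_coeff Ls a) u l = 0"
  shows "u 0 = 0"
proof -
  have low: "coeff_conv (taylor_coeff Ls a) u l = 0" if "l < \<kappa>" for l using chain that by simp
  obtain w where w: "continuous (at a) w" "w a = coeff_conv (taylor_coeff Ls a) u \<kappa>"
    "\<forall>\<^sub>F t in nhds a. L t (vpoly sU a r u t) = sV ((t - a) ^ \<kappa>) (w t)"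
    by (rule apply_vpoly_factor[OF sU sV \<Omega> Cr \<kappa> order_refl low])
  have wt: "(w \<longlongrightarrow> 0) (at a)" using w(1,2) chain[of \<kappa>] by (simp add: continuous_at)
  have ev: "\<forall>\<^sub>F t in at a. L t (vpoly sU a r u t) = sV ((t - a) ^ \<kappa>) (w t)"
    using w(3) by (auto simp: eventually_at_filter elim: eventually_mono)
  have ev2: "\<forall>\<^sub>F t in at a. 0 < dist t a \<and> dist t a < \<epsilon>"
    unfolding eventually_at using \<open>\<epsilon> > 0\<close> by auto
  have "(vpoly sU a r u \<longlongrightarrow> 0) (at a)"
  proof (rule Lim_null_comparison)
    show "\<forall>\<^sub>F t in at a. norm (vpoly sU a r u t) \<le> C * norm (w t)"
      using ev ev2
    proof eventually_elim
      case (elim t)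
      let ?T = "inv_into UNIV (blinfun_apply (L t))"
      have T: "bij (blinfun_apply (L t))" "bounded_linear ?T" "onorm ?T < C / norm (t - a) ^ \<kappa>"
        using inv[of t] elim by auto
      have pos: "norm (t - a) ^ \<kappa> > 0" using elim by (simp add: dist_norm)
      have "vpoly sU a r u t = ?T (L t (vpoly sU a r u t))" using T(1) by (simp add: bij_is_inj)
      also have "norm \<dots> \<le> onorm ?T * norm (L t (vpoly sU a r u t))" by (rule onorm[OF T(2)])
      also have "\<dots> \<le> C / norm (t - a) ^ \<kappa> * norm (L t (vpoly sU a r u t))"
        using T(3) by (intro mult_right_mono) auto
      also have "\<dots> = C * norm (w t)" using pos elim by (simp add: kspace_norm[OF sV] norm_power)
      finally show ?case .
    qed
    show "((\<lambda>t. C * norm (w t)) \<longlongrightarrow> 0) (at a)"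
      by (rule tendsto_mult_right_zero[OF tendsto_norm_zero[OF wt]])
  qed
  moreover have "(vpoly sU a r u \<longlongrightarrow> vpoly sU a r u a) (at a)"
    using continuous_on_vpoly[OF sU] by (simp add: continuous_on_eq_continuous_at continuous_at)
  ultimately have "vpoly sU a r u a = 0" using LIM_unique by blast
  then show ?thesis by (simp add: vpoly_center[OF sU])
qed

section \<open>Transversal families\<close>

lemma indep_familyD: "indep_family s n e \<Longrightarrow> lincomb s n e c = 0 \<Longrightarrow> i < n \<Longrightarrow> c i = 0"
  unfolding indep_family_def by simp

text \<open>The linear algebra of the Taylor coefficients, free of topology: q stands for I - Q and
  Z for its range, a complement of the range of \<open>M 0\<close>. That e and f have the same
  length n expresses index zero.\<close>

locale graded_family =
  fixes sU :: "'k::field \<Rightarrow> 'u::ab_group_add \<Rightarrow> 'u" and sV :: "'k \<Rightarrow> 'v::ab_group_add \<Rightarrow> 'v"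
    and M :: "nat \<Rightarrow> 'u \<Rightarrow> 'v" and r :: nat and q :: "'v \<Rightarrow> 'v" and Z :: "'v set"
    and n :: nat and e :: "nat \<Rightarrow> 'u" and f :: "nat \<Rightarrow> 'v"
  assumes vsU: "vector_space sU" and vsV: "vector_space sV"
    and M_add: "\<And>j x y. j \<le> r \<Longrightarrow> M j (x + y) = M j x + M j y"
    and M_scale: "\<And>j c x. j \<le> r \<Longrightarrow> M j (sU c x) = sV c (M j x)"
    and q_add: "\<And>v w. q (v + w) = q v + q w" and q_scale: "\<And>c v. q (sV c v) = sV c (q v)"
    and q_kernel: "\<And>v. q v = 0 \<longleftrightarrow> v \<in> range (M 0)"
    and q_mem: "\<And>v. q v \<in> Z" and q_fix: "\<And>v. v \<in> Z \<Longrightarrow> q v = v"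
    and e: "kbasis sU {x. M 0 x = 0} n e" and f: "kbasis sV Z n f"
begin

sublocale U: vector_space sU by (rule vsU)
sublocale V: vector_space sV by (rule vsV)

lemma M_zero: "j \<le> r \<Longrightarrow> M j 0 = 0"
  using M_scale[of j 0 0] by simp

lemma M_sum: "j \<le> r \<Longrightarrow> M j (sum h I) = (\<Sum>i\<in>I. M j (h i))"
  by (induction I rule: infinite_finite_induct) (auto simp: M_zero M_add)

lemma M_lincomb: "j \<le> r \<Longrightarrow> M j (lincomb sU m g c) = lincomb sV m (\<lambda>i. M j (g i)) c"
  by (simp add: lincomb_def M_sum M_scale)

lemma q_zero: "q 0 = 0"
  using q_scale[of 0 0] by simp

lemma q_sum: "q (sum h I) = (\<Sum>i\<in>I. q (h i))"
  by (induction I rule: infinite_finite_induct) (auto simp: q_zero q_add)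

lemma q_lincomb: "q (lincomb sV m g c) = lincomb sV m (\<lambda>i. q (g i)) c"
  by (simp add: lincomb_def q_sum q_scale)

lemma q_diff: "q (v - w) = q v - q w"
  using q_add[of "v - w" w] by simp

lemma M_diff: "j \<le> r \<Longrightarrow> M j (x - y) = M j x - M j y"
  using M_add[of j "x - y" y] by simp

lemma subspace_kerint: "j \<le> Suc r \<Longrightarrow> U.subspace (kerint M j)"
  by (rule U.subspaceI) (auto simp: kerint_def M_zero M_add M_scale)

lemma subspace_Tsp:
  assumes "j \<le> r"
  shows "V.subspace (Tsp M j)"
proof -
  have K: "U.subspace (kerint M j)" using subspace_kerint assms by simp
  show ?thesis
  proof (rule V.subspaceI)
    show "0 \<in> Tsp M j" unfolding Tsp_def
      by (rule image_eqI[of _ _ 0]) (use assms U.subspace_0[OF K] in \<open>auto simp: M_zero\<close>)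
    fix x y assume "x \<in> Tsp M j" "y \<in> Tsp M j"
    then obtain x' y' where "x = M j x'" "y = M j y'" "x' \<in> kerint M j" "y' \<in> kerint M j"
      unfolding Tsp_def by (elim imageE)
    then show "x + y \<in> Tsp M j" unfolding Tsp_def
      by (intro image_eqI[of _ _ "x' + y'"]) (simp_all add: M_add assms U.subspace_add[OF K])
  next
    fix c x assume "x \<in> Tsp M j"
    then obtain x' where "x = M j x'" "x' \<in> kerint M j" unfolding Tsp_def by (elim imageE)
    then show "sV c x \<in> Tsp M j" unfolding Tsp_def
      by (intro image_eqI[of _ _ "sU c x'"]) (simp_all add: M_scale assms U.subspace_scale[OF K])
  qed
qed

text \<open>For j \<ge> 1, \<open>kerint M j\<close> lies in the kernel of \<open>M 0\<close>, which
  is spanned by n vectors.\<close>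

lemma finite_indep_subset_Tsp:
  assumes j: "1 \<le> j" "j \<le> r" and G: "V.independent G" "G \<subseteq> Tsp M j"
  shows "finite G"
proof -
  have "G \<subseteq> V.span ((\<lambda>i. M j (e i)) ` {..<n})"
  proof
    fix v assume "v \<in> G"
    then have "v \<in> Tsp M j" using G by blast
    then obtain x where x: "v = M j x" "x \<in> kerint M j" unfolding Tsp_def by (elim imageE)
    then have "x \<in> {x. M 0 x = 0}" using j by (simp add: kerint_def)
    from U.lincomb_coords[OF e this] have "v = lincomb sV n (\<lambda>i. M j (e i)) (coords sU n e x)"
      using M_lincomb[OF j(2), of n e] x by metis
    then show "v \<in> V.span ((\<lambda>i. M j (e i)) ` {..<n})" unfolding V.span_image_lessThan by simp
  qed
  then show ?thesis using V.independent_span_bound[OF _ G(1), of "(\<lambda>i. M j (e i)) ` {..<n}"] by simp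
qed

end

section \<open>Bases adapted to a transversal family\<close>

text \<open>Zeroing the coefficients of other grades, instead of restricting the index set, keeps
  every graded component a \<open>lincomb\<close> over the same n vectors.\<close>

definition part_comb :: "('k::comm_ring_1 \<Rightarrow> 'v::ab_group_add \<Rightarrow> 'v) \<Rightarrow> nat \<Rightarrow> (nat \<Rightarrow> 'v) \<Rightarrow> (nat \<Rightarrow> nat) \<Rightarrow> nat \<Rightarrow> (nat \<Rightarrow> 'k) \<Rightarrow> 'v" where
  "part_comb s n F J j c = lincomb s n F (\<lambda>i. if J i = j then c i else 0)"

lemma (in vector_space) sum_part_comb:
  assumes "\<And>i. i < n \<Longrightarrow> 1 \<le> J i \<and> J i \<le> \<kappa>"
  shows "(\<Sum>j=1..\<kappa>. part_comb scale n F J j c) = lincomb scale n F c"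
proof -
  have "(\<Sum>j=1..\<kappa>. part_comb scale n F J j c) = (\<Sum>i<n. \<Sum>j=1..\<kappa>. scale (if J i = j then c i else 0) (F i))"
    unfolding part_comb_def lincomb_def by (rule sum.swap)
  also have "\<dots> = (\<Sum>i<n. \<Sum>j=1..\<kappa>. if J i = j then scale (c i) (F i) else 0)"
    by (intro sum.cong) auto
  also have "\<dots> = lincomb scale n F c" unfolding lincomb_def
    by (intro sum.cong) (use assms in \<open>auto simp: sum.delta'\<close>)
  finally show ?thesis .
qed

text \<open>A normal form for transversality: \<open>g i\<close> is annihilated up to order
  \<open>J i - 1\<close>, and the first images that may survive form a basis modulo the range of
  \<open>M 0\<close>. \<open>J_max\<close> matches the clause
  \<open>Tsp M \<kappa> \<noteq> {0}\<close>; if n = 0 it forces \<kappa> = 0.\<close>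

locale adapted_basis = graded_family +
  fixes g :: "nat \<Rightarrow> 'b" and J :: "nat \<Rightarrow> nat" and \<kappa> :: nat
  assumes g: "kbasis sU {x. M 0 x = 0} n g"
    and J_ge: "\<And>i. i < n \<Longrightarrow> 1 \<le> J i" and J_le: "\<And>i. i < n \<Longrightarrow> J i \<le> \<kappa>" and \<kappa>: "\<kappa> \<le> r"
    and J_max: "1 \<le> \<kappa> \<Longrightarrow> \<exists>i<n. J i = \<kappa>"
    and g_ker: "\<And>i l. i < n \<Longrightarrow> l < J i \<Longrightarrow> M l (g i) = 0"
    and F: "kbasis sV Z n (\<lambda>i. q (M (J i) (g i)))"
begin

abbreviation FF :: "nat \<Rightarrow> 'c" where "FF i \<equiv> M (J i) (g i)"

abbreviation grade_part :: "nat \<Rightarrow> (nat \<Rightarrow> 'a) \<Rightarrow> 'c" where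
  "grade_part \<equiv> part_comb sV n FF J"

lemma q_FF_indep: "indep_family sV n (\<lambda>i. q (FF i))"
  using F by (simp add: V.kbasis_iff)

text \<open>\<open>M l\<close> annihilates the vectors of grade above l, and those of grade below l
  carry coefficient 0.\<close>

lemma M_eq_part:
  assumes "l \<le> r" "\<And>i. i < n \<Longrightarrow> J i < l \<Longrightarrow> c i = 0"
  shows "M l (lincomb sU n g c) = grade_part l c"
  unfolding M_lincomb[OF assms(1)] unfolding part_comb_def lincomb_def
proof (rule sum.cong[OF refl])
  fix i assume "i \<in> {..<n}"
  then show "sV (c i) (M l (g i)) = sV (if J i = l then c i else 0) (FF i)"
    using assms(2)[of i] g_ker[of i l] by (cases "J i" l rule: linorder_cases) auto
qed

lemma part_zeroD:
  assumes "grade_part l c = 0" "i < n" "J i = l"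
  shows "c i = 0"
proof -
  have "lincomb sV n (\<lambda>i. q (FF i)) (\<lambda>i. if J i = l then c i else 0) = 0"
    using arg_cong[OF assms(1), of q] by (simp add: part_comb_def q_lincomb q_zero)
  from indep_familyD[OF q_FF_indep this assms(2)] show ?thesis using assms(3) by simp
qed

text \<open>Coefficients are eliminated grade by grade: once those below l are zero,
  \<open>M l x = 0\<close> is a relation among the images of grade l, which are independent even
  after applying q.\<close>

lemma kerint_coeffs:
  assumes x: "x \<in> kerint M j" and j: "1 \<le> j" "j \<le> Suc \<kappa>"
  obtains c where "x = lincomb sU n g c" "\<And>i. i < n \<Longrightarrow> J i < j \<Longrightarrow> c i = 0"
proof -
  have "x \<in> {x. M 0 x = 0}" using x j by (simp add: kerint_def)
  define c where "c = coords sU n g x"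
  have xc: "x = lincomb sU n g c" unfolding c_def
    using U.lincomb_coords[OF g \<open>x \<in> {x. M 0 x = 0}\<close>] by simp
  have "\<forall>i<n. J i = l \<longrightarrow> c i = 0" if "l < j" for l
    using that
  proof (induction l rule: less_induct)
    case (less l)
    have "M l x = grade_part l c" unfolding xc
      using less j \<kappa> by (intro M_eq_part) auto
    moreover have "M l x = 0" using x less.prems by (simp add: kerint_def)
    ultimately show ?case using part_zeroD by auto
  qed
  then show ?thesis using that[OF xc] by blast
qed

lemma Tsp_eq:
  assumes j: "1 \<le> j" "j \<le> \<kappa>"
  shows "Tsp M j = range (grade_part j)"
proof
  show "Tsp M j \<subseteq> range (grade_part j)"
  proof
    fix v assume "v \<in> Tsp M j"
    then obtain x where x: "v = M j x" "x \<in> kerint M j" unfolding Tsp_def by (elim imageE)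
    obtain c where c: "x = lincomb sU n g c" "\<And>i. i < n \<Longrightarrow> J i < j \<Longrightarrow> c i = 0"
      by (rule kerint_coeffs[OF x(2)]) (use j in auto)
    have "v = grade_part j c" unfolding x(1) c(1) by (rule M_eq_part) (use c j \<kappa> in auto)
    then show "v \<in> range (grade_part j)" by simp
  qed
  show "range (grade_part j) \<subseteq> Tsp M j"
  proof clarify
    fix c :: "nat \<Rightarrow> 'a"
    define d where "d = (\<lambda>i. if J i = j then c i else 0)"
    have "grade_part j c = M j (lincomb sU n g d)"
      by (subst M_eq_part) (use j \<kappa> in \<open>auto simp: d_def part_comb_def cong: if_cong\<close>)
    moreover have "lincomb sU n g d \<in> kerint M j" unfolding kerint_def
    proof (clarify)
      fix l assume l: "l < j"
      have "M l (lincomb sU n g d) = grade_part l d" by (rule M_eq_part) (use l j \<kappa> in \<open>auto simp: d_def\<close>)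
      also have "\<dots> = 0" unfolding part_comb_def lincomb_def using l by (intro sum.neutral) (auto simp: d_def)
      finally show "M l (lincomb sU n g d) = 0" .
    qed
    ultimately show "grade_part j c \<in> Tsp M j" unfolding Tsp_def by simp
  qed
qed

lemma q_FF_lincomb_coords:
  "lincomb sV n (\<lambda>i. q (FF i)) (coords sV n (\<lambda>i. q (FF i)) (q v)) = q v"
  by (rule V.lincomb_coords[OF F q_mem])

lemma sum_atMost_split: "(\<Sum>j\<le>\<kappa>. w j) = w 0 + (\<Sum>j=1..\<kappa>. w j)" for w :: "nat \<Rightarrow> 'c"
  by (simp add: atLeast0AtMost[symmetric] sum.atLeast_Suc_atMost)

text \<open>Applying q removes the component in the range of \<open>M 0\<close>, so the remaining
  coefficients can only be the coordinates of \<open>q v\<close> in the basis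
  \<open>q (FF i)\<close>. With this choice the rest of v lies in the kernel of q, which is the
  range of \<open>M 0\<close>.\<close>

theorem transversal: "transversal M \<kappa>"
proof -
  have sum_part: "(\<Sum>j=1..\<kappa>. grade_part j c) = lincomb sV n FF c" for c
    by (rule V.sum_part_comb) (use J_ge J_le in auto)
  have nontriv: "Tsp M \<kappa> \<noteq> {0}" if k: "1 \<le> \<kappa>"
  proof
    assume T: "Tsp M \<kappa> = {0}"
    obtain i where i: "i < n" "J i = \<kappa>" using J_max[OF k] by blast
    have "grade_part \<kappa> (\<lambda>_. 1) \<in> Tsp M \<kappa>" unfolding Tsp_eq[OF k order_refl] by simp
    then have "grade_part \<kappa> (\<lambda>_. 1) = 0" using T by simp
    from part_zeroD[OF this i] show False by simp
  qed
  have "\<exists>!w. w 0 \<in> range (M 0) \<and> (\<forall>j\<in>{1..\<kappa>}. w j \<in> Tsp M j) \<and>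
          (\<forall>j>\<kappa>. w j = 0) \<and> v = (\<Sum>j\<le>\<kappa>. w j)" for v
  proof -
    define a where "a = coords sV n (\<lambda>i. q (FF i)) (q v)"
    define w0 where "w0 = (\<lambda>j. if j = 0 then v - lincomb sV n FF a else if j \<le> \<kappa> then grade_part j a else 0)"
    have w0_sum: "(\<Sum>j=1..\<kappa>. w0 j) = lincomb sV n FF a"
      unfolding sum_part[symmetric] by (rule sum.cong) (auto simp: w0_def)
    show ?thesis
    proof (rule ex1I[of _ w0])
      have "q (v - lincomb sV n FF a) = 0"
        by (simp add: q_diff q_lincomb a_def q_FF_lincomb_coords)
      then have "w0 0 \<in> range (M 0)" by (simp add: w0_def q_kernel)
      moreover have "\<forall>j\<in>{1..\<kappa>}. w0 j \<in> Tsp M j"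
        by (auto simp: w0_def Tsp_eq)
      moreover have "v = (\<Sum>j\<le>\<kappa>. w0 j)" unfolding sum_atMost_split w0_sum by (simp add: w0_def)
      ultimately show "w0 0 \<in> range (M 0) \<and> (\<forall>j\<in>{1..\<kappa>}. w0 j \<in> Tsp M j) \<and>
          (\<forall>j>\<kappa>. w0 j = 0) \<and> v = (\<Sum>j\<le>\<kappa>. w0 j)" by (simp add: w0_def)
    next
      fix w assume w: "w 0 \<in> range (M 0) \<and> (\<forall>j\<in>{1..\<kappa>}. w j \<in> Tsp M j) \<and>
          (\<forall>j>\<kappa>. w j = 0) \<and> v = (\<Sum>j\<le>\<kappa>. w j)"
      have "\<exists>c. w j = grade_part j c" if "j \<in> {1..\<kappa>}" for j
        using w that Tsp_eq[of j] by auto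
      then obtain c where c: "\<And>j. j \<in> {1..\<kappa>} \<Longrightarrow> w j = grade_part j (c j)" by metis
      \<comment> \<open>Every index has exactly one grade, so the coefficient functions of all
        grades merge into one.\<close>
      define b where "b = (\<lambda>i. c (J i) i)"
      have wb: "w j = grade_part j b" if "j \<in> {1..\<kappa>}" for j
        unfolding c[OF that] part_comb_def b_def by (rule arg_cong[of _ _ "lincomb sV n FF"]) auto
      have "(\<Sum>j=1..\<kappa>. w j) = lincomb sV n FF b"
        unfolding sum_part[symmetric] by (rule sum.cong) (auto simp: wb)
      then have v: "v = w 0 + lincomb sV n FF b" using w unfolding sum_atMost_split by simp
      have "q (w 0) = 0" using w q_kernel by blast
      then have "q v = lincomb sV n (\<lambda>i. q (FF i)) b" unfolding v by (simp add: q_add q_lincomb)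
      then have "lincomb sV n (\<lambda>i. q (FF i)) b = lincomb sV n (\<lambda>i. q (FF i)) a"
        unfolding a_def q_FF_lincomb_coords by simp
      then have ba: "\<forall>i<n. b i = a i" unfolding V.lincomb_eq_iff[OF q_FF_indep] .
      then have "lincomb sV n FF b = lincomb sV n FF a" "\<And>j. grade_part j b = grade_part j a"
        unfolding part_comb_def lincomb_def by (auto intro!: sum.cong)
      then show "w = w0"
        using v wb w by (intro ext) (auto simp: w0_def)
    qed
  qed
  then show ?thesis unfolding transversal_def using nontriv by blast
qed

end

text \<open>Bases of the spaces \<open>Tsp M j\<close> are lifted to \<open>kerint M j\<close>. By
  directness of the sum q sends their union to a basis of Z, so there are n vectors altogether; the
  lifts are independent, and by index zero n independent kernel vectors form a basis of the
  kernel.\<close>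

lemma (in graded_family) transversal_imp_adapted_basis:
  assumes tr: "transversal M \<kappa>" and \<kappa>: "\<kappa> \<le> r"
  obtains g J where "kbasis sU {x. M 0 x = 0} n g"
    "\<And>i. i < n \<Longrightarrow> 1 \<le> J i \<and> J i \<le> \<kappa>"
    "\<And>i l. i < n \<Longrightarrow> l < J i \<Longrightarrow> M l (g i) = 0"
    "kbasis sV Z n (\<lambda>i. q (M (J i) (g i)))"
    "(\<Sum>i<n. J i) = tmult sV M \<kappa>"
proof -
  have sum_split: "(\<Sum>j\<le>\<kappa>. w j) = w 0 + (\<Sum>j=1..\<kappa>. w j)" for w :: "nat \<Rightarrow> 'v"
    by (simp add: atLeast0AtMost[symmetric] sum.atLeast_Suc_atMost)
  have direct: "\<forall>j\<in>{1..\<kappa>}. w j = 0"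
    if w: "\<And>j. j \<in> {1..\<kappa>} \<Longrightarrow> w j \<in> Tsp M j" and s: "(\<Sum>j=1..\<kappa>. w j) \<in> range (M 0)" for w
  proof -
    \<comment> \<open>Two decompositions of the same vector: the summands \<open>w j\<close> in
      their own places, and their whole sum in place 0. Uniqueness identifies them.\<close>
    define w1 where "w1 = (\<lambda>j. if j \<in> {1..\<kappa>} then w j else 0)"
    define w2 where "w2 = (\<lambda>j::nat. if j = 0 then (\<Sum>j=1..\<kappa>. w j) else 0)"
    let ?P = "\<lambda>w'. w' 0 \<in> range (M 0) \<and> (\<forall>j\<in>{1..\<kappa>}. w' j \<in> Tsp M j) \<and>
          (\<forall>j>\<kappa>. w' j = 0) \<and> (\<Sum>j=1..\<kappa>. w j) = (\<Sum>j\<le>\<kappa>. w' j)"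
    have z: "0 \<in> range (M 0)" by (rule range_eqI[of _ _ 0]) (simp add: M_zero)
    have "?P w1" unfolding sum_split w1_def using w z by (auto intro!: sum.cong)
    moreover have "?P w2" unfolding sum_split w2_def
      using s V.subspace_0[OF subspace_Tsp] \<kappa> by auto
    moreover have "\<exists>!w'. ?P w'" using tr unfolding transversal_def by blast
    ultimately have "w1 = w2" by blast
    then have "w1 j = w2 j" for j by simp
    then show ?thesis unfolding w1_def w2_def by (metis atLeastAtMost_iff not_one_le_zero)
  qed
  have "\<exists>G. G \<subseteq> Tsp M j \<and> V.independent G \<and> Tsp M j \<subseteq> V.span G \<and> card G = V.dim (Tsp M j)" for j
    using V.basis_exists[of "Tsp M j"] by metis
  then obtain G where G: "\<And>j. G j \<subseteq> Tsp M j" "\<And>j. V.independent (G j)"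
      "\<And>j. Tsp M j \<subseteq> V.span (G j)" "\<And>j. card (G j) = V.dim (Tsp M j)" by metis
  have fin: "finite (G j)" if "j \<in> {1..\<kappa>}" for j
    using finite_indep_subset_Tsp[OF _ _ G(2) G(1)] that \<kappa> by auto
  \<comment> \<open>Each basis vector is tagged by its grade, so disjointness of the sets
    \<open>G j\<close> is not an issue.\<close>
  define I where "I = Sigma {1..\<kappa>} G"
  have finI: "finite I" unfolding I_def using fin by auto
  define m where "m = card I"
  obtain \<phi> where \<phi>: "bij_betw \<phi> {..<m} I"
    using ex_bij_betw_nat_finite[OF finI] unfolding m_def atLeast0LessThan by blast
  define J where "J = (\<lambda>i. fst (\<phi> i))"
  define h where "h = (\<lambda>i. snd (\<phi> i))"
  have \<phi>I: "J i \<in> {1..\<kappa>}" "h i \<in> G (J i)" if "i < m" for i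
  proof -
    have "\<phi> i \<in> Sigma {1..\<kappa>} G" using bij_betwE[OF \<phi>] that unfolding I_def by blast
    then show "J i \<in> {1..\<kappa>}" "h i \<in> G (J i)" unfolding J_def h_def by (cases "\<phi> i"; simp)+
  qed
  have "\<exists>x. x \<in> kerint M (J i) \<and> M (J i) x = h i" if "i < m" for i
    using subsetD[OF G(1) \<phi>I(2)[OF that]] by (auto simp: Tsp_def)
  then obtain g where g: "\<And>i. i < m \<Longrightarrow> g i \<in> kerint M (J i)" "\<And>i. i < m \<Longrightarrow> M (J i) (g i) = h i"
    by metis
  have reindex: "(\<Sum>i<m. H (J i) (h i)) = (\<Sum>j=1..\<kappa>. \<Sum>v\<in>G j. H j v)" for H :: "nat \<Rightarrow> 'v \<Rightarrow> 'z::comm_monoid_add"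
  proof -
    have "(\<Sum>i<m. H (J i) (h i)) = (\<Sum>p\<in>I. H (fst p) (snd p))"
      unfolding J_def h_def using sum.reindex_bij_betw[OF \<phi>, of "\<lambda>p. H (fst p) (snd p)"] by simp
    then show ?thesis unfolding I_def using fin by (simp add: sum.Sigma case_prod_beta)
  qed
  have sumJ: "(\<Sum>i<m. J i) = tmult sV M \<kappa>"
    using reindex[of "\<lambda>j v. j"] unfolding tmult_def by (simp add: G(4) mult.commute)
  have indep: "indep_family sV m (\<lambda>i. q (h i))" unfolding indep_family_def
  proof (intro allI impI)
    fix c i assume c: "lincomb sV m (\<lambda>i. q (h i)) c = 0" and i: "i < m"
    define d where "d = (\<lambda>j v. c (the_inv_into {..<m} \<phi> (j, v)))"
    have dc: "d (J i) (h i) = c i" if "i < m" for i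
      using \<phi> that unfolding d_def J_def h_def bij_betw_def by (simp add: the_inv_into_f_f)
    define w where "w = (\<lambda>j. \<Sum>v\<in>G j. sV (d j v) v)"
    have "lincomb sV m h c = (\<Sum>i<m. sV (d (J i) (h i)) (h i))"
      unfolding lincomb_def by (rule sum.cong) (auto simp: dc)
    also have "\<dots> = (\<Sum>j=1..\<kappa>. w j)" unfolding w_def by (rule reindex)
    finally have "(\<Sum>j=1..\<kappa>. w j) \<in> range (M 0)" using c by (simp add: q_kernel[symmetric] q_lincomb[symmetric])
    moreover have "w j \<in> Tsp M j" if "j \<in> {1..\<kappa>}" for j
      unfolding w_def
    proof (rule V.subspace_sum)
      show S: "V.subspace (Tsp M j)" using that \<kappa> by (intro subspace_Tsp) simp
      show "sV (d j v) v \<in> Tsp M j" if "v \<in> G j" for v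
        by (rule V.subspace_scale[OF S subsetD[OF G(1) that]])
    qed
    ultimately have "w (J i) = 0" using direct[of w] \<phi>I[OF i] by blast
    then have "d (J i) (h i) = 0"
      unfolding w_def by (rule V.independentD[OF G(2) fin[OF \<phi>I(1)[OF i]] subset_refl _ \<phi>I(2)[OF i]])
    then show "c i = 0" by (simp add: dc[OF i])
  qed
  have spanZ: "range (lincomb sV m (\<lambda>i. q (h i))) = Z"
  proof
    have "V.subspace Z" by (rule V.kbasis_subspace[OF f])
    then show "range (lincomb sV m (\<lambda>i. q (h i))) \<subseteq> Z"
      unfolding V.span_image_lessThan[symmetric] by (intro V.span_minimal) (auto intro: q_mem)
    show "Z \<subseteq> range (lincomb sV m (\<lambda>i. q (h i)))"
    proof
      fix z assume z: "z \<in> Z"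
      obtain w where w: "w 0 \<in> range (M 0)" "\<And>j. j \<in> {1..\<kappa>} \<Longrightarrow> w j \<in> Tsp M j" "z = (\<Sum>j\<le>\<kappa>. w j)"
        using tr[unfolded transversal_def, THEN conjunct2, rule_format, of z] by blast
      have "\<exists>d. w j = (\<Sum>v\<in>G j. sV (d v) v)" if j: "j \<in> {1..\<kappa>}" for j
      proof -
        have "w j \<in> V.span (G j)" by (rule subsetD[OF G(3) w(2)[OF j]])
        then show ?thesis unfolding V.span_finite[OF fin[OF j]] by (elim imageE) (rule exI)
      qed
      then obtain d where d: "\<And>j. j \<in> {1..\<kappa>} \<Longrightarrow> w j = (\<Sum>v\<in>G j. sV (d j v) v)" by metis
      have "(\<Sum>j=1..\<kappa>. w j) = (\<Sum>j=1..\<kappa>. \<Sum>v\<in>G j. sV (d j v) v)" by (rule sum.cong) (auto simp: d)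
      also have "\<dots> = (\<Sum>i<m. sV (d (J i) (h i)) (h i))" by (rule reindex[symmetric])
      finally have "z = w 0 + lincomb sV m h (\<lambda>i. d (J i) (h i))"
        using w(3) unfolding sum_split lincomb_def by simp
      then have "q z = lincomb sV m (\<lambda>i. q (h i)) (\<lambda>i. d (J i) (h i))"
        using w(1) q_kernel[of "w 0"] by (simp add: q_add q_lincomb)
      then show "z \<in> range (lincomb sV m (\<lambda>i. q (h i)))" using q_fix[OF z] by simp
    qed
  qed
  have kb: "kbasis sV Z m (\<lambda>i. q (h i))" using indep spanZ by (simp add: V.kbasis_iff)
  then have mn: "m = n" using V.kbasis_dim[OF f] V.kbasis_dim by metis
  have gker: "M l (g i) = 0" if "i < m" "l < J i" for i l
    using g(1)[OF that(1)] that(2) by (simp add: kerint_def)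
  have indep_g: "indep_family sU m g" unfolding indep_family_def
  proof (intro allI impI)
    fix c i assume c: "lincomb sU m g c = 0" and i: "i < m"
    \<comment> \<open>Elimination by increasing grade: \<open>M j\<close> sees grade j alone once
      the lower coefficients are gone.\<close>
    have "\<forall>i<m. J i = j \<longrightarrow> c i = 0" if "j \<in> {1..\<kappa>}" for j
      using that
    proof (induction j rule: less_induct)
      case (less j)
      have jr: "j \<le> r" using less.prems \<kappa> by simp
      have "0 = M j (lincomb sU m g c)" by (simp add: c M_zero jr)
      also have "\<dots> = lincomb sV m (\<lambda>i. M j (g i)) c" by (rule M_lincomb[OF jr])
      also have "\<dots> = lincomb sV m h (\<lambda>i. if J i = j then c i else 0)"
        unfolding lincomb_def
      proof (rule sum.cong[OF refl])
        fix i assume "i \<in> {..<m}"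
        then have im: "i < m" by simp
        show "sV (c i) (M j (g i)) = sV (if J i = j then c i else 0) (h i)"
          using less.IH[of "J i"] \<phi>I(1)[OF im] less.prems gker[OF im, of j] g(2)[OF im] im
          by (cases "J i" j rule: linorder_cases) auto
      qed
      finally have z: "lincomb sV m (\<lambda>i. q (h i)) (\<lambda>i. if J i = j then c i else 0) = 0"
        by (metis q_lincomb q_zero)
      show ?case using indep_familyD[OF indep z] by (metis (full_types))
    qed
    then show "c i = 0" using \<phi>I(1)[OF i] i by blast
  qed
  have gN: "g i \<in> {x. M 0 x = 0}" if "i < m" for i using gker[OF that, of 0] \<phi>I(1)[OF that] by simp
  show ?thesis
  proof (rule that[of g J])
    show "kbasis sU {x. M 0 x = 0} n g"
      by (rule U.kbasisI_indep_family[OF e indep_g[unfolded mn] gN[unfolded mn]])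
    show "kbasis sV Z n (\<lambda>i. q (M (J i) (g i)))"
      using kb g(2) unfolding mn V.kbasis_iff indep_family_def lincomb_def by (simp add: image_def)
  qed (use mn \<phi>I gker sumJ in auto)
qed

section \<open>Chain systems of maximal total length\<close>

lemma (in vector_space) kbasis_exchange:
  assumes e: "kbasis scale S n e" and k: "k < n" and v: "v = lincomb scale n e d" "d k \<noteq> 0"
  shows "kbasis scale S n (e(k := v))"
proof (rule kbasisI_indep_family[OF e])
  have ie: "indep_family scale n e" and S: "range (lincomb scale n e) = S" using e by (auto simp: kbasis_iff)
  show "(e(k := v)) i \<in> S" if "i < n" for i
    using kbasis_mem[OF e that] S v(1) by auto
  show "indep_family scale n (e(k := v))" unfolding indep_family_def
  proof (intro allI impI)
    fix c i assume c: "lincomb scale n (e(k := v)) c = 0" and i: "i < n"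
    have "lincomb scale n (e(k := v)) c = (\<Sum>i<n. scale (if i = k then 0 else c i) (e i) + (if i = k then scale (c k) v else 0))"
      unfolding lincomb_def by (rule sum.cong) auto
    also have "\<dots> = lincomb scale n e (\<lambda>i. if i = k then 0 else c i) + scale (c k) v"
      using k by (simp add: sum.distrib lincomb_def)
    also have "\<dots> = lincomb scale n e (\<lambda>i. (if i = k then 0 else c i) + c k * d i)"
      unfolding v(1) lincomb_scale lincomb_add ..
    finally have L: "lincomb scale n e (\<lambda>i. (if i = k then 0 else c i) + c k * d i) = 0" using c by simp
    note z = indep_familyD[OF ie L]
    have "c k = 0" using z[OF k] v(2) by simp
    then show "c i = 0" using z[OF i] by (auto split: if_splits)
  qed
qed

context graded_family
begin

lemma coeff_conv_lincomb:
  assumes "l \<le> r"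
  shows "coeff_conv M (\<lambda>b. lincomb sU m (\<lambda>i. w i b) c) l = lincomb sV m (\<lambda>i. coeff_conv M (w i) l) c"
proof -
  have "coeff_conv M (\<lambda>b. lincomb sU m (\<lambda>i. w i b) c) l = (\<Sum>b\<le>l. \<Sum>i<m. sV (c i) (M (l - b) (w i b)))"
    unfolding coeff_conv_def using assms
    by (intro sum.cong) (simp_all add: M_lincomb lincomb_def M_sum M_scale)
  also have "\<dots> = (\<Sum>i<m. \<Sum>b\<le>l. sV (c i) (M (l - b) (w i b)))" by (rule sum.swap)
  finally show ?thesis by (simp add: coeff_conv_def lincomb_def V.scale_sum_right)
qed

text \<open>Multiplication of u(t) by t^d.\<close>

lemma coeff_conv_shift:
  assumes "l \<le> r"
  shows "coeff_conv M (\<lambda>b. if b < d then 0 else u (b - d)) l = (if l < d then 0 else coeff_conv M u (l - d))"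
proof (cases "l < d")
  case True
  then show ?thesis unfolding coeff_conv_def using assms by (simp add: M_zero)
next
  case False
  have "(\<Sum>b\<le>l. M (l - b) (if b < d then 0 else u (b - d))) = (\<Sum>b\<in>{d..l}. M (l - b) (u (b - d)))"
    using assms by (intro sum.mono_neutral_cong_right) (auto simp: M_zero)
  also have "\<dots> = (\<Sum>b\<le>l - d. M (l - d - b) (u b))"
    by (rule sum.reindex_bij_witness[of _ "\<lambda>b. b + d" "\<lambda>b. b - d"]) (use False in auto)
  finally show ?thesis using False by (simp add: coeff_conv_def)
qed

text \<open>Subtraction of t^m x, of which only the term \<open>M 0 x\<close> is visible up to
  degree m.\<close>

lemma coeff_conv_diff_single:
  assumes "l \<le> r" "l \<le> m"
  shows "coeff_conv M (\<lambda>b. u b - (if b = m then x else 0)) l = coeff_conv M u l - (if l = m then M 0 x else 0)"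
proof -
  have "coeff_conv M (\<lambda>b. u b - (if b = m then x else 0)) l =
      (\<Sum>b\<le>l. M (l - b) (u b) - (if b = m then M 0 x else 0))"
    unfolding coeff_conv_def using assms by (intro sum.cong) (auto simp: M_diff M_zero)
  then show ?thesis using assms by (simp add: sum_subtractf coeff_conv_def)
qed

text \<open>Jordan chains starting at a basis of the kernel. \<open>J i\<close> is merely a lower
  bound for the order of M(t) u_i(t); exactness of these orders is a consequence of
  maximality.\<close>

definition chain_system :: "(nat \<Rightarrow> nat \<Rightarrow> 'u) \<Rightarrow> (nat \<Rightarrow> nat) \<Rightarrow> bool" where
  "chain_system u J \<longleftrightarrow> kbasis sU {x. M 0 x = 0} n (\<lambda>i. u i 0) \<and>
     (\<forall>i<n. 1 \<le> J i \<and> (\<forall>l<J i. coeff_conv M (u i) l = 0))"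

lemma chain_system_length:
  assumes star: "\<forall>u. (\<forall>l\<le>\<kappa>. coeff_conv M u l = 0) \<longrightarrow> u 0 = 0"
    and c: "chain_system u J" and i: "i < n"
  shows "J i \<le> \<kappa>"
proof (rule ccontr)
  assume "\<not> J i \<le> \<kappa>"
  then have "\<forall>l\<le>\<kappa>. coeff_conv M (u i) l = 0" using c i by (auto simp: chain_system_def)
  then have z: "u i 0 = 0" using star by blast
  have "indep_family sU n (\<lambda>i. u i 0)" using c by (simp add: chain_system_def U.kbasis_iff)
  moreover have "lincomb sU n (\<lambda>i. u i 0) (\<lambda>k. if k = i then 1 else 0) = 0"
    using i z by (simp add: U.lincomb_delta)
  ultimately have "(if i = i then 1 else 0) = (0::'k)" using i indep_familyD by fastforce
  then show False by simp
qed

text \<open>If the leading terms \<open>f\<^sub>i\<close> of a chain system were dependent modulo the range of \<open>M 0\<close>, say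
  \<open>\<Sum> c\<^sub>i f\<^sub>i = M 0 x\<close>, then \<open>\<Sum> c\<^sub>i t\<^bsup>m - J i\<^esup> u\<^sub>i - t\<^sup>m x\<close> with \<open>m\<close> the largest \<open>J i\<close>
  occurring would be a longer chain.\<close>

lemma chain_system_extend:
  assumes c: "chain_system u J" and J: "\<And>i. i < n \<Longrightarrow> J i \<le> r"
    and dep: "\<not> indep_family sV n (\<lambda>i. q (coeff_conv M (u i) (J i)))"
  obtains u' J' where "chain_system u' J'" "(\<Sum>i<n. J i) < (\<Sum>i<n. J' i)"
proof -
  obtain a i0 where a: "lincomb sV n (\<lambda>i. q (coeff_conv M (u i) (J i))) a = 0" and i0: "i0 < n" "a i0 \<noteq> 0"
    using dep unfolding indep_family_def by blast
  define I where "I = {i. i < n \<and> a i \<noteq> 0}"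
  have I: "finite I" "I \<noteq> {}" using i0 by (auto simp: I_def)
  define m where "m = Max (J ` I)"
  have Jm: "J i \<le> m" if "i < n" "a i \<noteq> 0" for i unfolding m_def using that I by (intro Max_ge) (auto simp: I_def)
  have "m \<in> J ` I" unfolding m_def using I by (intro Max_in) auto
  then obtain k where k: "k < n" "a k \<noteq> 0" "J k = m" by (auto simp: I_def)
  have m1: "1 \<le> m" "m \<le> r" using c k J[of k] by (auto simp: chain_system_def)
  have "lincomb sV n (\<lambda>i. coeff_conv M (u i) (J i)) a \<in> range (M 0)"
    using a by (simp add: q_kernel[symmetric] q_lincomb)
  then obtain x where x: "lincomb sV n (\<lambda>i. coeff_conv M (u i) (J i)) a = M 0 x" by (elim rangeE)
  define w where "w = (\<lambda>i b. if b < m - J i then 0 else u i (b - (m - J i)))"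
  define v where "v = (\<lambda>b. lincomb sU n (\<lambda>i. w i b) a - (if b = m then x else 0))"
  have conv_w: "coeff_conv M (w i) l = (if l = m then coeff_conv M (u i) (J i) else 0)"
    if "i < n" "a i \<noteq> 0" "l \<le> m" for i l
  proof -
    have "coeff_conv M (w i) l = (if l < m - J i then 0 else coeff_conv M (u i) (l - (m - J i)))"
      unfolding w_def by (rule coeff_conv_shift) (use that m1 in simp)
    moreover have "coeff_conv M (u i) (l - (m - J i)) = 0" if "l < m" "\<not> l < m - J i"
      using c \<open>i < n\<close> that Jm[OF \<open>i < n\<close> \<open>a i \<noteq> 0\<close>] by (auto simp: chain_system_def)
    ultimately show ?thesis using that Jm[OF that(1,2)] c by (auto simp: chain_system_def)
  qed
  have conv_v: "coeff_conv M v l = 0" if "l \<le> m" for l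
  proof -
    have "coeff_conv M v l = lincomb sV n (\<lambda>i. coeff_conv M (w i) l) a - (if l = m then M 0 x else 0)"
      unfolding v_def using that m1 by (simp add: coeff_conv_diff_single coeff_conv_lincomb)
    moreover have "lincomb sV n (\<lambda>i. coeff_conv M (w i) l) a = (if l = m then M 0 x else 0)"
    proof -
      have "lincomb sV n (\<lambda>i. coeff_conv M (w i) l) a
          = (\<Sum>i<n. if l = m then sV (a i) (coeff_conv M (u i) (J i)) else 0)"
        unfolding lincomb_def
      proof (rule sum.cong[OF refl])
        fix i assume "i \<in> {..<n}"
        then show "sV (a i) (coeff_conv M (w i) l) = (if l = m then sV (a i) (coeff_conv M (u i) (J i)) else 0)"
          using conv_w[of i l] that by (cases "a i = 0") auto
      qed
      then show ?thesis using x by (simp add: lincomb_def)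
    qed
    ultimately show ?thesis by simp
  qed
  \<comment> \<open>In degree 0 only the unshifted chains survive, those with
    \<open>J i = m\<close>, and x stays out because m \<ge> 1. The index k is among them, so
    \<open>v 0\<close> may replace \<open>u k 0\<close> in the basis.\<close>
  define d where "d = (\<lambda>i. if J i = m then a i else 0)"
  have v0: "v 0 = lincomb sU n (\<lambda>i. u i 0) d"
  proof -
    have "v 0 = lincomb sU n (\<lambda>i. w i 0) a" using m1 by (simp add: v_def)
    also have "\<dots> = lincomb sU n (\<lambda>i. u i 0) d" unfolding lincomb_def d_def
    proof (rule sum.cong[OF refl])
      fix i assume "i \<in> {..<n}"
      then show "sU (a i) (w i 0) = sU (if J i = m then a i else 0) (u i 0)"
        using Jm[of i] by (cases "a i = 0") (auto simp: w_def)
    qed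
    finally show ?thesis .
  qed
  define u' where "u' = u(k := v)"
  define J' where "J' = J(k := Suc m)"
  have "kbasis sU {x. M 0 x = 0} n ((\<lambda>i. u i 0)(k := v 0))"
    by (rule U.kbasis_exchange[OF _ k(1) v0]) (use c k in \<open>auto simp: chain_system_def d_def\<close>)
  moreover have "(\<lambda>i. u i 0)(k := v 0) = (\<lambda>i. u' i 0)" by (auto simp: u'_def)
  ultimately have "chain_system u' J'"
    using c conv_v unfolding chain_system_def by (auto simp: u'_def J'_def)
  moreover have "(\<Sum>i<n. J i) < (\<Sum>i<n. J' i)"
    by (rule sum_strict_mono_ex1) (use k in \<open>auto simp: J'_def\<close>)
  ultimately show ?thesis by (rule that)
qed

text \<open>The total length is at most n * \<kappa>, so a maximum exists. It cannot be extended,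
  hence the leading terms are independent modulo the range of \<open>M 0\<close>, and there are as
  many of them as the dimension of Z.\<close>

lemma maximal_chain_system:
  assumes \<kappa>: "\<kappa> \<le> r" and star: "\<forall>u. (\<forall>l\<le>\<kappa>. coeff_conv M u l = 0) \<longrightarrow> u 0 = 0"
  obtains u J where "chain_system u J" "\<And>i. i < n \<Longrightarrow> J i \<le> \<kappa>"
    "kbasis sV Z n (\<lambda>i. q (coeff_conv M (u i) (J i)))"
proof -
  let ?P = "\<lambda>N. \<exists>u J. chain_system u J \<and> (\<Sum>i<n. J i) = N"
  have ex: "?P (\<Sum>i<n. 1)"
  proof (intro exI conjI)
    \<comment> \<open>Kernel vectors, read as constant polynomials, are chains of length 1.\<close>
    show "chain_system (\<lambda>i b. if b = 0 then e i else 0) (\<lambda>_. 1)"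
      unfolding chain_system_def using e U.kbasis_mem[OF e] by (auto simp: coeff_conv_def)
  qed simp
  have bound: "N \<le> n * \<kappa>" if N: "?P N" for N
  proof -
    obtain u J where u: "chain_system u J" "(\<Sum>i<n. J i) = N" using N by blast
    have "(\<Sum>i<n. J i) \<le> (\<Sum>i<n. \<kappa>)" by (rule sum_mono) (use chain_system_length[OF star u(1)] in simp)
    then show ?thesis using u by simp
  qed
  have "?P (Greatest ?P)" by (rule GreatestI_nat[of ?P, OF ex bound])
  then obtain u J where u: "chain_system u J" and G: "(\<Sum>i<n. J i) = Greatest ?P" by blast
  have max: "(\<Sum>i<n. J' i) \<le> (\<Sum>i<n. J i)" if "chain_system u' J'" for u' J'
    unfolding G by (rule Greatest_le_nat[of ?P _ "n * \<kappa>", OF _ bound]) (use that in blast)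
  have J: "J i \<le> \<kappa>" if "i < n" for i by (rule chain_system_length[OF star u that])
  have "indep_family sV n (\<lambda>i. q (coeff_conv M (u i) (J i)))"
  proof (rule ccontr)
    assume dep: "\<not> ?thesis"
    have "J i \<le> r" if "i < n" for i using J[OF that] \<kappa> by simp
    then obtain u' J' where "chain_system u' J'" "(\<Sum>i<n. J i) < (\<Sum>i<n. J' i)"
      using chain_system_extend[OF u _ dep] by blast
    then show False using max[of u' J'] by simp
  qed
  then have "kbasis sV Z n (\<lambda>i. q (coeff_conv M (u i) (J i)))"
    by (rule V.kbasisI_indep_family[OF f]) (rule q_mem)
  then show ?thesis using that u J by blast
qed

end

section \<open>The order of the reduced operator\<close>

lemma kblD:
  assumes "kbl sU sV T"
  shows "bounded_linear T" "T (x + y) = T x + T y" "T (x - y) = T x - T y" "T 0 = 0" "T (sU c x) = sV c (T x)"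
proof -
  show bl: "bounded_linear T" and "T (sU c x) = sV c (T x)" using assms unfolding kbl_def by auto
  interpret bounded_linear T by (rule bl)
  show "T (x + y) = T x + T y" "T (x - y) = T x - T y" "T 0 = 0" by (simp_all add: add diff zero)
qed

text \<open>Supplies the bounded K-linear functionals from which a transversalizing polynomial is
  assembled.\<close>

lemma kbl_coords:
  fixes sU :: "'k::{real_normed_field,banach} \<Rightarrow> 'u::real_normed_vector \<Rightarrow> 'u"
  assumes sU: "kspace sU" and g: "kbasis sU S n g" and P: "kbl sU sU P" "\<And>x. P x \<in> S" and i: "i < n"
  shows "kbl sU (*) (\<lambda>x. coords sU n g (P x) i)"
proof -
  interpret U: vector_space sU by (rule kspace_vector_space[OF sU])
  have ig: "indep_family sU n g" using g by (simp add: U.kbasis_iff)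
  define c where "c = (\<lambda>x. coords sU n g (P x))"
  have lc: "lincomb sU n g (c x) = P x" for x unfolding c_def by (rule U.lincomb_coords[OF g P(2)])
  have cI: "c x i = d i" if "P x = lincomb sU n g d" for x d
    unfolding c_def that by (rule U.coords_lincomb[OF ig i])
  have add: "c (x + y) i = c x i + c y i" for x y
    by (rule cI) (simp add: kblD[OF P(1)] lc U.lincomb_add[symmetric])
  have scale: "c (sU b x) i = b * c x i" for b x
    by (rule cI) (simp add: kblD[OF P(1)] lc U.lincomb_scale[symmetric])
  have sr: "sU (of_real b) x = b *\<^sub>R x" for b x using sU unfolding kspace_def by blast
  obtain C where C: "C > 0" "\<And>c. (\<Sum>i<n. norm (c i)) \<le> C * norm (lincomb sU n g c)"
    using lincomb_norm_bound[OF sU ig] by auto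
  obtain K where K: "\<And>x. norm (P x) \<le> norm x * K"
    using bounded_linear.bounded[OF kblD(1)[OF P(1)]] by auto
  have "bounded_linear (\<lambda>x. c x i)"
  proof (rule bounded_linear_intro[where K = "K * C"])
    show "c (b *\<^sub>R x) i = b *\<^sub>R c x i" for b x
      using scale[of "of_real b" x] by (simp add: sr scaleR_conv_of_real)
    fix x
    have "norm (c x i) \<le> (\<Sum>i<n. norm (c x i))" using i by (intro member_le_sum) auto
    also have "\<dots> \<le> C * norm (P x)" using C(2)[of "c x"] by (simp add: lc)
    also have "\<dots> \<le> C * (norm x * K)" using C(1) K by (intro mult_left_mono) auto
    finally show "norm (c x i) \<le> norm x * (K * C)" by (simp add: mult_ac)
  qed (rule add)
  then show ?thesis unfolding kbl_def using scale by (simp add: c_def)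
qed

locale ls_setting =
  fixes sU :: "'k::{real_normed_field,banach} \<Rightarrow> 'u::banach \<Rightarrow> 'u"
    and sV :: "'k \<Rightarrow> 'v::banach \<Rightarrow> 'v"
    and \<Omega> :: "'k set" and a :: 'k and L :: "'k \<Rightarrow> ('u \<Rightarrow>\<^sub>L 'v)"
    and P :: "'u \<Rightarrow> 'u" and Q :: "'v \<Rightarrow> 'v"
  assumes sU: "kspace sU" and sV: "kspace sV"
    and open_\<Omega>: "open \<Omega>" and a_mem: "a \<in> \<Omega>"
    and L_kbl: "\<And>t. t \<in> \<Omega> \<Longrightarrow> kbl sU sV (blinfun_apply (L t))"
    and L_cont: "continuous_on \<Omega> L"
    and PQ: "tproj_pair sU sV (blinfun_apply (L a)) P Q"
begin

sublocale U: vector_space sU by (rule kspace_vector_space[OF sU])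
sublocale V: vector_space sV by (rule kspace_vector_space[OF sV])

lemma P_kbl: "kbl sU sU P" and Q_kbl: "kbl sV sV Q"
  and P_idem: "P (P x) = P x" and Q_idem: "Q (Q v) = Q v"
  and range_P: "range P = {x. L a x = 0}" and range_Q: "range Q = range (blinfun_apply (L a))"
  using PQ unfolding tproj_pair_def kproj_def by auto

lemmas P_lin = kblD[OF P_kbl] and Q_lin = kblD[OF Q_kbl]

lemma L_P: "L a (P x) = 0"
proof -
  have "P x \<in> range P" by simp
  then show ?thesis unfolding range_P by simp
qed

lemma P_fix: "L a x = 0 \<Longrightarrow> P x = x"
proof -
  assume "L a x = 0"
  then have "x \<in> range P" unfolding range_P by simp
  then show "P x = x" using P_idem by auto
qed

lemma Q_L: "Q (L a x) = L a x"
proof -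
  have "L a x \<in> range Q" unfolding range_Q by simp
  then show ?thesis using Q_idem by auto
qed

lemma Q_mem: obtains x where "Q v = L a x"
proof -
  have "Q v \<in> range (blinfun_apply (L a))" unfolding range_Q[symmetric] by simp
  then show ?thesis using that by auto
qed

text \<open>The range of \<open>L a\<close> is a subspace and not a type, so the open mapping bound
  does not apply to it directly. Adding the complementary part \<open>v - Q v\<close> gives a
  bounded surjection from U \<times> V onto all of V.\<close>

lemma ex_partial_inverse:
  "\<exists>S. kbl sV sU S \<and> (\<forall>v. P (S v) = 0) \<and> (\<forall>v. L a (S v) = Q v)"
proof -
  define T where "T = (\<lambda>p::'u \<times> 'v. L a (fst p) + (snd p - Q (snd p)))"
  have blT: "bounded_linear T" unfolding T_def
    by (intro bounded_linear_add bounded_linear_sub bounded_linear_compose[OF blinfun.bounded_linear_right]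
        bounded_linear_fst bounded_linear_snd bounded_linear_compose[OF Q_lin(1)])
  have "surj T"
  proof (rule surjI)
    fix v :: 'v
    show "T (SOME p. T p = v) = v"
    proof (rule someI_ex)
      obtain x where "Q v = L a x" by (rule Q_mem)
      then show "\<exists>p. T p = v" by (intro exI[of _ "(x, v)"]) (simp add: T_def)
    qed
  qed
  then obtain C where C: "C > 0" "\<And>v. \<exists>p. T p = v \<and> norm p \<le> C * norm v"
    using open_mapping_bound[OF blT] by blast
  obtain K where K: "K \<ge> 0" "\<And>x. norm (P x) \<le> norm x * K"
    using bounded_linear.nonneg_bounded[OF P_lin(1)] by auto
  have ex: "\<exists>y. P y = 0 \<and> L a y = Q v \<and> norm y \<le> norm v * (C * (1 + K))" for v
  proof -
    obtain p where p: "T p = v" "norm p \<le> C * norm v" using C(2) by blast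
    \<comment> \<open>Removing the P-component does not change the image under \<open>L a\<close>
      and costs the factor 1 + K.\<close>
    define y where "y = fst p - P (fst p)"
    have "P y = 0" by (simp add: y_def P_lin P_idem)
    moreover have "L a y = Q v"
    proof -
      have "Q v = Q (L a (fst p)) + (Q (snd p) - Q (Q (snd p)))"
        unfolding p(1)[symmetric] T_def by (simp add: Q_lin)
      then show ?thesis by (simp add: Q_L Q_idem y_def blinfun.diff_right L_P)
    qed
    moreover have "norm y \<le> norm v * (C * (1 + K))"
    proof -
      have "norm y \<le> norm (fst p) + norm (P (fst p))" unfolding y_def by (rule norm_triangle_ineq4)
      also have "\<dots> \<le> norm (fst p) * (1 + K)" using K(2)[of "fst p"] by (simp add: algebra_simps)
      also have "\<dots> \<le> (C * norm v) * (1 + K)"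
        using norm_fst_le[of "fst p" "snd p"] p(2) K(1) by (intro mult_right_mono) auto
      finally show ?thesis by (simp add: mult_ac)
    qed
    ultimately show ?thesis by blast
  qed
  \<comment> \<open>Uniqueness within the kernel of P is what makes the pointwise choice of
    preimages linear.\<close>
  have uniq: "y = z" if "P y = 0" "P z = 0" "L a y = L a z" for y z
  proof -
    have "P (y - z) = y - z" by (rule P_fix) (simp add: blinfun.diff_right that)
    then show ?thesis using that by (simp add: P_lin)
  qed
  obtain S where S: "\<And>v. P (S v) = 0" "\<And>v. L a (S v) = Q v" "\<And>v. norm (S v) \<le> norm v * (C * (1 + K))"
    using ex by metis
  have add: "S (v + w) = S v + S w" for v w
    by (rule uniq) (simp_all add: S P_lin Q_lin blinfun.add_right)
  have scale: "S (sV c v) = sU c (S v)" for c v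
    by (rule uniq) (simp_all add: S P_lin Q_lin kblD[OF L_kbl[OF a_mem]])
  have "S (r *\<^sub>R v) = r *\<^sub>R S v" for r v
    using scale[of "of_real r" v] sU sV unfolding kspace_def by simp
  then have "bounded_linear S" using add S(3) by (intro bounded_linear_intro) auto
  then have "kbl sV sU S" using scale by (simp add: kbl_def)
  then show ?thesis using S by blast
qed

definition S :: "'v \<Rightarrow> 'u" where
  "S = (SOME S. kbl sV sU S \<and> (\<forall>v. P (S v) = 0) \<and> (\<forall>v. L a (S v) = Q v))"

lemma S_kbl: "kbl sV sU S" and P_S: "P (S v) = 0" and L_S: "L a (S v) = Q v"
  using someI_ex[OF ex_partial_inverse] unfolding S_def[symmetric] by auto

lemmas S_lin = kblD[OF S_kbl]

lemma eq_if_P_L: "P y = P z \<Longrightarrow> L a y = L a z \<Longrightarrow> y = z"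
  using P_fix[of "y - z"] by (simp add: blinfun.diff_right P_lin)

lemma S_L: "S (L a x) = x - P x"
  by (rule eq_if_P_L) (simp_all add: P_S L_S P_lin P_idem Q_L blinfun.diff_right L_P)

lemma S_Q: "S (Q v) = S v"
  by (rule eq_if_P_L) (simp_all add: P_S L_S Q_idem)

text \<open>S is injective on the range of Q, so QF = 0 may be replaced by SF = 0, an equation in
  U.\<close>

lemma Q_zero_iff: "Q v = 0 \<longleftrightarrow> S v = 0"
  using L_S[of v] S_Q[of v] by (metis S_lin(4) blinfun.zero_right)

text \<open>The derivative of \<open>P u + S (F t u)\<close> with respect to u at u = 0. On the
  range of I - P it is S L(t), so inverting it amounts to inverting \<open>L11\<close> there while
  working on all of U.\<close>

definition A :: "'k \<Rightarrow> ('u \<Rightarrow>\<^sub>L 'u)" where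
  "A t = Blinfun P + (Blinfun S o\<^sub>L L t)"

lemma A_apply: "A t x = P x + S (L t x)"
  by (simp add: A_def blinfun.add_left bounded_linear_Blinfun_apply[OF P_lin(1)] bounded_linear_Blinfun_apply[OF S_lin(1)])

lemma A_center: "A a = id_blinfun"
  by (rule blinfun_eqI) (simp add: A_apply S_L)

lemma A_tendsto: "(A \<longlongrightarrow> id_blinfun) (nhds a)"
proof -
  have "(L \<longlongrightarrow> L a) (nhds a)"
    using L_cont open_\<Omega> a_mem by (simp add: continuous_on_eq_continuous_at continuous_at tendsto_nhds_iff)
  then have "((\<lambda>t. Blinfun P + (Blinfun S o\<^sub>L L t)) \<longlongrightarrow> Blinfun P + (Blinfun S o\<^sub>L L a)) (nhds a)"
    by (intro tendsto_add tendsto_const bounded_bilinear.tendsto[OF bounded_bilinear_blinfun_compose])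
  then show ?thesis unfolding A_def[symmetric] A_center .
qed

lemma A_near_identity: "\<forall>\<^sub>F t in nhds a. norm (A t - id_blinfun) \<le> 1/2"
  using tendstoD[OF A_tendsto, of "1/2"] by (auto simp: dist_norm elim: eventually_mono)

lemma graded_familyI:
  assumes M0: "M 0 = blinfun_apply (L a)"
    and "\<And>j x y. j \<le> r \<Longrightarrow> M j (x + y) = M j x + M j y"
    and "\<And>j c x. j \<le> r \<Longrightarrow> M j (sU c x) = sV c (M j x)"
    and "kbasis sU {x. L a x = 0} n e" "kbasis sV (range (\<lambda>v. v - Q v)) n f"
  shows "graded_family sU sV M r (\<lambda>v. v - Q v) (range (\<lambda>v. v - Q v)) n e f"
proof
  show "v - Q v = 0 \<longleftrightarrow> v \<in> range (M 0)" for v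
  proof
    assume "v - Q v = 0"
    then show "v \<in> range (M 0)" unfolding M0 range_Q[symmetric] by (metis eq_iff_diff_eq_0 rangeI)
  next
    assume "v \<in> range (M 0)"
    then show "v - Q v = 0" unfolding M0 using Q_L by auto
  qed
qed (use assms in \<open>auto simp: Q_lin Q_idem V.scale_right_diff_distrib\<close>)

end

section \<open>Transversalizations and the multiplicity\<close>

lemma prod_taylor_conv: "prod_taylor Ls a Phi j x = coeff_conv (taylor_coeff Ls a) (\<lambda>b. Phi b x) j"
  by (simp add: prod_taylor_def coeff_conv_def taylor_coeff_def)

context ls_setting
begin

lemma taylor_coeff_lin:
  assumes Cr: "kCr sU sV \<Omega> r L Ls"
  shows "taylor_coeff Ls a i (x + y) = taylor_coeff Ls a i x + taylor_coeff Ls a i y"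
    and "i \<le> r \<Longrightarrow> taylor_coeff Ls a i (sU c x) = sV c (taylor_coeff Ls a i x)"
    and "taylor_coeff Ls a 0 = blinfun_apply (L a)"
proof -
  show "taylor_coeff Ls a i (x + y) = taylor_coeff Ls a i x + taylor_coeff Ls a i y"
    by (simp add: taylor_coeff_def blinfun.add_right)
  show "taylor_coeff Ls a i (sU c x) = sV c (taylor_coeff Ls a i x)" if "i \<le> r"
  proof -
    have "Ls i a (sU c x) = sV c (Ls i a x)" using Cr that a_mem unfolding kCr_def kbl_def by blast
    then show ?thesis
      by (simp add: taylor_coeff_def blinfun.scaleR_left
          bounded_bilinear.scaleR_right[OF kspace_bounded_bilinear[OF sV]])
  qed
  show "taylor_coeff Ls a 0 = blinfun_apply (L a)"
    using Cr a_mem by (simp add: taylor_coeff_def kCr_def)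
qed

lemma graded_family_prod_taylor:
  assumes Cr: "kCr sU sV \<Omega> r L Ls" and Phi: "kpoly_id sU Phi"
    and e: "kbasis sU {x. L a x = 0} n e" and f: "kbasis sV (range (\<lambda>v. v - Q v)) n f"
  shows "graded_family sU sV (prod_taylor Ls a Phi) r (\<lambda>v. v - Q v) (range (\<lambda>v. v - Q v)) n e f"
proof (rule graded_familyI[OF _ _ _ e f])
  have Phi_kbl: "kbl sU sU (Phi b)" for b using Phi unfolding kpoly_id_def by blast
  show "prod_taylor Ls a Phi 0 = blinfun_apply (L a)"
    using Phi by (intro ext) (simp add: prod_taylor_conv coeff_conv_def taylor_coeff_lin(3)[OF Cr] kpoly_id_def)
  fix j x y c assume j: "j \<le> r"
  show "prod_taylor Ls a Phi j (x + y) = prod_taylor Ls a Phi j x + prod_taylor Ls a Phi j y"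
    unfolding prod_taylor_conv coeff_conv_def
    by (simp add: kblD(2)[OF Phi_kbl] taylor_coeff_lin(1)[OF Cr] sum.distrib)
  show "prod_taylor Ls a Phi j (sU c x) = sV c (prod_taylor Ls a Phi j x)"
    unfolding prod_taylor_conv coeff_conv_def V.scale_sum_right
    by (rule sum.cong) (use j in \<open>auto simp: kblD(5)[OF Phi_kbl] taylor_coeff_lin(2)[OF Cr]\<close>)
qed

text \<open>\<open>Phi b\<close> sends the kernel basis vector \<open>u i 0\<close> to
  \<open>u i b\<close>. The Taylor coefficients of L Phi at these vectors are then the coefficients
  of the chains, so a maximal chain system becomes an adapted basis.\<close>

lemma ex_transversalization:
  assumes Cr: "kCr sU sV \<Omega> r L Ls"
    and e: "kbasis sU {x. L a x = 0} n e" and f: "kbasis sV (range (\<lambda>v. v - Q v)) n f"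
    and \<kappa>: "\<kappa> \<le> r" and star: "\<forall>u. (\<forall>l\<le>\<kappa>. coeff_conv (taylor_coeff Ls a) u l = 0) \<longrightarrow> u 0 = 0"
  shows "\<exists>Phi \<kappa>'. kpoly_id sU Phi \<and> \<kappa>' \<le> r \<and> transversal (prod_taylor Ls a Phi) \<kappa>'"
proof -
  interpret T: graded_family sU sV "taylor_coeff Ls a" r "\<lambda>v. v - Q v" "range (\<lambda>v. v - Q v)" n e f
    by (rule graded_familyI) (simp_all add: taylor_coeff_lin[OF Cr] e f)
  obtain u J where u: "T.chain_system u J" "\<And>i. i < n \<Longrightarrow> J i \<le> \<kappa>"
    "kbasis sV (range (\<lambda>v. v - Q v)) n (\<lambda>i. coeff_conv (taylor_coeff Ls a) (u i) (J i) - Q (coeff_conv (taylor_coeff Ls a) (u i) (J i)))"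
    by (rule T.maximal_chain_system[OF \<kappa> star]) (rule that)
  define g where "g = (\<lambda>i. u i 0)"
  have g: "kbasis sU {x. L a x = 0} n g"
    and J1: "\<And>i. i < n \<Longrightarrow> 1 \<le> J i"
    and chain: "\<And>i l. i < n \<Longrightarrow> l < J i \<Longrightarrow> coeff_conv (taylor_coeff Ls a) (u i) l = 0"
    using u(1) unfolding T.chain_system_def taylor_coeff_lin(3)[OF Cr] g_def by auto
  \<comment> \<open>P and the coordinates extend the prescription from the kernel to U. Coefficients
    beyond \<kappa> are cut off, since orders up to \<kappa> do not see them.\<close>
  define Phi where "Phi = (\<lambda>b x. if b = 0 then x else if b \<le> \<kappa> then lincomb sU n (\<lambda>i. u i b) (coords sU n g (P x)) else 0)"
  have PN: "P x \<in> {x. L a x = 0}" for x by (simp add: L_P)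
  have "kbl sU sU (Phi b)" for b
  proof (cases "b = 0 \<or> \<not> b \<le> \<kappa>")
    case True
    then show ?thesis by (cases "b = 0") (auto simp: Phi_def kbl_def)
  next
    case False
    then have Pb: "Phi b = (\<lambda>x. lincomb sU n (\<lambda>i. u i b) (coords sU n g (P x)))" by (auto simp: Phi_def)
    have c: "kbl sU (*) (\<lambda>x. coords sU n g (P x) i)" if "i < n" for i
      by (rule kbl_coords[OF sU g P_kbl PN that])
    have "bounded_linear (Phi b)" unfolding Pb lincomb_def
      by (intro bounded_linear_sum bounded_linear_compose[OF bounded_bilinear.bounded_linear_left[OF kspace_bounded_bilinear[OF sU]]])
         (use kblD(1)[OF c] in simp)
    moreover have "Phi b (sU d x) = sU d (Phi b x)" for d x
      unfolding Pb U.lincomb_scale unfolding lincomb_def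
      by (rule sum.cong) (use kblD(5)[OF c] in auto)
    ultimately show ?thesis by (simp add: kbl_def)
  qed
  then have Phi: "kpoly_id sU Phi" unfolding kpoly_id_def
    by (intro conjI allI exI[of _ \<kappa>]) (auto simp: Phi_def fun_eq_iff)
  have Phi_g: "Phi b (g i) = u i b" if "i < n" "b \<le> \<kappa>" for i b
  proof (cases "b = 0")
    case False
    have ig: "indep_family sU n g" using g by (simp add: U.kbasis_iff)
    have gi: "g i = lincomb sU n g (\<lambda>k. if k = i then 1 else 0)" using that by (simp add: U.lincomb_delta)
    have "P (g i) = g i" using U.kbasis_mem[OF g that(1)] by (simp add: P_fix)
    then have "Phi b (g i) = lincomb sU n (\<lambda>i. u i b) (coords sU n g (lincomb sU n g (\<lambda>k. if k = i then 1 else 0)))"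
      using False that gi by (simp add: Phi_def)
    also have "\<dots> = lincomb sU n (\<lambda>i. u i b) (\<lambda>k. if k = i then 1 else 0)"
      unfolding lincomb_def[of _ _ "\<lambda>i. u i b"]
      by (rule sum.cong) (auto simp: U.coords_lincomb[OF ig])
    finally show ?thesis using that by (simp add: U.lincomb_delta)
  qed (simp add: Phi_def g_def)
  let ?M = "prod_taylor Ls a Phi"
  interpret G: graded_family sU sV ?M r "\<lambda>v. v - Q v" "range (\<lambda>v. v - Q v)" n e f
    by (rule graded_family_prod_taylor[OF Cr Phi e f])
  have Mg: "?M j (g i) = coeff_conv (taylor_coeff Ls a) (u i) j" if "i < n" "j \<le> \<kappa>" for i j
    unfolding prod_taylor_conv coeff_conv_def by (rule sum.cong) (use that in \<open>auto simp: Phi_g\<close>)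
  have M0: "?M 0 = blinfun_apply (L a)"
    using Phi by (intro ext) (simp add: prod_taylor_conv coeff_conv_def taylor_coeff_lin(3)[OF Cr] kpoly_id_def)
  \<comment> \<open>Transversality requires a nonzero last summand, so the largest length that
    occurs is taken in place of the bound \<kappa>; it is 0 for a trivial kernel.\<close>
  define \<kappa>' where "\<kappa>' = (if n = 0 then 0 else Max (J ` {..<n}))"
  have k': "\<kappa>' \<le> \<kappa>" "\<And>i. i < n \<Longrightarrow> J i \<le> \<kappa>'"
    using u(2) by (auto simp: \<kappa>'_def Max_le_iff lessThan_empty_iff)
  have kmax: "\<exists>i<n. J i = \<kappa>'" if "1 \<le> \<kappa>'"
  proof -
    have n: "n \<noteq> 0" using that by (simp add: \<kappa>'_def split: if_splits)
    then have "Max (J ` {..<n}) \<in> J ` {..<n}" by (intro Max_in) (auto simp: lessThan_empty_iff)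
    then show ?thesis using n by (auto simp: \<kappa>'_def)
  qed
  have "adapted_basis sU sV ?M r (\<lambda>v. v - Q v) (range (\<lambda>v. v - Q v)) n e f g J \<kappa>'"
  proof
    show "kbasis sU {x. ?M 0 x = 0} n g" unfolding M0 by (rule g)
    show "?M l (g i) = 0" if "i < n" "l < J i" for i l
      using chain[OF that] Mg[OF that(1), of l] u(2)[OF that(1)] that(2) by simp
    have "lincomb sV n (\<lambda>i. ?M (J i) (g i) - Q (?M (J i) (g i))) = lincomb sV n (\<lambda>i. coeff_conv (taylor_coeff Ls a) (u i) (J i) - Q (coeff_conv (taylor_coeff Ls a) (u i) (J i)))"
      unfolding lincomb_def by (intro ext sum.cong) (auto simp: Mg u(2))
    then show "kbasis sV (range (\<lambda>v. v - Q v)) n (\<lambda>i. ?M (J i) (g i) - Q (?M (J i) (g i)))"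
      using u(3) unfolding V.kbasis_iff indep_family_def by simp
  qed (use J1 k' \<kappa> kmax in auto)
  then have "transversal ?M \<kappa>'" by (rule adapted_basis.transversal)
  then show ?thesis using Phi k' \<kappa> by (intro exI[of _ Phi] exI[of _ \<kappa>']) auto
qed

text \<open>Let v = P z + DY P z. Then z and v have the same P-component and Q L v = 0, so A(t)(z -
  v) = S L z = (t - a)^j S w. Hence z - v = (t - a)^j y with y = A(t)^(-1) S w, and L v = (t - a)^j
  (w - L y). At t = a the correction L y equals Q w, which I - Q annihilates.\<close>

lemma reduced_operator_factor:
  assumes j: "continuous (at a) w" "\<forall>\<^sub>F t in nhds a. L t (z t) = sV ((t - a) ^ j) (w t)"
    and DY: "\<forall>\<^sub>F t in nhds a. \<forall>x. L a x = 0 \<longrightarrow> P (x + DY t x) = x \<and> Q (L t (x + DY t x)) = 0"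
  obtains W where "continuous (at a) W" "W a = w a - Q (w a)" "\<And>t. W t \<in> range (\<lambda>v. v - Q v)"
    "\<forall>\<^sub>F t in nhds a. L t (P (z t) + DY t (P (z t))) - Q (L t (P (z t) + DY t (P (z t)))) = sV ((t - a) ^ j) (W t)"
proof -
  have "\<exists>R. norm (A t - id_blinfun) \<le> 1/2 \<longrightarrow> R o\<^sub>L A t = id_blinfun \<and> A t o\<^sub>L R = id_blinfun" for t
    using near_identity_inverse[of "A t"] by metis
  then obtain R where R: "\<And>t. norm (A t - id_blinfun) \<le> 1/2 \<Longrightarrow> R t o\<^sub>L A t = id_blinfun \<and> A t o\<^sub>L R t = id_blinfun"
    by metis
  have AR: "A t (R t x) = x" "R t (A t x) = x" if "norm (A t - id_blinfun) \<le> 1/2" for t x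
    using R[OF that] by (metis blinfun_apply_blinfun_compose blinfun_apply_id_blinfun)+
  define y where "y = (\<lambda>t. R t (S (w t)))"
  define W where "W = (\<lambda>t. w t - L t (y t) - Q (w t - L t (y t)))"
  have ya: "y a = S (w a)" using AR(1)[of a "S (w a)"] by (simp add: y_def A_center)
  have Sw: "((\<lambda>t. S (w t)) \<longlongrightarrow> S (w a)) (at a)"
    using j(1) by (intro bounded_linear.tendsto[OF S_lin(1)]) (simp add: continuous_at)
  have at_nhds: "\<forall>\<^sub>F t in at a. H t" if "\<forall>\<^sub>F t in nhds a. H t" for H
    using that by (auto simp: eventually_at_filter elim: eventually_mono)
  \<comment> \<open>Up to sign the difference is \<open>(A t - id_blinfun) (y t)\<close>, and y is
    bounded by 2 S w in norm. So y converges without an appeal to continuity of inversion.\<close>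
  have "((\<lambda>t. y t - S (w t)) \<longlongrightarrow> 0) (at a)"
  proof (rule Lim_null_comparison)
    show "\<forall>\<^sub>F t in at a. norm (y t - S (w t)) \<le> norm (A t - id_blinfun) * (2 * norm (S (w t)))"
      using at_nhds[OF A_near_identity]
    proof eventually_elim
      case (elim t)
      have Ay: "A t (y t) = S (w t)" unfolding y_def by (rule AR(1)[OF elim])
      have "norm (y t - S (w t)) = norm ((A t - id_blinfun) (y t))"
        by (simp add: Ay blinfun.diff_left norm_minus_commute)
      also have "\<dots> \<le> norm (A t - id_blinfun) * norm (y t)" by (rule norm_blinfun)
      also have "\<dots> \<le> norm (A t - id_blinfun) * (2 * norm (S (w t)))"
        using near_identity_lower_bound[OF elim, of "y t"] by (intro mult_left_mono) (simp_all add: Ay)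
      finally show ?case .
    qed
    have "(A \<longlongrightarrow> id_blinfun) (at a)" using A_tendsto by (simp add: tendsto_nhds_iff A_center)
    then have "((\<lambda>t. norm (A t - id_blinfun) * (2 * norm (S (w t)))) \<longlongrightarrow> norm (id_blinfun - id_blinfun :: 'u \<Rightarrow>\<^sub>L 'u) * (2 * norm (S (w a)))) (at a)"
      by (intro tendsto_intros Sw)
    then show "((\<lambda>t. norm (A t - id_blinfun) * (2 * norm (S (w t)))) \<longlongrightarrow> 0) (at a)" by simp
  qed
  from tendsto_add[OF this Sw] have y: "(y \<longlongrightarrow> y a) (at a)" by (simp add: ya)
  have "(L \<longlongrightarrow> L a) (at a)"
    using L_cont open_\<Omega> a_mem by (simp add: continuous_on_eq_continuous_at continuous_at)
  then have "((\<lambda>t. L t (y t)) \<longlongrightarrow> L a (y a)) (at a)" by (intro blinfun.tendsto y)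
  then have wl: "((\<lambda>t. w t - L t (y t)) \<longlongrightarrow> w a - L a (y a)) (at a)"
    using j(1) by (intro tendsto_diff) (auto simp: continuous_at)
  have Wc: "continuous (at a) W" unfolding continuous_at W_def
    by (rule tendsto_diff[OF wl bounded_linear.tendsto[OF Q_lin(1) wl]])
  have Wa: "W a = w a - Q (w a)" by (simp add: W_def ya L_S Q_lin Q_idem)
  have "\<forall>\<^sub>F t in nhds a. t \<in> \<Omega>" using open_\<Omega> a_mem by (rule eventually_nhds_in_open)
  with A_near_identity j(2) DY
  have "\<forall>\<^sub>F t in nhds a. L t (P (z t) + DY t (P (z t))) - Q (L t (P (z t) + DY t (P (z t)))) = sV ((t - a) ^ j) (W t)"
  proof eventually_elim
    case (elim t)
    define v where "v = P (z t) + DY t (P (z t))"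
    have v: "P v = P (z t)" "Q (L t v) = 0" unfolding v_def using elim(3) L_P by blast+
    note Llin = kblD[OF L_kbl[OF elim(4)]]
    let ?\<tau> = "(t - a) ^ j"
    have "A t (z t - v) = S (L t (z t))"
      using v(2) by (simp add: A_apply P_lin S_lin Llin v(1) Q_zero_iff)
    also have "\<dots> = sU ?\<tau> (S (w t))" by (simp add: elim(2) S_lin)
    also have "\<dots> = sU ?\<tau> (A t (y t))" unfolding y_def by (simp add: AR(1)[OF elim(1)])
    also have "\<dots> = A t (sU ?\<tau> (y t))" by (simp add: A_apply P_lin S_lin Llin U.scale_right_distrib)
    finally have "z t - v = sU ?\<tau> (y t)" using AR(2)[OF elim(1)] by metis
    then have "v = z t - sU ?\<tau> (y t)" by (simp add: algebra_simps)
    then have "L t v = sV ?\<tau> (w t - L t (y t))" by (simp add: Llin elim(2) V.scale_right_diff_distrib)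
    then show ?case unfolding v_def[symmetric] W_def by (simp add: Q_lin V.scale_right_diff_distrib)
  qed
  then show ?thesis using Wc Wa by (intro that[of W]) (auto simp: W_def)
qed

theorem has_order_tmult:
  assumes Cr: "kCr sU sV \<Omega> r L Ls" and Phi: "kpoly_id sU Phi" and \<kappa>: "\<kappa> \<le> r"
    and tr: "transversal (prod_taylor Ls a Phi) \<kappa>"
    and e: "kbasis sU {x. L a x = 0} n e" and f: "kbasis sV (range (\<lambda>v. v - Q v)) n f"
    and DY: "\<forall>\<^sub>F t in nhds a. \<forall>x. L a x = 0 \<longrightarrow> P (x + DY t x) = x \<and> Q (L t (x + DY t x)) = 0"
    and DY_kbl: "\<forall>\<^sub>F t in nhds a. kbl sU sU (DY t)"
  shows "has_order (\<lambda>t. map_det sV n e f (\<lambda>x. L t (x + DY t x) - Q (L t (x + DY t x)))) a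
           (tmult sV (prod_taylor Ls a Phi) \<kappa>)"
proof -
  let ?M = "prod_taylor Ls a Phi"
  interpret G: graded_family sU sV ?M r "\<lambda>v. v - Q v" "range (\<lambda>v. v - Q v)" n e f
    by (rule graded_family_prod_taylor[OF Cr Phi e f])
  have M0: "?M 0 = blinfun_apply (L a)"
    using Phi by (intro ext) (simp add: prod_taylor_conv coeff_conv_def taylor_coeff_lin(3)[OF Cr] kpoly_id_def)
  obtain g J where g: "kbasis sU {x. L a x = 0} n g" and J: "\<And>i. i < n \<Longrightarrow> 1 \<le> J i \<and> J i \<le> \<kappa>"
    and ker: "\<And>i l. i < n \<Longrightarrow> l < J i \<Longrightarrow> ?M l (g i) = 0"
    and F: "kbasis sV (range (\<lambda>v. v - Q v)) n (\<lambda>i. ?M (J i) (g i) - Q (?M (J i) (g i)))"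
    and sumJ: "(\<Sum>i<n. J i) = tmult sV ?M \<kappa>"
    by (rule G.transversal_imp_adapted_basis[OF tr \<kappa>, unfolded M0]) (rule that)
  \<comment> \<open>Cutting Phi off at degree r is harmless: the orders up to
    \<open>J i \<le> r\<close> involve only coefficients of index at most r.\<close>
  define z where "z = (\<lambda>i. vpoly sU a r (\<lambda>b. Phi b (g i)))"
  define B where "B = (\<lambda>t x. L t (x + DY t x) - Q (L t (x + DY t x)))"
  have za: "z i a = g i" for i using Phi by (simp add: z_def vpoly_center[OF sU] kpoly_id_def)
  define H where "H = (\<lambda>i W. continuous (at a) W \<and> W a = ?M (J i) (g i) - Q (?M (J i) (g i)) \<and>
      (\<forall>t. W t \<in> range (\<lambda>v. v - Q v)) \<and> (\<forall>\<^sub>F t in nhds a. B t (P (z i t)) = sV ((t - a) ^ J i) (W t)))"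
  have "\<forall>i\<in>{..<n}. \<exists>W. H i W"
  proof
    fix i assume "i \<in> {..<n}"
    then have i: "i < n" by simp
    have Jr: "J i \<le> r" using J[OF i] \<kappa> by simp
    have low: "coeff_conv (taylor_coeff Ls a) (\<lambda>b. Phi b (g i)) l = 0" if "l < J i" for l
      using ker[OF i that] by (simp add: prod_taylor_conv)
    obtain w where w: "continuous (at a) w" "w a = coeff_conv (taylor_coeff Ls a) (\<lambda>b. Phi b (g i)) (J i)"
      "\<forall>\<^sub>F t in nhds a. L t (vpoly sU a r (\<lambda>b. Phi b (g i)) t) = sV ((t - a) ^ J i) (w t)"
      by (rule apply_vpoly_factor[OF sU sV open_\<Omega> a_mem Cr Jr order_refl low])
    obtain W where W: "continuous (at a) W" "W a = w a - Q (w a)" "\<And>t. W t \<in> range (\<lambda>v. v - Q v)"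
      "\<forall>\<^sub>F t in nhds a. L t (P (z i t) + DY t (P (z i t))) - Q (L t (P (z i t) + DY t (P (z i t)))) = sV ((t - a) ^ J i) (W t)"
      using reduced_operator_factor[OF w(1) _ DY, of "z i" "J i"] w(3) unfolding z_def by blast
    then show "\<exists>W. H i W" using w(2) unfolding H_def B_def by (intro exI[of _ W]) (simp add: prod_taylor_conv)
  qed
  from bchoice[OF this] obtain W where "\<forall>i\<in>{..<n}. H i (W i)" ..
  then have W: "\<And>i. i < n \<Longrightarrow> continuous (at a) (W i)"
    "\<And>i. i < n \<Longrightarrow> W i a = ?M (J i) (g i) - Q (?M (J i) (g i))"
    "\<And>i t. i < n \<Longrightarrow> W i t \<in> range (\<lambda>v. v - Q v)"
    "\<And>i. i < n \<Longrightarrow> \<forall>\<^sub>F t in nhds a. B t (P (z i t)) = sV ((t - a) ^ J i) (W i t)"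
    unfolding H_def by auto
  have "has_order (\<lambda>t. map_det sV n e f (B t)) a (\<Sum>i<n. J i)"
  proof (rule has_order_map_det[OF sU sV e f, where p = "\<lambda>i t. P (z i t)" and w = W])
    have "\<forall>\<^sub>F t in nhds a. t \<in> \<Omega>" using open_\<Omega> a_mem by (rule eventually_nhds_in_open)
    with DY_kbl show "\<forall>\<^sub>F t in nhds a. \<forall>c. B t (lincomb sU n e c) = lincomb sV n (\<lambda>i. B t (e i)) c"
    proof eventually_elim
      case (elim t)
      note lin = kblD[OF L_kbl[OF elim(2)]] kblD[OF elim(1)] Q_lin
      have add: "B t (x + y) = B t x + B t y" for x y unfolding B_def by (simp add: lin)
      have scale: "B t (sU c x) = sV c (B t x)" for c x
        unfolding B_def by (simp add: lin U.scale_right_distrib[symmetric] V.scale_right_distrib V.scale_right_diff_distrib)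
      have "Modules.additive (B t)" by (rule additive.intro) (rule add)
      then show ?case by (simp add: lincomb_def additive.sum scale)
    qed
    show "\<forall>\<^sub>F t in nhds a. \<forall>i<n. B t (e i) \<in> range (\<lambda>v. v - Q v)"
      unfolding B_def by (intro always_eventually) auto
    fix i assume i: "i < n"
    have "continuous (at a) (z i)" unfolding z_def
      using continuous_on_vpoly[OF sU] by (simp add: continuous_on_eq_continuous_at)
    then show "continuous (at a) (\<lambda>t. P (z i t))"
      unfolding continuous_at by (rule bounded_linear.tendsto[OF P_lin(1)])
    show "\<forall>\<^sub>F t in nhds a. P (z i t) \<in> {x. L a x = 0}" by (simp add: L_P)
    show "\<forall>\<^sub>F t in nhds a. W i t \<in> range (\<lambda>v. v - Q v)" using W(3)[OF i] by simp
  next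
    have "P (z i a) = g i" if "i < n" for i
      unfolding za using U.kbasis_mem[OF g that] by (simp add: P_fix)
    then have "lincomb sU n (\<lambda>i. P (z i a)) = lincomb sU n g" unfolding lincomb_def by (intro ext sum.cong) auto
    then show "kbasis sU {x. L a x = 0} n (\<lambda>i. P (z i a))"
      using g unfolding U.kbasis_iff indep_family_def by simp
    have "lincomb sV n (\<lambda>i. W i a) = lincomb sV n (\<lambda>i. ?M (J i) (g i) - Q (?M (J i) (g i)))"
      unfolding lincomb_def by (intro ext sum.cong) (auto simp: W(2))
    then show "kbasis sV (range (\<lambda>v. v - Q v)) n (\<lambda>i. W i a)"
      using F unfolding V.kbasis_iff indep_family_def by simp
  qed (use W in auto)
  then show ?thesis unfolding sumJ B_def .
qed

text \<open>Existence for the definite description is \<open>ex_transversalization\<close>. For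
  uniqueness, every candidate value is the order at a of one and the same determinant, which depends
  on none of \<open>Ls\<close>, \<open>Phi\<close> and \<open>\<kappa>\<close>.\<close>

theorem has_order_alg_mult:
  assumes cA: "classA sU sV \<Omega> a r L"
    and e: "kbasis sU {x. L a x = 0} n e" and f: "kbasis sV (range (\<lambda>v. v - Q v)) n f"
    and DY: "\<forall>\<^sub>F t in nhds a. \<forall>x. L a x = 0 \<longrightarrow> P (x + DY t x) = x \<and> Q (L t (x + DY t x)) = 0"
    and DY_kbl: "\<forall>\<^sub>F t in nhds a. kbl sU sU (DY t)"
  shows "has_order (\<lambda>t. map_det sV n e f (\<lambda>x. L t (x + DY t x) - Q (L t (x + DY t x)))) a
           (alg_mult sU sV \<Omega> r L a)"
proof -
  let ?d = "\<lambda>t. map_det sV n e f (\<lambda>x. L t (x + DY t x) - Q (L t (x + DY t x)))"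
  let ?R = "\<lambda>c. \<exists>Ls Phi \<kappa>. kCr sU sV \<Omega> r L Ls \<and> kpoly_id sU Phi \<and> \<kappa> \<le> r \<and>
      transversal (prod_taylor Ls a Phi) \<kappa> \<and> c = tmult sV (prod_taylor Ls a Phi) \<kappa>"
  have ord: "has_order ?d a c" if "?R c" for c
    using that has_order_tmult[OF _ _ _ _ e f DY DY_kbl] by blast
  obtain Ls where Cr: "kCr sU sV \<Omega> r L Ls" using cA unfolding classA_def by blast
  obtain \<kappa> \<epsilon> C where k: "\<kappa> \<le> r" "\<epsilon> > 0"
    "\<And>t. 0 < dist t a \<Longrightarrow> dist t a < \<epsilon> \<Longrightarrow> bij (blinfun_apply (L t)) \<and>
       bounded_linear (inv_into UNIV (blinfun_apply (L t))) \<and> onorm (inv_into UNIV (blinfun_apply (L t))) < C / norm (t - a) ^ \<kappa>"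
    using cA unfolding classA_def by blast
  have star: "\<forall>u. (\<forall>l\<le>\<kappa>. coeff_conv (taylor_coeff Ls a) u l = 0) \<longrightarrow> u 0 = 0"
  proof (intro allI impI)
    fix u assume u: "\<forall>l\<le>\<kappa>. coeff_conv (taylor_coeff Ls a) u l = 0"
    show "u 0 = 0"
      by (rule chain_length_bound[OF sU sV open_\<Omega> a_mem Cr k(1,2)]) (rule k(3), assumption, assumption, simp add: u)
  qed
  obtain Phi \<kappa>' where "kpoly_id sU Phi \<and> \<kappa>' \<le> r \<and> transversal (prod_taylor Ls a Phi) \<kappa>'"
    using ex_transversalization[OF Cr e f k(1) star] by blast
  then have R: "?R (tmult sV (prod_taylor Ls a Phi) \<kappa>')" using Cr by blast
  have "alg_mult sU sV \<Omega> r L a = tmult sV (prod_taylor Ls a Phi) \<kappa>'"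
    unfolding alg_mult_def
  proof (rule the_equality)
    show "?R (tmult sV (prod_taylor Ls a Phi) \<kappa>')" by (rule R)
    show "c = tmult sV (prod_taylor Ls a Phi) \<kappa>'" if "?R c" for c
      by (rule has_order_unique[OF ord[OF that] ord[OF R]])
  qed
  then show ?thesis using ord[OF R] by simp
qed

end

section \<open>Lyapunov-Schmidt reduction\<close>

lemma pair_in_prod_balls:
  fixes a :: "'a::real_normed_vector" and b :: "'b::real_normed_vector"
  assumes "open W" "(a, b) \<in> W"
  obtains \<rho> where "\<rho> > 0" "\<And>x y. dist x a < \<rho> \<Longrightarrow> dist y b < \<rho> \<Longrightarrow> (x, y) \<in> W"
proof -
  obtain X Y where XY: "open X" "open Y" "a \<in> X" "b \<in> Y" "X \<times> Y \<subseteq> W"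
    using open_prod_elim[OF assms] by (metis mem_Sigma_iff)
  obtain d1 where "d1 > 0" "ball a d1 \<subseteq> X" using XY openE by blast
  moreover obtain d2 where "d2 > 0" "ball b d2 \<subseteq> Y" using XY openE by blast
  ultimately show ?thesis using XY(5)
    by (intro that[of "min d1 d2"]) (auto simp: subset_iff dist_commute)
qed

locale ls_nonlinear = ls_setting +
  fixes N :: "'a \<times> 'b \<Rightarrow> 'c"
    and L' :: "'a \<Rightarrow> ('a \<Rightarrow>\<^sub>L ('b \<Rightarrow>\<^sub>L 'c))" and N' :: "'a \<times> 'b \<Rightarrow> (('a \<times> 'b) \<Rightarrow>\<^sub>L 'c)" and \<delta>\<^sub>N :: real
  assumes L_der: "\<And>t. t \<in> \<Omega> \<Longrightarrow> (L has_derivative blinfun_apply (L' t)) (at t)"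
    and L'_scale: "\<And>t c h. t \<in> \<Omega> \<Longrightarrow> L' t (c * h) = bscale sV c (L' t h)"
    and L'_cont: "continuous_on \<Omega> L'"
    and N_der: "\<And>p. p \<in> \<Omega> \<times> UNIV \<Longrightarrow> (N has_derivative blinfun_apply (N' p)) (at p)"
    and N'_scale: "\<And>p c h. p \<in> \<Omega> \<times> UNIV \<Longrightarrow> N' p (pscale (*) sU c h) = sV c (N' p h)"
    and N'_cont: "continuous_on (\<Omega> \<times> UNIV) N'"
    and \<delta>\<^sub>N: "\<delta>\<^sub>N > 0" and N_zero: "\<And>t. dist t a < \<delta>\<^sub>N \<Longrightarrow> N (t, 0) = 0"
    and N_der_zero: "\<And>t. dist t a < \<delta>\<^sub>N \<Longrightarrow> ((\<lambda>u. N (t, u)) has_derivative (\<lambda>_. 0)) (at 0)"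
begin

definition F :: "'a \<Rightarrow> 'b \<Rightarrow> 'c" where "F t u = L t u + N (t, u)"

text \<open>Keeping t as a component turns the implicit equation for u into the inversion of a map
  of K \<times> U, with (t, x) as the new variables.\<close>

definition Psi :: "'a \<times> 'b \<Rightarrow> 'a \<times> 'b" where
  "Psi p = (fst p, P (snd p) + S (F (fst p) (snd p)))"

text \<open>Spelled out as sums and compositions of bounded operators, so that its continuity in p
  follows from that of \<open>L\<close>, \<open>L'\<close> and \<open>N'\<close>.\<close>

definition Psi' :: "'a \<times> 'b \<Rightarrow> (('a \<times> 'b) \<Rightarrow>\<^sub>L ('a \<times> 'b))" where
  "Psi' p = (Blinfun (\<lambda>x. (x, 0)) o\<^sub>L Blinfun fst) +
     (Blinfun (\<lambda>y. (0, y)) o\<^sub>L ((Blinfun P o\<^sub>L Blinfun snd) + (Blinfun S o\<^sub>L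
       ((L (fst p) o\<^sub>L Blinfun snd) + (blinfun.prod_left (snd p) o\<^sub>L (L' (fst p) o\<^sub>L Blinfun fst)) + N' p))))"

lemma Psi'_apply:
  "Psi' p h = (fst h, P (snd h) + S (L (fst p) (snd h) + L' (fst p) (fst h) (snd p) + N' p h))"
proof -
  have inl: "bounded_linear (\<lambda>x. (x, 0))" and inr: "bounded_linear (\<lambda>y. (0, y))"
    by (intro bounded_linear_Pair bounded_linear_ident bounded_linear_zero)+
  show ?thesis
    by (simp add: Psi'_def blinfun.add_left bounded_linear_Blinfun_apply[OF inl] bounded_linear_Blinfun_apply[OF inr]
        bounded_linear_Blinfun_apply[OF bounded_linear_fst] bounded_linear_Blinfun_apply[OF bounded_linear_snd]
        bounded_linear_Blinfun_apply[OF P_lin(1)] bounded_linear_Blinfun_apply[OF S_lin(1)])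
qed

lemma Psi'_cont: "continuous_on (\<Omega> \<times> UNIV) Psi'"
proof -
  have 1: "continuous_on (\<Omega> \<times> UNIV) (\<lambda>p::'a \<times> 'b. L (fst p))"
    by (rule continuous_on_compose2[OF L_cont continuous_on_fst[OF continuous_on_id]]) auto
  have 2: "continuous_on (\<Omega> \<times> UNIV) (\<lambda>p::'a \<times> 'b. L' (fst p))"
    by (rule continuous_on_compose2[OF L'_cont continuous_on_fst[OF continuous_on_id]]) auto
  have 3: "continuous_on (\<Omega> \<times> UNIV) (\<lambda>p::'a \<times> 'b. blinfun.prod_left (snd p) :: ('b \<Rightarrow>\<^sub>L 'c) \<Rightarrow>\<^sub>L 'c)"
    by (intro bounded_linear.continuous_on[OF blinfun.bounded_linear_prod_left] continuous_on_snd continuous_on_id)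
  note comp = bounded_bilinear.continuous_on[OF bounded_bilinear_blinfun_compose]
  show ?thesis unfolding Psi'_def
    by (intro continuous_on_add comp continuous_on_const 1 2 3 N'_cont)
qed

lemma Psi_der:
  assumes p: "p \<in> \<Omega> \<times> UNIV"
  shows "(Psi has_derivative blinfun_apply (Psi' p)) (at p)"
proof -
  have "(fst has_derivative fst) (at p)" by (rule has_derivative_fst[OF has_derivative_ident])
  moreover have "(L has_derivative blinfun_apply (L' (fst p))) (at (fst p))" using p by (intro L_der) auto
  ultimately have Lf: "((\<lambda>p::'a \<times> 'b. L (fst p)) has_derivative (\<lambda>h. L' (fst p) (fst h))) (at p)"
    by (rule has_derivative_compose)
  have "((\<lambda>p. L (fst p) (snd p)) has_derivative (\<lambda>h. L (fst p) (snd h) + L' (fst p) (fst h) (snd p))) (at p)"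
    by (rule blinfun.FDERIV[OF Lf has_derivative_snd[OF has_derivative_ident]])
  then have LN: "((\<lambda>p. L (fst p) (snd p) + N (fst p, snd p)) has_derivative
      (\<lambda>h. L (fst p) (snd h) + L' (fst p) (fst h) (snd p) + N' p h)) (at p)"
    using N_der[OF p] by (intro has_derivative_add) simp_all
  have "((\<lambda>p. (fst p, P (snd p) + S (L (fst p) (snd p) + N (fst p, snd p)))) has_derivative
      (\<lambda>h. (fst h, P (snd h) + S (L (fst p) (snd h) + L' (fst p) (fst h) (snd p) + N' p h)))) (at p)"
    by (intro has_derivative_Pair has_derivative_add bounded_linear.has_derivative[OF P_lin(1)]
        bounded_linear.has_derivative[OF S_lin(1) LN] has_derivative_fst has_derivative_snd has_derivative_ident)
  moreover have "Psi = (\<lambda>p. (fst p, P (snd p) + S (L (fst p) (snd p) + N (fst p, snd p))))"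
    by (simp add: fun_eq_iff Psi_def F_def)
  moreover have "blinfun_apply (Psi' p) = (\<lambda>h. (fst h, P (snd h) + S (L (fst p) (snd h) + L' (fst p) (fst h) (snd p) + N' p h)))"
    by (rule ext) (rule Psi'_apply)
  ultimately show ?thesis by simp
qed

lemma Psi'_scale:
  assumes p: "p \<in> \<Omega> \<times> UNIV"
  shows "Psi' p (pscale (*) sU c h) = pscale (*) sU c (Psi' p h)"
proof -
  have t: "fst p \<in> \<Omega>" using p by auto
  note lin = kblD[OF L_kbl[OF t]] P_lin S_lin
  show ?thesis
    unfolding Psi'_apply N'_scale[OF p]
    by (simp add: pscale_def lin L'_scale[OF t] bscale_apply[OF sV] U.scale_right_distrib)
qed

text \<open>The hypothesis controls the derivative in u only. The derivative in t vanishes as well,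
  because \<open>N (s, 0) = 0\<close> for all s near t, and the total derivative is the sum of the
  two.\<close>

lemma N'_zero:
  assumes t: "dist t a < \<delta>\<^sub>N" "t \<in> \<Omega>"
  shows "N' (t, 0) = 0"
proof (rule blinfun_eqI)
  fix h :: "'a \<times> 'b"
  have p: "(t, 0) \<in> \<Omega> \<times> (UNIV :: 'b set)" using t by simp
  note dN = N_der[OF p]
  have "((\<lambda>u. N (t, u)) has_derivative (\<lambda>k. N' (t, 0) (0, k))) (at 0)"
    by (rule has_derivative_compose[where g = N and f = "\<lambda>u. (t, u)"])
       (use dN in \<open>auto intro!: derivative_eq_intros\<close>)
  then have "(\<lambda>k. N' (t, 0) (0, k)) = (\<lambda>_. 0)" using N_der_zero[OF t(1)] by (rule has_derivative_unique)
  then have 1: "N' (t, 0) (0, snd h) = 0" by (rule fun_cong)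
  have "((\<lambda>s. N (s, 0)) has_derivative (\<lambda>k. N' (t, 0) (k, 0))) (at t)"
    by (rule has_derivative_compose[where g = N and f = "\<lambda>s. (s, 0)"])
       (use dN in \<open>auto intro!: derivative_eq_intros\<close>)
  moreover have "((\<lambda>s. N (s, 0)) has_derivative (\<lambda>_. 0)) (at t)"
  proof (rule has_derivative_transform_within_open[of "\<lambda>_. 0" _ _ _ "ball a \<delta>\<^sub>N"])
    show "0 = N (s, 0)" if "s \<in> ball a \<delta>\<^sub>N" for s using N_zero[of s] that by (simp add: dist_commute)
  qed (use t in \<open>auto simp: dist_commute\<close>)
  ultimately have "(\<lambda>k. N' (t, 0) (k, 0)) = (\<lambda>_. 0)" by (rule has_derivative_unique)
  then have 2: "N' (t, 0) (fst h, 0) = 0" by (rule fun_cong)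
  have "h = (fst h, 0) + (0, snd h)" by simp
  then have "N' (t, 0) h = N' (t, 0) (fst h, 0) + N' (t, 0) (0, snd h)" by (metis blinfun.add_right)
  then show "N' (t, 0) h = blinfun_apply 0 h" using 1 2 by simp
qed

lemma Psi'_zero_section:
  assumes t: "dist t a < \<delta>\<^sub>N" "t \<in> \<Omega>"
  shows "Psi' (t, 0) h = (fst h, A t (snd h))"
  using N'_zero[OF t] by (simp add: Psi'_apply A_apply)

lemma Psi_zero_section: "dist t a < \<delta>\<^sub>N \<Longrightarrow> Psi (t, 0) = (t, 0)"
  by (simp add: Psi_def F_def N_zero P_lin S_lin)

text \<open>There are two radii: data in \<delta>-balls give solutions of norm below \<rho>/2,
  whereas uniqueness holds for all u of norm below \<rho>. The gap between \<rho>/2 and \<rho> is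
  what later excludes other solution maps.\<close>

theorem reduction:
  obtains \<rho> \<delta> \<gamma> \<Gamma> where "0 < \<delta>" "\<delta> \<le> \<rho>" "\<And>t. dist t a < \<delta> \<Longrightarrow> t \<in> \<Omega>"
    "\<And>t x. dist t a < \<delta> \<Longrightarrow> norm x < \<delta> \<Longrightarrow> P (\<gamma> (t, x)) + S (F t (\<gamma> (t, x))) = x \<and> norm (\<gamma> (t, x)) < \<rho> / 2"
    "\<And>t u x. dist t a < \<rho> \<Longrightarrow> norm u < \<rho> \<Longrightarrow> P u + S (F t u) = x \<Longrightarrow> \<gamma> (t, x) = u"
    "\<And>p. p \<in> ball a \<delta> \<times> ball 0 \<delta> \<Longrightarrow> (\<gamma> has_derivative blinfun_apply (\<Gamma> p)) (at p)"
    "\<And>p c h. p \<in> ball a \<delta> \<times> ball 0 \<delta> \<Longrightarrow> \<Gamma> p (pscale (*) sU c h) = sU c (\<Gamma> p h)"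
    "continuous_on (ball a \<delta> \<times> ball 0 \<delta>) \<Gamma>"
    "\<And>t. dist t a < \<delta> \<Longrightarrow> \<gamma> (t, 0) = 0"
    "\<And>t k. dist t a < \<delta> \<Longrightarrow> A t (\<Gamma> (t, 0) (0, k)) = k"
    "\<And>t. dist t a < \<delta> \<Longrightarrow> norm (A t - id_blinfun) \<le> 1/2"
proof -
  have S: "open (\<Omega> \<times> (UNIV :: 'b set))" "(a, 0) \<in> \<Omega> \<times> (UNIV :: 'b set)"
    using open_\<Omega> a_mem by (auto intro: open_Times)
  have id: "Psi' (a, 0) = id_blinfun"
    by (rule blinfun_eqI) (simp add: Psi'_zero_section a_mem \<delta>\<^sub>N A_center)
  obtain W V g g' where W: "open W" "(a, 0) \<in> W" "W \<subseteq> \<Omega> \<times> UNIV"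
    and V: "open V" "Psi (a, 0) \<in> V"
    and gPsi: "\<And>p. p \<in> W \<Longrightarrow> Psi p \<in> V \<and> g (Psi p) = p"
    and Psig: "\<And>y. y \<in> V \<Longrightarrow> g y \<in> W \<and> Psi (g y) = y"
    and g_der: "\<And>y. y \<in> V \<Longrightarrow> (g has_derivative blinfun_apply (g' y)) (at y)"
    and fg: "\<And>y. y \<in> V \<Longrightarrow> Psi' (g y) o\<^sub>L g' y = id_blinfun"
    and gf: "\<And>y. y \<in> V \<Longrightarrow> g' y o\<^sub>L Psi' (g y) = id_blinfun"
    and g'_cont: "continuous_on V g'"
    by (rule inverse_function_near_identity[OF S Psi_der Psi'_cont id]) blast+
  have fg': "Psi' (g y) (g' y h) = h" and gf': "g' y (Psi' (g y) h) = h" if "y \<in> V" for y h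
    using fg[OF that] gf[OF that] by (metis blinfun_apply_blinfun_compose blinfun_apply_id_blinfun)+
  have Psi0: "Psi (a, 0) = (a, 0)" by (rule Psi_zero_section) (simp add: \<delta>\<^sub>N)
  have fst_g: "fst (g y) = fst y" if "y \<in> V" for y
    using Psig[OF that] by (metis Psi_def fst_conv)
  obtain \<rho>1 where \<rho>1: "\<rho>1 > 0" "\<And>t u. dist t a < \<rho>1 \<Longrightarrow> dist u 0 < \<rho>1 \<Longrightarrow> (t, u) \<in> W"
    using pair_in_prod_balls[OF W(1,2)] by blast
  \<comment> \<open>The product of \<rho>-balls lies in W, and below \<open>\<delta>\<^sub>N\<close>
    the points (t, 0) are fixed by Psi.\<close>
  define \<rho> where "\<rho> = min \<rho>1 \<delta>\<^sub>N"
  have \<rho>: "\<rho> > 0" "\<And>t u. dist t a < \<rho> \<Longrightarrow> norm u < \<rho> \<Longrightarrow> (t, u) \<in> W" "\<rho> \<le> \<delta>\<^sub>N"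
    using \<rho>1 \<delta>\<^sub>N by (auto simp: \<rho>_def)
  have "continuous (at (a, 0)) g" using g_der[of "(a, 0)"] V(2) Psi0 has_derivative_continuous by metis
  moreover have "g (a, 0) = (a, 0)" using gPsi[OF W(2)] Psi0 by simp
  ultimately have "((\<lambda>p. snd (g p)) \<longlongrightarrow> 0) (at (a, 0))"
    using tendsto_snd[of g "(a, 0)" "at (a, 0)"] by (simp add: continuous_at)
  then have "\<forall>\<^sub>F p in at (a, 0). norm (snd (g p)) < \<rho> / 2"
    using \<rho>(1) by (auto dest!: tendstoD[of _ _ _ "\<rho> / 2"])
  then have "\<forall>\<^sub>F p in nhds (a, 0). norm (snd (g p)) < \<rho> / 2"
    using \<rho>(1) \<open>g (a, 0) = (a, 0)\<close> by (simp add: eventually_nhds_conv_at)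
  moreover have "\<forall>\<^sub>F p in nhds (a, 0). p \<in> V" using V Psi0 by (intro eventually_nhds_in_open) auto
  ultimately have "\<forall>\<^sub>F p in nhds (a, 0). p \<in> V \<and> norm (snd (g p)) < \<rho> / 2" by eventually_elim simp
  then obtain X where X: "open X" "(a, 0) \<in> X" "\<And>p. p \<in> X \<Longrightarrow> p \<in> V \<and> norm (snd (g p)) < \<rho> / 2"
    unfolding eventually_nhds by blast
  obtain \<delta>1 where \<delta>1: "\<delta>1 > 0" "\<And>t x. dist t a < \<delta>1 \<Longrightarrow> dist x 0 < \<delta>1 \<Longrightarrow> (t, x) \<in> X"
    using pair_in_prod_balls[OF X(1,2)] by blast
  obtain \<delta>2 where \<delta>2: "\<delta>2 > 0" "\<And>t. dist t a < \<delta>2 \<Longrightarrow> norm (A t - id_blinfun) \<le> 1/2"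
    using A_near_identity unfolding eventually_nhds_metric by blast
  \<comment> \<open>\<delta>1 keeps the solutions below \<rho>/2, \<delta>2 keeps \<open>A t\<close>
    near the identity, and \<rho> gives access to uniqueness.\<close>
  define \<delta> where "\<delta> = Min {\<delta>1, \<delta>2, \<rho>}"
  have \<delta>: "\<delta> > 0" "\<delta> \<le> \<delta>1" "\<delta> \<le> \<delta>2" "\<delta> \<le> \<rho>" using \<delta>1 \<delta>2 \<rho> by (auto simp: \<delta>_def)
  define \<gamma> where "\<gamma> = (\<lambda>p. snd (g p))"
  define \<Gamma> where "\<Gamma> = (\<lambda>p. Blinfun snd o\<^sub>L g' p)"
  have \<Gamma>: "\<Gamma> p h = snd (g' p h)" for p h
    by (simp add: \<Gamma>_def bounded_linear_Blinfun_apply[OF bounded_linear_snd])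
  have XV: "(t, x) \<in> V" "norm (\<gamma> (t, x)) < \<rho> / 2" if "dist t a < \<delta>" "norm x < \<delta>" for t x
    using X(3)[OF \<delta>1(2), of t x] that \<delta> by (auto simp: \<gamma>_def)
  have ballV: "p \<in> V" if "p \<in> ball a \<delta> \<times> ball 0 \<delta>" for p
    using XV(1)[of "fst p" "snd p"] that by (auto simp: dist_commute)
  have g0: "g (t, 0) = (t, 0)" if "dist t a < \<rho>" for t
    using gPsi[OF \<rho>(2), of t 0] that \<rho> Psi_zero_section[of t] by simp
  show ?thesis
  proof (rule that[of \<delta> \<rho> \<gamma> \<Gamma>])
    show "0 < \<delta>" "\<delta> \<le> \<rho>" by fact+
    show t\<Omega>: "t \<in> \<Omega>" if "dist t a < \<delta>" for t
      using \<rho>(2)[of t 0] W(3) that \<delta> \<rho>(1) by auto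
    show "P (\<gamma> (t, x)) + S (F t (\<gamma> (t, x))) = x \<and> norm (\<gamma> (t, x)) < \<rho> / 2" if "dist t a < \<delta>" "norm x < \<delta>" for t x
    proof -
      have "Psi (g (t, x)) = (t, x)" "fst (g (t, x)) = t" using Psig fst_g XV(1)[OF that] by auto
      then show ?thesis using XV(2)[OF that] by (simp add: Psi_def \<gamma>_def)
    qed
    show "\<gamma> (t, x) = u" if "dist t a < \<rho>" "norm u < \<rho>" "P u + S (F t u) = x" for t u x
      using gPsi[OF \<rho>(2)[OF that(1,2)]] that(3) by (simp add: Psi_def \<gamma>_def)
    show "(\<gamma> has_derivative blinfun_apply (\<Gamma> p)) (at p)" if "p \<in> ball a \<delta> \<times> ball 0 \<delta>" for p
      using has_derivative_snd[OF g_der[OF ballV[OF that]]] unfolding \<gamma>_def by (simp add: \<Gamma>[abs_def])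
    show "\<Gamma> p (pscale (*) sU c h) = sU c (\<Gamma> p h)" if p: "p \<in> ball a \<delta> \<times> ball 0 \<delta>" for p c h
    proof -
      have pV: "p \<in> V" by (rule ballV[OF p])
      \<comment> \<open>The inverse function theorem was real; the K-linearity of
        \<open>g' p\<close> is inherited from its inverse \<open>Psi' (g p)\<close>.\<close>
      have "g p \<in> \<Omega> \<times> UNIV" using Psig[OF pV] W(3) by blast
      then have "Psi' (g p) (pscale (*) sU c (g' p h)) = pscale (*) sU c h"
        by (simp add: Psi'_scale fg'[OF pV])
      then have "g' p (pscale (*) sU c h) = pscale (*) sU c (g' p h)" using gf'[OF pV] by metis
      then show ?thesis by (simp add: \<Gamma> pscale_def)
    qed
    have "continuous_on (ball a \<delta> \<times> ball 0 \<delta>) g'" using g'_cont ballV by (rule continuous_on_subset[OF _ subsetI])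
    then show "continuous_on (ball a \<delta> \<times> ball 0 \<delta>) \<Gamma>" unfolding \<Gamma>_def
      by (intro bounded_bilinear.continuous_on[OF bounded_bilinear_blinfun_compose] continuous_on_const)
    show "\<gamma> (t, 0) = 0" if "dist t a < \<delta>" for t using g0[of t] that \<delta> by (simp add: \<gamma>_def)
    show "A t (\<Gamma> (t, 0) (0, k)) = k" if t: "dist t a < \<delta>" for t k
    proof -
      have V0: "(t, 0) \<in> V" using XV(1)[of t 0] t \<delta> by simp
      have "Psi' (t, 0) (g' (t, 0) (0, k)) = (0, k)" using fg'[OF V0, of "(0, k)"] g0[of t] t \<delta> by simp
      moreover have "Psi' (t, 0) h = (fst h, A t (snd h))" for h
        using t \<delta> \<rho>(3) t\<Omega>[OF t] by (intro Psi'_zero_section) auto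
      ultimately show ?thesis by (simp add: \<Gamma>)
    qed
    show "norm (A t - id_blinfun) \<le> 1/2" if "dist t a < \<delta>" for t using \<delta>2(2) that \<delta> by auto
  qed
qed

end

section \<open>The solution map Y and the linearized bifurcation equation\<close>

text \<open>Fixes one outcome of \<open>reduction\<close>, so that Y and DY can be definitions
  shared by the lemmas that follow.\<close>

locale ls_reduced = ls_nonlinear +
  fixes \<rho> \<delta> :: real and \<gamma> :: "'a \<times> 'b \<Rightarrow> 'b" and \<Gamma> :: "'a \<times> 'b \<Rightarrow> (('a \<times> 'b) \<Rightarrow>\<^sub>L 'b)"
  assumes \<delta>: "0 < \<delta>" "\<delta> \<le> \<rho>" and ball_\<Omega>: "\<And>t. dist t a < \<delta> \<Longrightarrow> t \<in> \<Omega>"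
    and sol: "\<And>t x. dist t a < \<delta> \<Longrightarrow> norm x < \<delta> \<Longrightarrow>
        P (\<gamma> (t, x)) + S (F t (\<gamma> (t, x))) = x \<and> norm (\<gamma> (t, x)) < \<rho> / 2"
    and uniq: "\<And>t u x. dist t a < \<rho> \<Longrightarrow> norm u < \<rho> \<Longrightarrow> P u + S (F t u) = x \<Longrightarrow> \<gamma> (t, x) = u"
    and \<gamma>_der: "\<And>p. p \<in> ball a \<delta> \<times> ball 0 \<delta> \<Longrightarrow> (\<gamma> has_derivative blinfun_apply (\<Gamma> p)) (at p)"
    and \<Gamma>_scale: "\<And>p c h. p \<in> ball a \<delta> \<times> ball 0 \<delta> \<Longrightarrow> \<Gamma> p (pscale (*) sU c h) = sU c (\<Gamma> p h)"
    and \<Gamma>_cont: "continuous_on (ball a \<delta> \<times> ball 0 \<delta>) \<Gamma>"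
    and \<gamma>_zero: "\<And>t. dist t a < \<delta> \<Longrightarrow> \<gamma> (t, 0) = 0"
    and A_\<Gamma>: "\<And>t k. dist t a < \<delta> \<Longrightarrow> A t (\<Gamma> (t, 0) (0, k)) = k"
    and A_id: "\<And>t. dist t a < \<delta> \<Longrightarrow> norm (A t - id_blinfun) \<le> 1/2"
begin

definition Nk :: "'b set" where "Nk = {x. L a x = 0}"
definition Ry :: "'b set" where "Ry = range (\<lambda>u. u - P u)"
definition \<U> :: "('a \<times> 'b) set" where "\<U> = (ball a \<delta> \<times> ball 0 \<delta>) \<inter> (\<Omega> \<times> Nk)"
definition kproj_snd :: "'a \<times> 'b \<Rightarrow> 'a \<times> 'b" where "kproj_snd p = (fst p, P (snd p))"
text \<open>Factoring through P makes Y and its derivative depend on the kernel component alone,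
  while both are defined on the whole space.\<close>

definition Y :: "'a \<times> 'b \<Rightarrow> 'b" where "Y p = \<gamma> (kproj_snd p) - P (snd p)"
definition DY :: "'a \<Rightarrow> 'b \<Rightarrow> 'b" where "DY t x = \<Gamma> (t, 0) (0, P x) - P x"

lemma Nk_iff:
  "x \<in> Nk \<longleftrightarrow> P x = x"
  unfolding Nk_def using P_fix[of x] L_P[of x] by auto

lemma Ry_iff:
  "y \<in> Ry \<longleftrightarrow> P y = 0"
  unfolding Ry_def by (auto simp: P_lin P_idem intro: range_eqI[of _ _ y])

lemma dom_iff:
  "(t, x) \<in> \<U> \<longleftrightarrow> dist t a < \<delta> \<and> norm x < \<delta> \<and> x \<in> Nk"
  unfolding \<U>_def using ball_\<Omega>[of t] by (auto simp: dist_commute)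

lemma kproj_snd_dom:
  assumes hyp: "p \<in> \<U>"
  shows "kproj_snd p = p"
  using hyp dom_iff[of "fst p" "snd p"] Nk_iff[of "snd p"] by (simp add: kproj_snd_def)

lemma bounded_linear_kproj_snd:
  "bounded_linear kproj_snd"
  unfolding kproj_snd_def[abs_def]
  by (intro bounded_linear_Pair bounded_linear_fst bounded_linear_compose[OF P_lin(1)] bounded_linear_snd)

lemma Q_iff:
  "Q (L t u + N (t, u)) = 0 \<longleftrightarrow> S (F t u) = 0"
  by (simp add: Q_zero_iff F_def)

lemma \<gamma>_solves:
  assumes hyp: "(t, x) \<in> \<U>"
  shows "P (\<gamma> (t, x)) = x" "S (F t (\<gamma> (t, x))) = 0"
proof -
  have eq: "P (\<gamma> (t, x)) + S (F t (\<gamma> (t, x))) = x" using sol[of t x] hyp by (simp add: dom_iff)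
  have "P (P (\<gamma> (t, x)) + S (F t (\<gamma> (t, x)))) = P (\<gamma> (t, x))"
    by (simp add: P_lin(2) P_idem P_S)
  then show "P (\<gamma> (t, x)) = x" using hyp unfolding eq by (simp add: dom_iff Nk_iff)
  then show "S (F t (\<gamma> (t, x))) = 0" using eq by simp
qed

lemma Y_dom:
  assumes hyp: "(t, x) \<in> \<U>"
  shows "Y (t, x) = \<gamma> (t, x) - x"
  using kproj_snd_dom[OF hyp] hyp by (simp add: Y_def dom_iff Nk_iff)

lemma Y_C1:
  "kC1_on (pscale (*) sU) sU \<U> Y"
  unfolding kC1_on_def
proof (intro exI[of _ "\<lambda>p. (\<Gamma> (kproj_snd p) o\<^sub>L Blinfun kproj_snd) - (Blinfun P o\<^sub>L Blinfun snd)"] conjI ballI allI)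
  have app: "((\<Gamma> (kproj_snd p) o\<^sub>L Blinfun kproj_snd) - (Blinfun P o\<^sub>L Blinfun snd)) h = \<Gamma> (kproj_snd p) (kproj_snd h) - P (snd h)" for p h
    by (simp add: blinfun.diff_left bounded_linear_Blinfun_apply[OF bounded_linear_kproj_snd]
        bounded_linear_Blinfun_apply[OF P_lin(1)] bounded_linear_Blinfun_apply[OF bounded_linear_snd])
  have mp: "kproj_snd p \<in> ball a \<delta> \<times> ball 0 \<delta>" if "p \<in> \<U>" for p
    using that unfolding kproj_snd_dom[OF that] by (simp add: \<U>_def)
  fix p assume p: "p \<in> \<U>"
  have \<gamma>kproj_snd: "((\<lambda>p. \<gamma> (kproj_snd p)) has_derivative (\<lambda>h. \<Gamma> (kproj_snd p) (kproj_snd h))) (at p within \<U>)"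
    by (rule has_derivative_compose[OF bounded_linear_imp_has_derivative[OF bounded_linear_kproj_snd] \<gamma>_der[OF mp[OF p]]])
  have "(Y has_derivative (\<lambda>h. \<Gamma> (kproj_snd p) (kproj_snd h) - P (snd h))) (at p within \<U>)"
    unfolding Y_def[abs_def]
    by (intro has_derivative_diff \<gamma>kproj_snd bounded_linear.has_derivative[OF P_lin(1)] has_derivative_snd has_derivative_ident)
  then show "(Y has_derivative blinfun_apply ((\<Gamma> (kproj_snd p) o\<^sub>L Blinfun kproj_snd) - (Blinfun P o\<^sub>L Blinfun snd))) (at p within \<U>)"
    by (simp add: app[abs_def])
  show "((\<Gamma> (kproj_snd p) o\<^sub>L Blinfun kproj_snd) - (Blinfun P o\<^sub>L Blinfun snd)) (pscale (*) sU c h) =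
      sU c (((\<Gamma> (kproj_snd p) o\<^sub>L Blinfun kproj_snd) - (Blinfun P o\<^sub>L Blinfun snd)) h)" for c h
  proof -
    have "kproj_snd (pscale (*) sU c h) = pscale (*) sU c (kproj_snd h)" by (simp add: kproj_snd_def pscale_def P_lin)
    then show ?thesis unfolding app
      by (simp add: \<Gamma>_scale[OF mp[OF p]] U.scale_right_diff_distrib) (simp add: pscale_def P_lin)
  qed
next
  have "continuous_on \<U> (\<lambda>p. \<Gamma> (kproj_snd p))"
  proof (rule continuous_on_compose2[OF \<Gamma>_cont bounded_linear.continuous_on[OF bounded_linear_kproj_snd continuous_on_id]])
    show "kproj_snd ` \<U> \<subseteq> ball a \<delta> \<times> ball 0 \<delta>" using kproj_snd_dom by (auto simp: \<U>_def)
  qed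
  then show "continuous_on \<U> (\<lambda>p. (\<Gamma> (kproj_snd p) o\<^sub>L Blinfun kproj_snd) - (Blinfun P o\<^sub>L Blinfun snd))"
    by (intro continuous_on_diff continuous_on_const bounded_bilinear.continuous_on[OF bounded_bilinear_blinfun_compose])
qed

lemma Y_Ry:
  assumes hyp: "p \<in> \<U>"
  shows "Y p \<in> Ry"
  using \<gamma>_solves(1)[of "fst p" "snd p"] Y_dom[of "fst p" "snd p"] hyp
  by (simp add: Ry_iff P_lin P_idem) (metis P_idem)

lemma Y_solves:
  assumes hyp: "(t, x) \<in> \<U>"
  shows "Q (L t (x + Y (t, x)) + N (t, x + Y (t, x))) = 0"
  using \<gamma>_solves(2)[OF hyp] Y_dom[OF hyp] by (simp add: Q_iff)

text \<open>\<open>uniq\<close> concerns solutions of norm below \<rho>, but Y' is not assumed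
  small. Along the segment from (t, 0) to (t, x) the norm of s x + Y'(t, s x) starts at 0 and is
  continuous. It cannot equal \<rho>/2: at that size the point would be a value of \<gamma>, and
  those have norm below \<rho>/2. By the intermediate value theorem it stays below \<rho>/2, where
  \<open>uniq\<close> applies.\<close>

lemma Y_unique:
  assumes Y': "kC1_on (pscale (*) sU) sU \<U> Y'" "\<forall>p\<in>\<U>. Y' p \<in> Ry" "\<forall>t. (t, 0) \<in> \<U> \<longrightarrow> Y' (t, 0) = 0"
    "\<forall>t x. (t, x) \<in> \<U> \<longrightarrow> Q (L t (x + Y' (t, x)) + N (t, x + Y' (t, x))) = 0" and p: "p \<in> \<U>"
  shows "Y' p = Y p"
proof -
  obtain t x where tx: "p = (t, x)" by (cases p)
  have t: "dist t a < \<delta>" "norm x < \<delta>" "x \<in> Nk" using p by (auto simp: tx dom_iff)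
  have seg: "(t, s *\<^sub>R x) \<in> \<U>" if "s \<in> {0..1}" for s
  proof -
    have "norm (s *\<^sub>R x) \<le> 1 * norm x" using that by (simp add: mult_left_le_one_le)
    then show ?thesis using t by (simp add: dom_iff Nk_def blinfun.scaleR_right)
  qed
  define u where "u = (\<lambda>s. s *\<^sub>R x + Y' (t, s *\<^sub>R x))"
  have u_\<gamma>: "\<gamma> (t, s *\<^sub>R x) = u s" if s: "s \<in> {0..1}" "norm (u s) < \<rho>" for s
  proof (rule uniq)
    show "dist t a < \<rho>" using t \<delta> by simp
    have "P (s *\<^sub>R x) = s *\<^sub>R x" using seg[OF s(1)] by (simp add: dom_iff Nk_iff)
    moreover have "P (Y' (t, s *\<^sub>R x)) = 0" using Y'(2) seg[OF s(1)] Ry_iff by blast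
    moreover have "S (F t (u s)) = 0" using Y'(4) seg[OF s(1)] unfolding u_def Q_iff[symmetric] by blast
    ultimately show "P (u s) + S (F t (u s)) = s *\<^sub>R x" by (simp add: u_def P_lin(2))
  qed (rule s(2))
  have u_small: "norm (u s) < \<rho> / 2" if s: "s \<in> {0..1}" "norm (u s) < \<rho>" for s
    using sol[of t "s *\<^sub>R x"] u_\<gamma>[OF s] seg[OF s(1)] by (simp add: dom_iff)
  have "continuous_on \<U> Y'"
    using Y'(1) unfolding kC1_on_def continuous_on_eq_continuous_within by (blast intro: has_derivative_continuous)
  then have "continuous_on {0..1} (\<lambda>s. Y' (t, s *\<^sub>R x))"
    by (rule continuous_on_compose2) (use seg in \<open>auto intro!: continuous_intros\<close>)
  then have cont: "continuous_on {0..1} (\<lambda>s. norm (u s))"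
    unfolding u_def by (intro continuous_intros)
  have u0: "norm (u 0) = 0" using Y'(3) seg[of 0] by (simp add: u_def)
  have "norm (u 1) < \<rho> / 2"
  proof (rule ccontr)
    assume "\<not> norm (u 1) < \<rho> / 2"
    then obtain s where "0 \<le> s" "s \<le> 1" "norm (u s) = \<rho> / 2"
      using IVT'[of "\<lambda>s. norm (u s)" 0 "\<rho> / 2" 1] u0 cont \<delta> by auto
    then show False using u_small[of s] \<delta> by simp
  qed
  then have "\<gamma> (t, x) = x + Y' (t, x)" using u_\<gamma>[of 1] \<delta> by (simp add: u_def)
  then show ?thesis using Y_dom[of t x] p by (simp add: tx)
qed

text \<open>The neighbourhood also confines u to the \<rho>-ball, where \<open>uniq\<close>
  identifies each zero with the value of \<gamma> at its kernel component.\<close>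

lemma local_zeros:
  "\<exists>W. open W \<and> (a, 0) \<in> W \<and> (\<forall>t u. (t, u) \<in> W \<longrightarrow> (t, P u) \<in> \<U> \<and>
    (Q (L t u + N (t, u)) = 0 \<longleftrightarrow> u - P u = Y (t, P u)))"
proof (intro exI[of _ "ball a \<delta> \<times> (ball 0 \<rho> \<inter> P -` ball 0 \<delta>)"] conjI allI impI)
  have "open (P -` ball 0 \<delta>)"
    by (rule open_vimage[OF open_ball bounded_linear.continuous_on[OF P_lin(1) continuous_on_id]])
  then show "open (ball a \<delta> \<times> (ball 0 \<rho> \<inter> P -` ball 0 \<delta>))" by (intro open_Times open_Int open_ball)
  show "(a, 0) \<in> ball a \<delta> \<times> (ball 0 \<rho> \<inter> P -` ball 0 \<delta>)" using \<delta> by (simp add: P_lin)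
  fix t u assume "(t, u) \<in> ball a \<delta> \<times> (ball 0 \<rho> \<inter> P -` ball 0 \<delta>)"
  then have tu: "dist t a < \<delta>" "norm u < \<rho>" "norm (P u) < \<delta>" by (auto simp: dist_commute)
  then show PU: "(t, P u) \<in> \<U>" by (simp add: dom_iff Nk_iff P_idem)
  show "Q (L t u + N (t, u)) = 0 \<longleftrightarrow> u - P u = Y (t, P u)"
  proof
    assume "Q (L t u + N (t, u)) = 0"
    then have "P u + S (F t u) = P u" by (simp add: Q_iff)
    then have "\<gamma> (t, P u) = u" using uniq[of t u "P u"] tu \<delta> by simp
    then show "u - P u = Y (t, P u)" by (simp add: Y_dom[OF PU])
  next
    assume "u - P u = Y (t, P u)"
    then have "\<gamma> (t, P u) = u" by (simp add: Y_dom[OF PU])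
    then show "Q (L t u + N (t, u)) = 0" using \<gamma>_solves(2)[OF PU] by (simp add: Q_iff)
  qed
qed

text \<open>The vector k = x + DY t x solves \<open>A t k = x\<close>. Since P S = 0, applying P
  separates this into P k = x and S L k = 0.\<close>

lemma kernel_solution:
  assumes t: "dist t a < \<delta>" and x: "x \<in> Nk"
  shows "P (x + DY t x) = x" "Q (L t (x + DY t x)) = 0"
proof -
  define k where "k = \<Gamma> (t, 0) (0, x)"
  have k: "x + DY t x = k" using x by (simp add: DY_def k_def Nk_iff)
  have A: "P k + S (L t k) = x" using A_\<Gamma>[OF t, of x] by (simp add: k_def A_apply)
  have "P (P k + S (L t k)) = P k" by (simp add: P_lin(2) P_idem P_S)
  then have Pk: "P k = x" using x unfolding A by (simp add: Nk_iff)
  then have "Q (L t k) = 0" using A by (simp add: Q_zero_iff)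
  with Pk show "P (x + DY t x) = x" "Q (L t (x + DY t x)) = 0" by (simp_all add: k)
qed

text \<open>On the kernel of P, \<open>A t\<close> is S L(t), and S is injective on the range of Q;
  so bijectivity descends from \<open>A t\<close>. For surjectivity the solution of
  \<open>A t u = S v\<close> satisfies P u = 0 because P S = 0.\<close>

lemma L11_bij:
  assumes t: "dist t a < \<delta>"
  shows "bij_betw (\<lambda>y. Q (L t y)) Ry (range Q)"
proof (rule bij_betwI')
  fix y z assume yz: "y \<in> Ry" "z \<in> Ry"
  show "Q (L t y) = Q (L t z) \<longleftrightarrow> y = z"
  proof
    assume "Q (L t y) = Q (L t z)"
    then have "S (L t (y - z)) = 0" by (simp add: blinfun.diff_right Q_lin Q_zero_iff[symmetric])
    then have "A t (y - z) = 0" using yz by (simp add: A_apply P_lin Ry_iff)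
    then show "y = z" using near_identity_lower_bound[OF A_id[OF t], of "y - z"] by simp
  qed simp
next
  fix v assume "v \<in> range Q"
  then have v: "Q v = v" using Q_idem by auto
  obtain u where u: "A t u = S v" using near_identity_surj[OF A_id[OF t]] by blast
  then have eq: "P u + S (L t u) = S v" by (simp add: A_apply)
  have "P (P u + S (L t u)) = P u" by (simp add: P_lin(2) P_idem P_S)
  then have Pu: "P u = 0" unfolding eq by (simp add: P_S)
  then have "Q (L t u) = v" using eq L_S[of "L t u"] L_S[of v] v by simp
  then show "\<exists>y\<in>Ry. v = Q (L t y)" using Pu Ry_iff by blast
qed simp

lemma DY_der:
  assumes t: "dist t a < \<delta>"
  shows "((\<lambda>x. Y (t, x)) has_derivative DY t) (at 0 within Nk)"
proof -
  have t0: "(t, P 0) \<in> ball a \<delta> \<times> ball 0 \<delta>" using t \<delta> by (simp add: P_lin dist_commute)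
  have "((\<lambda>x. (t, P x)) has_derivative (\<lambda>h. (0, P h))) (at 0 within Nk)"
    by (intro has_derivative_Pair has_derivative_const bounded_linear_imp_has_derivative[OF P_lin(1)])
  from has_derivative_compose[OF this \<gamma>_der[OF t0]]
  have "((\<lambda>x. \<gamma> (t, P x)) has_derivative (\<lambda>h. \<Gamma> (t, 0) (0, P h))) (at 0 within Nk)" by (simp add: P_lin)
  then show ?thesis unfolding Y_def kproj_snd_def DY_def[abs_def] fst_conv snd_conv
    by (intro has_derivative_diff bounded_linear_imp_has_derivative[OF P_lin(1)])
qed

text \<open>The linearized equation \<open>Q (L t (x + DY t x)) = 0\<close>, solved for its
  component in Ry.\<close>

lemma DY_eq:
  assumes t: "dist t a < \<delta>" and x: "x \<in> Nk"
  shows "DY t x = - the_inv_into Ry (\<lambda>y. Q (L t y)) (Q (L t (P x)))"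
proof -
  have "the_inv_into Ry (\<lambda>y. Q (L t y)) (Q (L t (P x))) = - DY t x"
  proof (rule the_inv_into_f_eq)
    show "inj_on (\<lambda>y. Q (L t y)) Ry" using L11_bij[OF t] by (simp add: bij_betw_def)
    have "Q (L t x) + Q (L t (DY t x)) = 0" using kernel_solution(2)[OF t x] by (simp add: blinfun.add_right Q_lin)
    then have z: "Q (L t (DY t x)) = - Q (L t x)" by (simp add: eq_neg_iff_add_eq_0 add.commute)
    have "Q (L t (0 - DY t x)) = Q (L t x)"
      by (simp only: blinfun.diff_right blinfun.zero_right Q_lin(3,4) z) simp
    then show "Q (L t (- DY t x)) = Q (L t (P x))" using x by (simp add: Nk_iff)
    have "P (DY t x) = 0" using kernel_solution(1)[OF t x] x by (simp add: P_lin(2) Nk_iff)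
    then have "P (0 - DY t x) = 0" by (simp only: P_lin(3,4)) simp
    then show "- DY t x \<in> Ry" by (simp add: Ry_iff)
  qed
  then show ?thesis by simp
qed

lemma bifurcation_operator_eq:
  assumes t: "dist t a < \<delta>" and x: "x \<in> Nk" and z: "z = the_inv_into Ry (\<lambda>y. Q (L t y)) (Q (L t (P x)))"
  shows "L t (x + DY t x) - Q (L t (x + DY t x)) =
    L t (P x) - Q (L t (P x)) - (L t (z - P z) - Q (L t (z - P z)))"
proof -
  have dz: "DY t x = - z" unfolding z by (rule DY_eq[OF t x])
  have "P (x - z) = x" using kernel_solution(1)[OF t x] by (simp add: dz)
  then have "P z = 0" using x by (simp add: P_lin(3) Nk_iff)
  then show ?thesis using x by (simp add: dz Nk_iff blinfun.diff_right Q_lin(3))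
qed

lemma has_order_bifurcation:
  assumes cA: "classA sU sV \<Omega> a r L"
    and e: "kbasis sU Nk n e" and f: "kbasis sV (range (\<lambda>v. v - Q v)) n f"
  shows "has_order (\<lambda>t. map_det sV n e f (\<lambda>x. L t (x + DY t x) - Q (L t (x + DY t x)))) a
    (alg_mult sU sV \<Omega> r L a)"
proof (rule has_order_alg_mult[OF cA e[unfolded Nk_def] f])
  show "\<forall>\<^sub>F t in nhds a. \<forall>x. L a x = 0 \<longrightarrow> P (x + DY t x) = x \<and> Q (L t (x + DY t x)) = 0"
    unfolding eventually_nhds_metric using \<delta>(1) kernel_solution by (intro exI[of _ \<delta>]) (simp add: Nk_def)
  have "kbl sU sU (DY t)" if t: "dist t a < \<delta>" for t
    unfolding kbl_def
  proof (intro conjI allI)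
    show "bounded_linear (DY t)" using has_derivative_bounded_linear[OF DY_der[OF t]] .
    have t0: "(t, 0) \<in> ball a \<delta> \<times> ball 0 \<delta>" using t \<delta> by (simp add: dist_commute)
    show "DY t (sU c x) = sU c (DY t x)" for c x
      using \<Gamma>_scale[OF t0, of c "(0, P x)"] by (simp add: DY_def pscale_def P_lin(5) U.scale_right_diff_distrib)
  qed
  then show "\<forall>\<^sub>F t in nhds a. kbl sU sU (DY t)"
    unfolding eventually_nhds_metric using \<delta>(1) by blast
qed

lemma dom_nbhd:
  "\<exists>Op. open Op \<and> \<U> = Op \<inter> (\<Omega> \<times> Nk)"
  by (intro exI[of _ "ball a \<delta> \<times> ball 0 \<delta>"]) (simp add: \<U>_def open_Times)

lemma center_in_dom: "(a, 0) \<in> \<U>"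
  using \<delta> by (simp add: dom_iff Nk_def)

lemma Y_zero:
  assumes hyp: "(t, 0) \<in> \<U>"
  shows "Y (t, 0) = 0"
  using Y_dom[OF hyp] \<gamma>_zero[of t] hyp by (simp add: dom_iff)

end

theorem theorem1p2:
  fixes sU :: "'k::{real_normed_field,banach} \<Rightarrow> 'u::banach \<Rightarrow> 'u"
    and sV :: "'k \<Rightarrow> 'v::banach \<Rightarrow> 'v"
    and \<Omega> :: "'k set" and lam0 :: 'k
    and L :: "'k \<Rightarrow> ('u \<Rightarrow>\<^sub>L 'v)"
    and N :: "'k \<times> 'u \<Rightarrow> 'v"
    and P :: "'u \<Rightarrow> 'u" and Q :: "'v \<Rightarrow> 'v"
  assumes sU: "kspace sU" and sV: "kspace sV"
    and \<Omega>: "open \<Omega>" "lam0 \<in> \<Omega>"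
    and Lfred: "\<forall>lam\<in>\<Omega>. fredholm0 sU sV (blinfun_apply (L lam))"
    and LC1: "kC1_on (*) (bscale sV) \<Omega> L"
    and NC1: "kC1_on (pscale (*) sU) sV (\<Omega> \<times> UNIV) N"
    and N0: "\<exists>\<delta>>0. \<forall>lam. dist lam lam0 < \<delta> \<longrightarrow>
               N (lam, 0) = 0 \<and> ((\<lambda>u. N (lam, u)) has_derivative (\<lambda>_. 0)) (at 0)"
    and PQ: "tproj_pair sU sV (blinfun_apply (L lam0)) P Q"
  shows
   "let F = (\<lambda>lam u. L lam u + N (lam, u));
        Nk = {x. L lam0 x = 0};
        Ry = range (\<lambda>u. u - P u);
        L11inv = (\<lambda>lam. the_inv_into Ry (\<lambda>y. Q (L lam y)));
        L12 = (\<lambda>lam x. Q (L lam (P x)));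
        L21 = (\<lambda>lam y. L lam (y - P y) - Q (L lam (y - P y)));
        L22 = (\<lambda>lam x. L lam (P x) - Q (L lam (P x)))
    in \<exists>\<U> Y.
        (\<exists>Op. open Op \<and> \<U> = Op \<inter> (\<Omega> \<times> Nk)) \<and> (lam0, 0) \<in> \<U> \<and>
        kC1_on (pscale (*) sU) sU \<U> Y \<and>
        (\<forall>p\<in>\<U>. Y p \<in> Ry) \<and>
        (\<forall>lam. (lam, 0) \<in> \<U> \<longrightarrow> Y (lam, 0) = 0) \<and>
        (\<forall>lam x. (lam, x) \<in> \<U> \<longrightarrow> Q (F lam (x + Y (lam, x))) = 0) \<and>
        (\<forall>Y'. kC1_on (pscale (*) sU) sU \<U> Y' \<and> (\<forall>p\<in>\<U>. Y' p \<in> Ry) \<and>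
              (\<forall>lam. (lam, 0) \<in> \<U> \<longrightarrow> Y' (lam, 0) = 0) \<and>
              (\<forall>lam x. (lam, x) \<in> \<U> \<longrightarrow> Q (F lam (x + Y' (lam, x))) = 0)
              \<longrightarrow> (\<forall>p\<in>\<U>. Y' p = Y p)) \<and>
        (\<exists>W. open W \<and> (lam0, 0) \<in> W \<and>
              (\<forall>lam u. (lam, u) \<in> W \<longrightarrow> (lam, P u) \<in> \<U> \<and>
                   (Q (F lam u) = 0 \<longleftrightarrow> u - P u = Y (lam, P u)))) \<and>
        (\<exists>DY :: 'k \<Rightarrow> 'u \<Rightarrow> 'u.
           (\<forall>lam. (lam, 0) \<in> \<U> \<longrightarrow>
              bij_betw (\<lambda>y. Q (L lam y)) Ry (range Q) \<and>
              ((\<lambda>x. Y (lam, x)) has_derivative DY lam) (at 0 within Nk) \<and>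
              (\<forall>x\<in>Nk. DY lam x = - L11inv lam (L12 lam x)) \<and>
              (\<forall>x\<in>Nk. L lam (x + DY lam x) - Q (L lam (x + DY lam x))
                        = L22 lam x - L21 lam (L11inv lam (L12 lam x)))) \<and>
           (\<forall>r. classA sU sV \<Omega> lam0 r L \<longrightarrow>
              (\<forall>n e f. kbasis sU Nk n e \<and> kbasis sV (range (\<lambda>v. v - Q v)) n f \<longrightarrow>
                 has_order
                   (\<lambda>lam. map_det sV n e f (\<lambda>x. L lam (x + DY lam x) - Q (L lam (x + DY lam x))))
                   lam0 (alg_mult sU sV \<Omega> r L lam0))))"
proof -
  obtain L' :: "'k \<Rightarrow> ('k \<Rightarrow>\<^sub>L ('u \<Rightarrow>\<^sub>L 'v))" where L':
    "\<forall>p\<in>\<Omega>. (L has_derivative blinfun_apply (L' p)) (at p within \<Omega>) \<and> (\<forall>a h. L' p (a * h) = bscale sV a (L' p h))"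
    "continuous_on \<Omega> L'"
    using LC1 unfolding kC1_on_def by (elim exE conjE) (rule that)
  obtain N' :: "'k \<times> 'u \<Rightarrow> (('k \<times> 'u) \<Rightarrow>\<^sub>L 'v)" where N':
    "\<forall>p\<in>\<Omega> \<times> UNIV. (N has_derivative blinfun_apply (N' p)) (at p within \<Omega> \<times> UNIV) \<and>
       (\<forall>a h. N' p (pscale (*) sU a h) = sV a (N' p h))"
    "continuous_on (\<Omega> \<times> UNIV) N'"
    using NC1 unfolding kC1_on_def by (elim exE conjE) (rule that)
  obtain \<delta>\<^sub>N where \<delta>\<^sub>N: "\<delta>\<^sub>N > 0" "\<forall>lam. dist lam lam0 < \<delta>\<^sub>N \<longrightarrow>
      N (lam, 0) = 0 \<and> ((\<lambda>u. N (lam, u)) has_derivative (\<lambda>_. 0)) (at 0)"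
    using N0 by blast
  \<comment> \<open>\<open>kC1_on\<close> differentiates within the set; on the open set \<Omega>
    this is the full derivative.\<close>
  have L_der: "(L has_derivative blinfun_apply (L' t)) (at t)" if "t \<in> \<Omega>" for t
    using bspec[OF L'(1) that, THEN conjunct1] unfolding at_within_open[OF that \<Omega>(1)] .
  have open_prod: "open (\<Omega> \<times> (UNIV :: 'u set))" using \<Omega>(1) by (simp add: open_Times)
  interpret R: ls_nonlinear sU sV \<Omega> lam0 L P Q N L' N' \<delta>\<^sub>N
  proof
    show "kbl sU sV (blinfun_apply (L t))" if "t \<in> \<Omega>" for t
      using Lfred that unfolding fredholm0_def by blast
    show "continuous_on \<Omega> L"
      by (intro continuous_at_imp_continuous_on ballI has_derivative_continuous[OF L_der])
    show "(N has_derivative blinfun_apply (N' p)) (at p)" if "p \<in> \<Omega> \<times> UNIV" for p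
      using bspec[OF N'(1) that, THEN conjunct1] unfolding at_within_open[OF that open_prod] .
    show "L' t (c * h) = bscale sV c (L' t h)" if "t \<in> \<Omega>" for t c h
      using bspec[OF L'(1) that, THEN conjunct2] by blast
    show "N' p (pscale (*) sU c h) = sV c (N' p h)" if "p \<in> \<Omega> \<times> UNIV" for p c h
      using bspec[OF N'(1) that, THEN conjunct2] by blast
    show "N (t, 0) = 0" "((\<lambda>u. N (t, u)) has_derivative (\<lambda>_. 0)) (at 0)" if "dist t lam0 < \<delta>\<^sub>N" for t
      using \<delta>\<^sub>N(2) that by blast+
  qed (fact sU sV \<Omega> PQ L'(2) N'(2) \<delta>\<^sub>N(1) L_der)+
  obtain \<rho> \<delta> \<gamma> \<Gamma> where \<delta>: "0 < \<delta>" "\<delta> \<le> \<rho>" and ball_\<Omega>: "\<And>t. dist t lam0 < \<delta> \<Longrightarrow> t \<in> \<Omega>"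
    and sol: "\<And>t x. dist t lam0 < \<delta> \<Longrightarrow> norm x < \<delta> \<Longrightarrow>
        P (\<gamma> (t, x)) + R.S (R.F t (\<gamma> (t, x))) = x \<and> norm (\<gamma> (t, x)) < \<rho> / 2"
    and uniq: "\<And>t u x. dist t lam0 < \<rho> \<Longrightarrow> norm u < \<rho> \<Longrightarrow> P u + R.S (R.F t u) = x \<Longrightarrow> \<gamma> (t, x) = u"
    and \<gamma>_der: "\<And>p. p \<in> ball lam0 \<delta> \<times> ball 0 \<delta> \<Longrightarrow> (\<gamma> has_derivative blinfun_apply (\<Gamma> p)) (at p)"
    and \<Gamma>_scale: "\<And>p c h. p \<in> ball lam0 \<delta> \<times> ball 0 \<delta> \<Longrightarrow> \<Gamma> p (pscale (*) sU c h) = sU c (\<Gamma> p h)"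
    and \<Gamma>_cont: "continuous_on (ball lam0 \<delta> \<times> ball 0 \<delta>) \<Gamma>"
    and \<gamma>_zero: "\<And>t. dist t lam0 < \<delta> \<Longrightarrow> \<gamma> (t, 0) = 0"
    and A_\<Gamma>: "\<And>t k. dist t lam0 < \<delta> \<Longrightarrow> R.A t (\<Gamma> (t, 0) (0, k)) = k"
    and A_id: "\<And>t. dist t lam0 < \<delta> \<Longrightarrow> norm (R.A t - id_blinfun) \<le> 1/2"
    by (rule R.reduction) (rule that)
  interpret M: ls_reduced sU sV \<Omega> lam0 L P Q N L' N' \<delta>\<^sub>N \<rho> \<delta> \<gamma> \<Gamma>
    by unfold_locales (fact \<delta> ball_\<Omega> sol uniq \<gamma>_der \<Gamma>_scale \<Gamma>_cont \<gamma>_zero A_\<Gamma> A_id)+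
  show ?thesis
    unfolding Let_def M.Nk_def[symmetric] M.Ry_def[symmetric]
  proof (rule exI[of _ M.\<U>], rule exI[of _ M.Y], intro conjI)
    show "\<exists>Op. open Op \<and> M.\<U> = Op \<inter> (\<Omega> \<times> M.Nk)" by (rule M.dom_nbhd)
    show "(lam0, 0) \<in> M.\<U>" by (rule M.center_in_dom)
    show "kC1_on (pscale (*) sU) sU M.\<U> M.Y" by (rule M.Y_C1)
    show "\<forall>p\<in>M.\<U>. M.Y p \<in> M.Ry" by (simp add: M.Y_Ry)
    show "\<forall>t. (t, 0) \<in> M.\<U> \<longrightarrow> M.Y (t, 0) = 0" by (simp add: M.Y_zero)
    show "\<forall>t x. (t, x) \<in> M.\<U> \<longrightarrow> Q (L t (x + M.Y (t, x)) + N (t, x + M.Y (t, x))) = 0"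
      by (simp add: M.Y_solves)
    show "\<forall>Y'. kC1_on (pscale (*) sU) sU M.\<U> Y' \<and> (\<forall>p\<in>M.\<U>. Y' p \<in> M.Ry) \<and>
        (\<forall>t. (t, 0) \<in> M.\<U> \<longrightarrow> Y' (t, 0) = 0) \<and>
        (\<forall>t x. (t, x) \<in> M.\<U> \<longrightarrow> Q (L t (x + Y' (t, x)) + N (t, x + Y' (t, x))) = 0) \<longrightarrow>
        (\<forall>p\<in>M.\<U>. Y' p = M.Y p)"
      by (intro allI impI ballI, elim conjE) (rule M.Y_unique)
  qed (rule M.local_zeros, rule exI[of _ M.DY], intro conjI allI impI ballI M.L11_bij M.DY_der M.DY_eq M.bifurcation_operator_eq[OF _ _ refl] M.has_order_bifurcation, auto simp: M.dom_iff)
qed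

end
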